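(* Let $d\ge2$, $1\le k\le d-1$ and $j\ge0$ integers. There are constants $\alpha_1,\alpha_2,\beta_2,\beta_3$ depending only on $d,k,j$ such that for every $K\in\mathcal{K}^d$, setting $I_j(K):=\int_{A_{d,k}}\frac{d^j}{d\epsilon^j}\Big|_{\epsilon=0}\left[\int_{(K\cap E)_\epsilon}|s|^2\,dm_k(s)\right]d\mu_k(E)$ and $V_j(K):=\frac{d^j}{d\epsilon^j}\Big|_{\epsilon=0}\int_{K+\epsilon B}|s|^2\,dm_d(s)$, we have $I_j(K)=\alpha_1V_j(K)$ if $j=0,1$; $I_j(K)=\alpha_2V_j(K)+\beta_2W_{j-2}(K)$ if $2\le j\le k$; $I_j(K)=\beta_3W_{j-2}(K)$ if $j=k+1,k+2$; $I_j(K)=0$ if $j>k+2$.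
   Context: $\mathcal{K}^d$: nonempty compact convex subsets of $\mathbb{R}^d$; $B$ the Euclidean unit ball of $\mathbb{R}^d$; $m_i$ denotes $i$-dimensional Lebesgue measure. $A_{d,k}$ is the manifold of $k$-dimensional affine subspaces of $\mathbb{R}^d$ with its motion-invariant Haar measure $\mu_k$ in the standard normalization ($\mu_k$ is the image of $\nu_k\otimes m_{d-k}$ under $(L,y)\mapsto L+y$, $L$ a linear $k$-subspace with normalized Haar probability measure $\nu_k$, $y\in L^\perp$). For an affine subspace $E$ with parallel linear subspace $\bar E$ and compact convex $M\subset E$, $M_\epsilon:=M+\epsilon(B\cap\bar E)$ (and $M_\epsilon=\emptyset$ if $M=\emptyset$); $\epsilon\mapsto\int_{M_\epsilon}|s|^2dm_k(s)$ is a polynomial for $\epsilon\ge0$. Quermassintegrals $W_i(K)$ are defined by $\mathrm{vol}_d(K+\epsilon B)=\sum_{i=0}^d\binom di W_i(K)\epsilon^i$. *)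

theory Defs
  imports "HOL-Analysis.Analysis" "HOL-Computational_Algebra.Polynomial"
begin

definition onb :: "'a::euclidean_space set \<Rightarrow> nat \<Rightarrow> 'a" where
  "onb S = (SOME b. (\<forall>i<dim S. \<forall>l<dim S. b i \<bullet> b l = (if i = l then 1 else 0))
                    \<and> span (b ` {..<dim S}) = S)"

definition lebesgue_subspace :: "'a::euclidean_space set \<Rightarrow> 'a measure" where
  "lebesgue_subspace S =
     distr (PiM {..<dim S} (\<lambda>_. lborel)) borel (\<lambda>t. \<Sum>i<dim S. t i *\<^sub>R onb S i)"

definition lin_part :: "'a::euclidean_space set \<Rightarrow> 'a set" where
  "lin_part E = {x - y | x y. x \<in> E \<and> y \<in> E}"

definition lebesgue_affine :: "'a::euclidean_space set \<Rightarrow> 'a measure" where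
  "lebesgue_affine E = distr (lebesgue_subspace (lin_part E)) borel (\<lambda>x. x + (SOME a. a \<in> E))"

definition par_in :: "'a::euclidean_space set \<Rightarrow> 'a set \<Rightarrow> real \<Rightarrow> 'a set" where
  "par_in E M \<epsilon> = {x + \<epsilon> *\<^sub>R u | x u. x \<in> M \<and> u \<in> lin_part E \<and> norm u \<le> 1}"

definition par_body :: "'a::euclidean_space set \<Rightarrow> real \<Rightarrow> 'a set" where
  "par_body K \<epsilon> = {x + \<epsilon> *\<^sub>R u | x u. x \<in> K \<and> norm u \<le> 1}"

definition deriv0 :: "nat \<Rightarrow> (real \<Rightarrow> real) \<Rightarrow> real" where
  "deriv0 j f = (THE c. \<exists>p :: real poly. (\<forall>\<epsilon>\<ge>0. f \<epsilon> = poly p \<epsilon>) \<and> c = (deriv ^^ j) (poly p) 0)"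

definition quermass :: "nat \<Rightarrow> 'a::euclidean_space set \<Rightarrow> real" where
  "quermass i K = (THE w. \<exists>W :: nat \<Rightarrow> real.
      (\<forall>\<epsilon>\<ge>0. measure lborel (par_body K \<epsilon>) = (\<Sum>l\<le>DIM('a). real (DIM('a) choose l) * W l * \<epsilon> ^ l))
      \<and> w = W i)"

definition grass :: "nat \<Rightarrow> 'a::euclidean_space set set" where
  "grass k = {L. subspace L \<and> dim L = k}"

text \<open>Borel sigma-algebra of the (Fell) topology on G(d,k), generated by the hitting sets.\<close>
definition grass_space :: "nat \<Rightarrow> 'a::euclidean_space set measure" where
  "grass_space k = sigma (grass k) {{L \<in> grass k. L \<inter> C \<noteq> {}} | C. compact C}"

definition haar_grass :: "nat \<Rightarrow> 'a::euclidean_space set measure" where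
  "haar_grass k = (THE M. sets M = sets (grass_space k) \<and> emeasure M (space M) = 1 \<and>
       (\<forall>f. orthogonal_transformation f \<longrightarrow> distr M (grass_space k) (\<lambda>L. f ` L) = M))"

text \<open>Integral over A(d,k) w.r.t. mu_k = image of nu_k \<otimes> m_(d-k) under (L,y) \<mapsto> L + y, y \<in> L^\<bottom>.\<close>
definition int_affgrass :: "nat \<Rightarrow> ('a::euclidean_space set \<Rightarrow> real) \<Rightarrow> real" where
  "int_affgrass k F = (\<integral>L. (\<integral>y. F ((\<lambda>x. x + y) ` L) \<partial>lebesgue_subspace (orthogonal_comp L)) \<partial>haar_grass k)"

definition I_j :: "nat \<Rightarrow> nat \<Rightarrow> 'a::euclidean_space set \<Rightarrow> real" where
  "I_j k j K = int_affgrass k (\<lambda>E. deriv0 j (\<lambda>\<epsilon>.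
       \<integral>s. indicator (par_in E (K \<inter> E) \<epsilon>) s * (norm s)\<^sup>2 \<partial>lebesgue_affine E))"

definition V_j :: "nat \<Rightarrow> 'a::euclidean_space set \<Rightarrow> real" where
  "V_j j K = deriv0 j (\<lambda>\<epsilon>. \<integral>s. indicator (par_body K \<epsilon>) s * (norm s)\<^sup>2 \<partial>lborel)"

end

theory Submission
  imports Defs "HOL-Probability.Probability"
begin

text \<open>For an affine subspace \<open>E = L + y\<close>, the union over \<open>y\<close> of the sets \<open>(K \<inter> E)\<^sub>\<epsilon>\<close>
  is \<open>K + \<epsilon> (B \<inter> L)\<close>, so by Fubini \<open>I_j\<close> is, up to a constant, the \<open>j\<close>-th derivative at \<open>0\<close> of the average over \<open>L\<close> of
  \<open>\<integral> \<bar>s\<bar>\<^sup>2\<close> over \<open>K + \<epsilon> (B \<inter> L)\<close>.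
  Write \<open>p\<close> for the point of \<open>K \<inter> (s + L)\<close> nearest to \<open>s\<close> and \<open>v = s - p\<close>. Dilating along \<open>L\<close> expresses the
  integral of \<open>\<bar>s\<bar>\<^sup>2 - \<bar>p\<bar>\<^sup>2 = 2 p \<bullet> v + \<bar>v\<bar>\<^sup>2\<close> through the volumes of \<open>K + r (B \<inter> L)\<close>, with shift of the degree by \<open>2\<close>.
  For a polytope the integral of a function of \<open>p\<close> splits over the faces, each contributing a monomial in \<open>\<epsilon>\<close>,
  and by rotation invariance its average over \<open>L\<close> is a multiple, depending only on the codimension \<open>j\<close> of the
  face and vanishing for \<open>j > k\<close>, of the contribution for \<open>L\<close> the whole space. Comparing the
  coefficients of \<open>\<epsilon>\<^sup>j\<close> gives the relation for polytopes, and outer approximation gives it in general.\<close>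

section \<open>Orthogonal projections\<close>

text \<open>The part of the squared norm carried by \<open>s - p\<close> contributes in degree
  \<open>j\<close> a multiple of the volume coefficient of degree \<open>j - 2\<close>, and the
  multiple involves \<open>dim L\<close>. It is therefore different on the averaged side and on the
  side of \<open>V_j\<close>; \<open>correction\<close> records the difference. Vanishing for large
  \<open>j\<close> is linear algebra: a normal space of dimension above \<open>k\<close> cannot be
  projected injectively into \<open>L\<close>. Differentiation at \<open>0\<close> is never
  exchanged with limits or integrals. All functions of \<open>\<epsilon>\<close> involved are
  polynomials of known degree, and their coefficients are fixed linear combinations of values at
  finitely many positive radii; so coefficients pass through approximation and integration as soon
  as values do. The notions are given by descriptions (\<open>THE\<close>) and choices
  (\<open>SOME\<close>): the Haar measure has to be constructed and shown unique on the
  sigma-algebra of hitting sets, and the chosen basis \<open>onb L\<close> offers no measurable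
  dependence on \<open>L\<close>, so arguments that vary \<open>L\<close> run through its orthogonal
  projection.\<close>

lemma onb_exists:
  fixes S :: "'a::euclidean_space set"
  assumes "subspace S"
  shows "\<exists>b. (\<forall>i<dim S. \<forall>l<dim S. b i \<bullet> b l = (if i = l then 1 else 0))
                    \<and> span (b ` {..<dim S}) = S"
proof -
  obtain B where B: "B \<subseteq> S" "pairwise orthogonal B" "\<And>x. x \<in> B \<Longrightarrow> norm x = 1"
      "independent B" "card B = dim S" "span B = S"
    by (rule orthonormal_basis_subspace[OF assms]) (auto)
  have "finite B" using B(4) by (rule independent_imp_finite)
  then obtain b where b: "bij_betw b {..<dim S} B"
    using B(5) by (metis atLeast0LessThan ex_bij_betw_nat_finite)
  show ?thesis
  proof (intro exI[of _ b] conjI allI impI)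
    fix i l assume il: "i < dim S" "l < dim S"
    then have "b i \<in> B" "b l \<in> B" using b by (auto simp: bij_betw_def)
    moreover have "i \<noteq> l \<Longrightarrow> b i \<noteq> b l" using b il by (auto simp: bij_betw_def inj_on_def)
    ultimately show "b i \<bullet> b l = (if i = l then 1 else 0)"
      using B(2,3) by (auto simp: pairwise_def orthogonal_def norm_eq_1)
  next
    show "span (b ` {..<dim S}) = S" using b B(6) by (simp add: bij_betw_def)
  qed
qed

lemma
  fixes S :: "'a::euclidean_space set"
  assumes "subspace S"
  shows onb_inner: "i < dim S \<Longrightarrow> l < dim S \<Longrightarrow> onb S i \<bullet> onb S l = (if i = l then 1 else 0)"
    and onb_span: "span (onb S ` {..<dim S}) = S"
  using someI_ex[OF onb_exists[OF assms]] unfolding onb_def[symmetric] by auto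

lemma onb_in: "subspace S \<Longrightarrow> i < dim S \<Longrightarrow> onb S i \<in> S"
  using onb_span[of S] by (metis imageI lessThan_iff span_base)

text \<open>Built from the arbitrary basis \<open>onb S\<close>, yet independent of it on subspaces
  by \<open>proj_unique\<close>. The formula is linear for every set \<open>S\<close>, which makes
  \<open>proj L x\<close> a total function of \<open>L\<close>.\<close>

definition proj :: "'a::euclidean_space set \<Rightarrow> 'a \<Rightarrow> 'a" where
  "proj S x = (\<Sum>i<dim S. (x \<bullet> onb S i) *\<^sub>R onb S i)"

lemma linear_proj: "linear (proj S)"
  unfolding proj_def
  by (rule linearI) (simp_all add: inner_add_left scaleR_add_left sum.distrib scaleR_sum_right)

lemma bounded_linear_proj: "bounded_linear (proj S)"
  using linear_proj linear_conv_bounded_linear by blast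

lemmas proj_add = linear_add[OF linear_proj]
  and proj_diff = linear_diff[OF linear_proj]
  and proj_scaleR = linear_cmul[OF linear_proj]

lemma proj_0 [simp]: "proj S 0 = 0"
  using linear_proj linear_0 by blast

lemma continuous_on_proj [continuous_intros]: "continuous_on X f \<Longrightarrow> continuous_on X (\<lambda>x. proj S (f x))"
  by (rule bounded_linear.continuous_on[OF bounded_linear_proj])

lemma proj_in: "subspace S \<Longrightarrow> proj S x \<in> S"
  unfolding proj_def by (intro subspace_sum subspace_mul onb_in) auto

lemma proj_orth:
  assumes "subspace S" "y \<in> S"
  shows "(x - proj S x) \<bullet> y = 0"
proof -
  have "y \<in> span (onb S ` {..<dim S})" using assms onb_span by blast
  then show ?thesis
  proof (induction rule: span_induct)
    case base
    have "subspace {y. y \<bullet> (x - proj S x) = 0}" by (rule subspace_hyperplane2)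
    then show ?case by (simp add: inner_commute)
  next
    case (step y)
    then obtain l where l: "l < dim S" "y = onb S l" by auto
    have "proj S x \<bullet> onb S l = (\<Sum>i<dim S. (x \<bullet> onb S i) * (if i = l then 1 else 0))"
      unfolding proj_def inner_sum_left inner_scaleR_left
      by (intro sum.cong refl) (use onb_inner[OF assms(1)] l in auto)
    also have "\<dots> = x \<bullet> onb S l" using l by (simp add: if_distrib cong: if_cong)
    finally show ?case using l by (simp add: inner_diff_left)
  qed
qed

text \<open>Any other candidate differs from \<open>proj S x\<close> by a vector of \<open>S\<close>
  that is orthogonal to itself.\<close>

lemma proj_unique:
  assumes "subspace S" "y \<in> S" "\<And>z. z \<in> S \<Longrightarrow> (x - y) \<bullet> z = 0"
  shows "proj S x = y"
proof -
  have m: "proj S x - y \<in> S" using assms proj_in subspace_diff by blast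
  have "(proj S x - y) \<bullet> (proj S x - y) = (x - y) \<bullet> (proj S x - y) - (x - proj S x) \<bullet> (proj S x - y)"
    by (simp add: inner_diff_left)
  also have "\<dots> = 0" using assms(3)[OF m] proj_orth[OF assms(1) m] by simp
  finally show ?thesis by simp
qed

lemma proj_id: "subspace S \<Longrightarrow> x \<in> S \<Longrightarrow> proj S x = x"
  by (rule proj_unique) auto

lemma proj_eq_iff: "subspace S \<Longrightarrow> proj S x = x \<longleftrightarrow> x \<in> S"
  using proj_id proj_in by metis

lemma proj_idem [simp]: "subspace S \<Longrightarrow> proj S (proj S x) = proj S x"
  by (simp add: proj_id proj_in)

lemma proj_eq_0_iff: "subspace S \<Longrightarrow> proj S x = 0 \<longleftrightarrow> (\<forall>z\<in>S. x \<bullet> z = 0)"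
  using proj_orth[of S _ x] proj_unique[of S 0 x] by (auto simp: subspace_0)

lemma proj_UNIV [simp]: "proj UNIV x = x"
  by (rule proj_id) auto

lemma inner_proj_left: "subspace S \<Longrightarrow> proj S x \<bullet> y = proj S x \<bullet> proj S y"
  using proj_orth[of S "proj S x" y] proj_in[of S x] by (simp add: inner_diff_left) (metis inner_commute)

lemma proj_selfadj: "subspace S \<Longrightarrow> proj S x \<bullet> y = x \<bullet> proj S y"
  by (metis inner_commute inner_proj_left)

lemma inner_proj_in: "subspace S \<Longrightarrow> y \<in> S \<Longrightarrow> proj S x \<bullet> y = x \<bullet> y"
  by (simp add: proj_selfadj proj_id)

lemma proj_pythagoras: "subspace S \<Longrightarrow> (norm x)\<^sup>2 = (norm (proj S x))\<^sup>2 + (norm (x - proj S x))\<^sup>2"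
  using proj_orth[of S "proj S x" x] proj_in[of S x]
  by (simp add: power2_norm_eq_inner inner_diff_left inner_diff_right inner_commute)

lemma norm_proj_le: "subspace S \<Longrightarrow> norm (proj S x) \<le> norm x"
  using proj_pythagoras[of S x] by (metis le_add_same_cancel1 norm_ge_zero power2_le_imp_le zero_le_power2)

lemma proj_dist_le:
  assumes "subspace S" "y \<in> S"
  shows "norm (x - proj S x) \<le> norm (x - y)"
proof -
  have "proj S (x - y) = proj S x - y" using assms by (simp add: proj_diff proj_id)
  then have "(x - y) - proj S (x - y) = x - proj S x" by simp
  then show ?thesis using proj_pythagoras[OF assms(1), of "x - y"]
    by (metis le_add_same_cancel2 norm_ge_zero power2_le_imp_le zero_le_power2)
qed

lemma proj_perp: "subspace S \<Longrightarrow> proj S (x - proj S x) = 0"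
  by (simp add: proj_diff)

section \<open>Orthogonal maps, complements and reflections\<close>

lemma orthogonal_transformation_add: "orthogonal_transformation h \<Longrightarrow> h (x + y) = h x + h y"
  by (simp add: orthogonal_transformation_def linear_add)

lemma orthogonal_transformation_diff: "orthogonal_transformation h \<Longrightarrow> h (x - y) = h x - h y"
  by (simp add: orthogonal_transformation_def linear_diff)

lemma orthogonal_transformation_inner: "orthogonal_transformation h \<Longrightarrow> h x \<bullet> h y = x \<bullet> y"
  by (simp add: orthogonal_transformation_def)

lemma subspace_orth_image: "orthogonal_transformation h \<Longrightarrow> subspace S \<Longrightarrow> subspace (h ` S)"
  by (simp add: linear_subspace_image orthogonal_transformation_linear)

lemma dim_orth_image: 
  fixes h :: "'a::euclidean_space \<Rightarrow> 'a"
  shows "orthogonal_transformation h \<Longrightarrow> dim (h ` S) = dim S"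
  by (rule dim_image_eq) (auto simp: orthogonal_transformation_linear intro: inj_on_subset orthogonal_transformation_inj)

lemma proj_orth_image:
  assumes "orthogonal_transformation h" "subspace S"
  shows "proj (h ` S) (h x) = h (proj S x)"
proof (rule proj_unique)
  show "subspace (h ` S)" using assms by (rule subspace_orth_image)
  show "h (proj S x) \<in> h ` S" using assms proj_in by auto
  show "(h x - h (proj S x)) \<bullet> z = 0" if "z \<in> h ` S" for z
    using that assms proj_orth[of S _ x]
    by (auto simp flip: orthogonal_transformation_diff simp: orthogonal_transformation_inner)
qed

lemma orth_comp_mem: "subspace L \<Longrightarrow> y \<in> L\<^sup>\<bottom> \<longleftrightarrow> proj L y = 0"
  by (auto simp: orthogonal_comp_def orthogonal_def proj_eq_0_iff inner_commute)

lemma dim_orth_comp: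
  fixes L :: "'a::euclidean_space set"
  assumes "subspace L" shows "dim (L\<^sup>\<bottom>) = DIM('a) - dim L"
proof -
  have "dim {y \<in> UNIV. \<forall>x \<in> L. orthogonal x y} + dim L = dim (UNIV::'a set)"
    by (rule dim_subspace_orthogonal_to_vectors) (use assms in auto)
  then show ?thesis by (simp add: orthogonal_comp_def)
qed

text \<open>Householder reflection in the hyperplane orthogonal to \<open>z\<close>. For
  \<open>z = 0\<close> division by zero makes it the identity, so it is orthogonal for every
  \<open>z\<close>.\<close>

definition reflect :: "'a::euclidean_space \<Rightarrow> 'a \<Rightarrow> 'a" where
  "reflect z x = x - (2 * (x \<bullet> z) / (z \<bullet> z)) *\<^sub>R z"

lemma reflect_orth: "orthogonal_transformation (reflect z)"
  unfolding orthogonal_transformation_def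
proof
  show "linear (reflect z)"
    by (rule linearI) (simp_all add: reflect_def inner_add_left scaleR_diff_right scaleR_add_left
        algebra_simps add_divide_distrib)
  show "\<forall>v w. reflect z v \<bullet> reflect z w = v \<bullet> w"
    by (cases "z = 0") (auto simp: reflect_def inner_diff_left inner_diff_right inner_commute field_simps)
qed

text \<open>With equal norms, twice the inner product of \<open>x\<close> and \<open>x - y\<close>
  is the squared length of \<open>x - y\<close>, so the coefficient in the reflection of
  \<open>x\<close> is \<open>1\<close>.\<close>

lemma reflect_swap:
  assumes "norm x = norm y" shows "reflect (x - y) x = y"
proof (cases "x = y")
  case False
  have "x \<bullet> x = y \<bullet> y" using assms by (metis norm_eq)
  then have e: "(x - y) \<bullet> (x - y) = 2 * (x \<bullet> (x - y))"
    by (simp add: inner_diff_left inner_diff_right inner_commute)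
  have "(x - y) \<bullet> (x - y) \<noteq> 0" using False by simp
  then show ?thesis unfolding reflect_def e[symmetric] by simp
qed (simp add: reflect_def)

lemma reflect_subspace:
  assumes "subspace S" "z \<in> S" shows "reflect z ` S = S"
proof -
  have sub: "reflect z x \<in> S" if "x \<in> S" for x
    using assms that by (simp add: reflect_def subspace_diff subspace_mul)
  have "reflect z (reflect z x) = x" for x
    by (cases "z = 0") (auto simp: reflect_def inner_diff_left field_simps)
  then show ?thesis using sub by (metis (no_types, lifting) image_eqI image_subset_iff subsetI subset_antisym)
qed

text \<open>Isometries between the subspaces and between their complements, which also have equal
  dimension, are glued along the orthogonal decomposition; Pythagoras makes the glued map an
  isometry.\<close>

lemma orth_trans_subspaces:
  fixes S S' :: "'a::euclidean_space set"
  assumes S: "subspace S" "subspace S'" "dim S = dim S'"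
  obtains h where "orthogonal_transformation h" "h ` S = S'"
proof -
  obtain f where f: "linear f" "f ` S = S'" "\<And>x. x \<in> S \<Longrightarrow> norm (f x) = norm x"
    using isometries_subspaces[OF S] by metis
  have "dim (S\<^sup>\<bottom>) = dim (S'\<^sup>\<bottom>)" using S by (simp add: dim_orth_comp)
  then obtain g where g: "linear g" "g ` (S\<^sup>\<bottom>) = S'\<^sup>\<bottom>" "\<And>x. x \<in> S\<^sup>\<bottom> \<Longrightarrow> norm (g x) = norm x"
    using isometries_subspaces[OF subspace_orthogonal_comp subspace_orthogonal_comp] by metis
  define h where "h x = f (proj S x) + g (x - proj S x)" for x
  have m: "x - proj S x \<in> S\<^sup>\<bottom>" for x using S by (simp add: orth_comp_mem proj_perp)
  have lh: "linear h" unfolding h_def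
    using f(1) g(1) by (auto intro!: linearI simp: proj_add proj_scaleR linear_add linear_diff linear_cmul algebra_simps)
  have "norm (h x) = norm x" for x
  proof -
    have a: "f (proj S x) \<in> S'" using S f proj_in by blast
    have b: "g (x - proj S x) \<in> S'\<^sup>\<bottom>" using m g by blast
    have "orthogonal (f (proj S x)) (g (x - proj S x))"
      using a b by (simp add: orthogonal_comp_def)
    then have "(norm (h x))\<^sup>2 = (norm (f (proj S x)))\<^sup>2 + (norm (g (x - proj S x)))\<^sup>2"
      unfolding h_def by (rule norm_add_Pythagorean)
    also have "\<dots> = (norm x)\<^sup>2" using f(3)[OF proj_in[OF S(1)]] g(3)[OF m] proj_pythagoras[OF S(1), of x] by simp
    finally show ?thesis by simp
  qed
  with lh have o: "orthogonal_transformation h" by (simp add: orthogonal_transformation)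
  have "h ` S = f ` S" using S g(1) by (auto simp: h_def proj_id linear_0 image_iff)
  with o f(2) that show thesis by blast
qed

text \<open>Once the subspaces are matched by \<open>f\<close>, a reflection swaps
  \<open>f x\<close> with \<open>y\<close>. Its axis \<open>f x - y\<close> lies in
  \<open>S'\<close>, so it preserves \<open>S'\<close>.\<close>

lemma orth_trans_subspaces_vec:
  fixes S S' :: "'a::euclidean_space set"
  assumes S: "subspace S" "subspace S'" "dim S = dim S'" "x \<in> S" "y \<in> S'" "norm x = norm y"
  obtains h where "orthogonal_transformation h" "h ` S = S'" "h x = y"
proof -
  obtain f where f: "orthogonal_transformation f" "f ` S = S'"
    using orth_trans_subspaces[OF S(1-3)] .
  have fx: "f x \<in> S'" using f S by blast
  have n: "norm (f x) = norm y" using f S orthogonal_transformation_norm by metis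
  have "reflect (f x - y) ` S' = S'" by (intro reflect_subspace S subspace_diff fx)
  then have "(reflect (f x - y) \<circ> f) ` S = S'" using f by (simp only: image_comp[symmetric])
  moreover have "orthogonal_transformation (reflect (f x - y) \<circ> f)"
    using f by (intro orthogonal_transformation_compose reflect_orth)
  ultimately show thesis
    using that[of "reflect (f x - y) \<circ> f"] reflect_swap[OF n] by simp
qed

section \<open>Measurability on the Grassmannian\<close>

text \<open>Compactness turns an uncountable existential into a countable condition: the infimum
  over \<open>C\<close> is attained, and by continuity smallness can be tested on the dense subset
  \<open>D\<close>.\<close>

lemma compact_exists_zero_iff:
  fixes g :: "'a::{metric_space,heine_borel} \<Rightarrow> real"
  assumes C: "compact C" and g: "continuous_on C g" "\<And>x. x \<in> C \<Longrightarrow> 0 \<le> g x"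
    and D: "D \<subseteq> C" "C \<subseteq> closure D"
  shows "(\<exists>x\<in>C. g x = 0) \<longleftrightarrow> (\<forall>n. \<exists>x\<in>D. g x < inverse (real (Suc n)))"
proof
  assume "\<exists>x\<in>C. g x = 0"
  then obtain x where x: "x \<in> C" "g x = 0" by blast
  show "\<forall>n. \<exists>x\<in>D. g x < inverse (real (Suc n))"
  proof
    fix n
    obtain \<delta> where "\<delta> > 0" and \<delta>: "\<And>y. y \<in> C \<Longrightarrow> dist y x < \<delta> \<Longrightarrow> dist (g y) (g x) < inverse (real (Suc n))"
      using g(1) x(1) unfolding continuous_on_iff by (metis inverse_positive_iff_positive of_nat_0_less_iff zero_less_Suc)
    obtain y where y: "y \<in> D" "dist y x < \<delta>"
      using D(2) x(1) \<open>\<delta> > 0\<close> by (meson closure_approachable subsetD)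
    have "g y < inverse (real (Suc n))" using \<delta>[of y] y D(1) x(2) by (auto simp: dist_real_def)
    with y show "\<exists>x\<in>D. g x < inverse (real (Suc n))" by blast
  qed
next
  assume *: "\<forall>n. \<exists>x\<in>D. g x < inverse (real (Suc n))"
  then have "C \<noteq> {}" using D(1) by blast
  then obtain x where x: "x \<in> C" "\<And>y. y \<in> C \<Longrightarrow> g x \<le> g y"
    using continuous_attains_inf[OF C _ g(1)] by blast
  have "g x < inverse (real (Suc n))" for n
    using * x(2) D(1) by (meson order_le_less_trans subsetD)
  then have "\<not> g x > 0" by (meson not_less_iff_gr_or_eq reals_Archimedean)
  with x(1) g(2) show "\<exists>x\<in>C. g x = 0" by force
qed

text \<open>The device behind the measurability proofs below: a condition quantified over a compact
  set is encoded as the vanishing of a nonnegative function that is continuous in the quantified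
  point and measurable in the parameter.\<close>

lemma sets_exists_compact:
  fixes g :: "'w \<Rightarrow> 'a::euclidean_space \<Rightarrow> real"
  assumes C: "compact C"
    and m: "\<And>x. x \<in> C \<Longrightarrow> (\<lambda>w. g w x) \<in> borel_measurable M"
    and c: "\<And>w. w \<in> space M \<Longrightarrow> continuous_on C (g w)"
    and pos: "\<And>w x. w \<in> space M \<Longrightarrow> x \<in> C \<Longrightarrow> 0 \<le> g w x"
  shows "{w \<in> space M. \<exists>x\<in>C. g w x = 0} \<in> sets M"
proof -
  obtain D where D: "countable D" "D \<subseteq> C" "C \<subseteq> closure D" using separable by blast
  have "{w \<in> space M. \<exists>x\<in>C. g w x = 0} = {w \<in> space M. \<forall>n. \<exists>x\<in>D. g w x < inverse (real (Suc n))}"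
    using compact_exists_zero_iff[OF C c pos D(2,3)] by blast
  also have "\<dots> = (\<Inter>n. \<Union>x\<in>D. {w \<in> space M. g w x < inverse (real (Suc n))})" by auto
  also have "\<dots> \<in> sets M"
  proof -
    have "{w \<in> space M. g w x < inverse (real (Suc n))} \<in> sets M" if "x \<in> D" for x n
      using m[of x] that D(2) borel_measurable_less by (auto intro!: borel_measurable_less)
    then show ?thesis using D(1) by (intro sets.countable_INT' sets.countable_UN') auto
  qed
  finally show ?thesis .
qed

lemma space_grass [simp]: "space (grass_space k) = grass k"
  unfolding grass_space_def by (rule space_measure_of) auto

text \<open>\<open>L\<close> hits \<open>cball x r\<close> exactly when \<open>x\<close> has
  distance at most \<open>r\<close> from \<open>L\<close>, so distances are measurable by the choice
  of generators. Pythagoras then gives the squared norm of the projection, and polarization its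
  components.\<close>

lemma measurable_grass_proj [measurable]: "(\<lambda>L. proj L x) \<in> borel_measurable (grass_space k)"
proof -
  have d: "(\<lambda>L. norm (x - proj L x)) \<in> borel_measurable (grass_space k)" for x :: 'a
  proof (rule borel_measurableI_le)
    fix r
    have "{L \<in> space (grass_space k). norm (x - proj L x) \<le> r} = {L \<in> grass k. L \<inter> cball x r \<noteq> {}}"
    proof -
      have "norm (x - proj L x) \<le> r \<longleftrightarrow> L \<inter> cball x r \<noteq> {}" if "L \<in> grass k" for L
      proof
        assume "norm (x - proj L x) \<le> r"
        then have "proj L x \<in> L \<inter> cball x r" using that by (auto simp: grass_def proj_in dist_norm)
        then show "L \<inter> cball x r \<noteq> {}" by blast
      next
        assume "L \<inter> cball x r \<noteq> {}"
        then obtain y where "y \<in> L" "norm (x - y) \<le> r" by (auto simp: dist_norm)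
        then show "norm (x - proj L x) \<le> r" using that proj_dist_le[of L y x] by (auto simp: grass_def)
      qed
      then show ?thesis by auto
    qed
    also have "\<dots> \<in> sets (grass_space k)"
      unfolding grass_space_def by (subst sets_measure_of) (auto intro!: sigma_sets.Basic)
    finally show "{L \<in> space (grass_space k). norm (x - proj L x) \<le> r} \<in> sets (grass_space k)" .
  qed
  have n: "(\<lambda>L. (norm (proj L x))\<^sup>2) \<in> borel_measurable (grass_space k)" for x :: 'a
  proof -
    have "(\<lambda>L. (norm x)\<^sup>2 - (norm (x - proj L x))\<^sup>2) \<in> borel_measurable (grass_space k)"
      using d by measurable
    then show ?thesis
      by (rule measurable_cong[THEN iffD1, rotated])
        (auto simp: grass_def proj_pythagoras[of _ x])
  qed
  show ?thesis
  proof (subst borel_measurable_euclidean_space, safe)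
    fix b :: 'a
    have "(\<lambda>L. ((norm (proj L (x + b)))\<^sup>2 - (norm (proj L (x - b)))\<^sup>2) / 4) \<in> borel_measurable (grass_space k)"
      using n by measurable
    then show "(\<lambda>L. proj L x \<bullet> b) \<in> borel_measurable (grass_space k)"
    proof (rule measurable_cong[THEN iffD1, rotated])
      fix L :: "'a set" assume "L \<in> space (grass_space k)"
      then have L: "subspace L" by (simp add: grass_def)
      show "((norm (proj L (x + b)))\<^sup>2 - (norm (proj L (x - b)))\<^sup>2) / 4 = proj L x \<bullet> b"
        using inner_proj_left[OF L, of x b]
        by (simp add: power2_norm_eq_inner proj_add proj_diff inner_add_left inner_add_right
            inner_diff_left inner_diff_right inner_commute field_simps)
    qed
  qed
qed

text \<open>Hitting a compact \<open>C\<close> means that some point of \<open>C\<close> has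
  distance zero from its projection, a condition of the kind treated by
  \<open>sets_exists_compact\<close>.\<close>

lemma measurable_into_grass:
  fixes f :: "'w \<Rightarrow> 'a::euclidean_space set"
  assumes s: "\<And>w. w \<in> space N \<Longrightarrow> f w \<in> grass k"
    and p: "\<And>x. (\<lambda>w. proj (f w) x) \<in> borel_measurable N"
  shows "f \<in> measurable N (grass_space k)"
  unfolding grass_space_def
proof (rule measurable_measure_of)
  show "f \<in> space N \<rightarrow> grass k" using s by auto
  fix A :: "'a set set" assume "A \<in> {{L \<in> grass k. L \<inter> C \<noteq> {}} | C. compact C}"
  then obtain C :: "'a set" where C: "A = {L \<in> grass k. L \<inter> C \<noteq> {}}" "compact C" by blast
  have "f -` A \<inter> space N = {w \<in> space N. \<exists>x\<in>C. norm (x - proj (f w) x) = 0}"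
  proof -
    have "f w \<in> A \<longleftrightarrow> (\<exists>x\<in>C. norm (x - proj (f w) x) = 0)" if "w \<in> space N" for w
    proof -
      have "x \<in> f w \<longleftrightarrow> norm (x - proj (f w) x) = 0" for x
        using s[OF that] proj_eq_iff[of "f w" x] by (auto simp: grass_def)
      then show ?thesis using s[OF that] unfolding C(1) by blast
    qed
    then show ?thesis by blast
  qed
  also have "\<dots> \<in> sets N"
  proof (rule sets_exists_compact[OF C(2)])
    show "(\<lambda>w. norm (x - proj (f w) x)) \<in> borel_measurable N" for x using p by measurable
    show "continuous_on C (\<lambda>x. norm (x - proj (f w) x))" for w by (intro continuous_intros)
  qed simp
  finally show "f -` A \<inter> space N \<in> sets N" .
qed blast

text \<open>By linearity only the values on \<open>Basis\<close> matter, so measurability at each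
  fixed vector already gives joint measurability.\<close>

lemma borel_measurable_pairI:
  fixes f :: "'w \<Rightarrow> 'a::euclidean_space \<Rightarrow> 'b::euclidean_space"
  assumes f: "\<And>x. (\<lambda>w. f w x) \<in> borel_measurable M" and lin: "\<And>w. linear (f w)"
  shows "(\<lambda>(w, x). f w x) \<in> borel_measurable (M \<Otimes>\<^sub>M borel)"
proof -
  have "(\<lambda>p. \<Sum>b\<in>Basis. (snd p \<bullet> b) *\<^sub>R f (fst p) b) \<in> borel_measurable (M \<Otimes>\<^sub>M borel)"
    using f by measurable
  moreover have "(\<Sum>b\<in>Basis. (snd p \<bullet> b) *\<^sub>R f (fst p) b) = (case p of (w, x) \<Rightarrow> f w x)" for p
  proof (cases p)
    case (Pair w x)
    have "f w x = f w (\<Sum>b\<in>Basis. (x \<bullet> b) *\<^sub>R b)" by (simp add: euclidean_representation)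
    also have "\<dots> = (\<Sum>b\<in>Basis. (x \<bullet> b) *\<^sub>R f w b)" by (simp add: linear_sum[OF lin] linear_cmul[OF lin])
    finally show ?thesis using Pair by simp
  qed
  ultimately show ?thesis by simp
qed

lemma measurable_proj_comp [measurable (raw)]:
  assumes f[measurable]: "f \<in> measurable N (grass_space k)" and g[measurable]: "g \<in> borel_measurable N"
  shows "(\<lambda>w. proj (f w) (g w)) \<in> borel_measurable N"
proof -
  have m: "(\<lambda>(L, x). proj L x) \<in> borel_measurable (grass_space k \<Otimes>\<^sub>M borel)"
    by (rule borel_measurable_pairI) (auto simp: linear_proj)
  have "(\<lambda>w. (f w, g w)) \<in> measurable N (grass_space k \<Otimes>\<^sub>M borel)" by measurable
  from measurable_compose[OF this m] show ?thesis by simp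
qed

section \<open>Lebesgue measure under linear maps\<close>

lemma emeasure_cball_pos_fin:
  "emeasure lborel (cball (0::'a::euclidean_space) 1) \<noteq> 0" "emeasure lborel (cball (0::'a::euclidean_space) 1) \<noteq> \<infinity>"
proof -
  have "measure lborel (cball (0::'a) 1) > 0"
    by (rule content_cball_pos) simp
  then show "emeasure lborel (cball (0::'a) 1) \<noteq> 0" by (auto simp: measure_def)
  show "emeasure lborel (cball (0::'a) 1) \<noteq> \<infinity>" using emeasure_lborel_cball_finite[of "0::'a" 1] by simp
qed

text \<open>Weil's argument: with \<open>g\<close> the indicator of the ball, evaluate
  \<open>\<integral>\<integral> g y * f (x + y)\<close> over \<open>\<mu>\<close> and Lebesgue measure in both orders.\<close>

lemma translation_invariant_unique:
  fixes \<mu> :: "'a::euclidean_space measure"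
  assumes s[measurable_cong]: "sets \<mu> = sets borel" and sf: "sigma_finite_measure \<mu>"
    and inv: "\<And>a. distr \<mu> borel (\<lambda>x. x + a) = \<mu>"
    and A[measurable]: "A \<in> sets borel"
  shows "emeasure \<mu> A * emeasure lborel (cball (0::'a) 1) = emeasure lborel A * emeasure \<mu> (cball 0 1)"
proof -
  interpret sigma_finite_measure \<mu> by fact
  interpret pair_sigma_finite \<mu> "lborel :: 'a measure" ..
  define f :: "'a \<Rightarrow> ennreal" where "f = indicator A"
  define g :: "'a \<Rightarrow> ennreal" where "g = indicator (cball 0 1)"
  have fm[measurable]: "f \<in> borel_measurable borel" and gm[measurable]: "g \<in> borel_measurable borel"
    unfolding f_def g_def by (rule borel_measurable_indicator, simp)+
  have If: "(\<integral>\<^sup>+x. f x \<partial>\<mu>) = emeasure \<mu> A" "(\<integral>\<^sup>+x. f x \<partial>lborel) = emeasure lborel A"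
    unfolding f_def by (auto intro!: nn_integral_indicator simp: s)
  have Ig: "(\<integral>\<^sup>+x. g x \<partial>\<mu>) = emeasure \<mu> (cball 0 1)" "(\<integral>\<^sup>+x. g x \<partial>lborel) = emeasure lborel (cball (0::'a) 1)"
    unfolding g_def by (auto intro!: nn_integral_indicator simp: s)
  have shift: "(\<integral>\<^sup>+x. u (x + a) \<partial>\<mu>) = (\<integral>\<^sup>+x. u x \<partial>\<mu>)"
    if [measurable]: "u \<in> borel_measurable borel" for u a
    by (subst (2) inv[of a, symmetric], subst nn_integral_distr) auto
  have shiftl: "(\<integral>\<^sup>+x. u (x + a) \<partial>lborel) = (\<integral>\<^sup>+x. u x \<partial>lborel)"
    if [measurable]: "u \<in> borel_measurable borel" for u and a :: 'a
    by (subst (2) lborel_distr_plus[of a, symmetric], subst nn_integral_distr) (auto simp: add.commute)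
  have "emeasure \<mu> A * emeasure lborel (cball (0::'a) 1) = (\<integral>\<^sup>+y. g y * (\<integral>\<^sup>+x. f x \<partial>\<mu>) \<partial>lborel)"
    by (subst nn_integral_multc) (auto simp: If Ig mult.commute gm)
  also have "\<dots> = (\<integral>\<^sup>+y. (\<integral>\<^sup>+x. g y * f (x + y) \<partial>\<mu>) \<partial>lborel)"
    by (subst nn_integral_cmult) (auto simp: shift)
  also have "\<dots> = (\<integral>\<^sup>+x. (\<integral>\<^sup>+y. g y * f (x + y) \<partial>lborel) \<partial>\<mu>)"
    by (rule Fubini') measurable
  also have "\<dots> = (\<integral>\<^sup>+x. (\<integral>\<^sup>+y. g (y - x) * f y \<partial>lborel) \<partial>\<mu>)"
  proof (rule nn_integral_cong)
    fix x
    have "(\<integral>\<^sup>+y. g (y + x - x) * f (y + x) \<partial>lborel) = (\<integral>\<^sup>+y. g (y - x) * f y \<partial>lborel)"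
      by (rule shiftl[of "\<lambda>y. g (y - x) * f y"]) measurable
    then show "(\<integral>\<^sup>+y. g y * f (x + y) \<partial>lborel) = (\<integral>\<^sup>+y. g (y - x) * f y \<partial>lborel)"
      by (simp add: add.commute)
  qed
  also have "\<dots> = (\<integral>\<^sup>+y. (\<integral>\<^sup>+x. g (y - x) * f y \<partial>\<mu>) \<partial>lborel)"
    by (rule Fubini'[symmetric]) measurable
  also have "\<dots> = (\<integral>\<^sup>+y. (\<integral>\<^sup>+x. g x \<partial>\<mu>) * f y \<partial>lborel)"
  proof (rule nn_integral_cong)
    fix y
    have "g (y - x) = g (x + - y)" for x
      by (simp add: g_def indicator_def norm_minus_commute)
    then show "(\<integral>\<^sup>+x. g (y - x) * f y \<partial>\<mu>) = (\<integral>\<^sup>+x. g x \<partial>\<mu>) * f y"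
      using shift[OF gm, of "- y"] by (subst nn_integral_multc) auto
  qed
  also have "\<dots> = emeasure lborel A * emeasure \<mu> (cball 0 1)"
    by (subst nn_integral_cmult) (auto simp: If Ig mult.commute)
  finally show ?thesis .
qed

lemma sigma_finite_cball:
  fixes M :: "'a::euclidean_space measure"
  assumes s: "sets M = sets borel" and f: "\<And>n::nat. emeasure M (cball 0 (real n)) < \<infinity>"
  shows "sigma_finite_measure M"
proof
  show "\<exists>A. countable A \<and> A \<subseteq> sets M \<and> \<Union> A = space M \<and> (\<forall>a\<in>A. emeasure M a \<noteq> \<infinity>)"
  proof (intro exI conjI ballI)
    show "countable (range (\<lambda>n. cball (0::'a) (real n)))" by simp
    show "range (\<lambda>n. cball (0::'a) (real n)) \<subseteq> sets M" unfolding s by auto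
    have "\<Union> (range (\<lambda>n. cball (0::'a) (real n))) = UNIV"
      using real_arch_simple by (auto simp: dist_norm)
    then show "\<Union> (range (\<lambda>n. cball (0::'a) (real n))) = space M"
      unfolding sets_eq_imp_space_eq[OF s] space_borel .
    fix a assume "a \<in> range (\<lambda>n. cball (0::'a) (real n))"
    then obtain n where "a = cball 0 (real n)" by blast
    then show "emeasure M a \<noteq> \<infinity>" using f[of n] by (simp add: less_top[symmetric])
  qed
qed

lemma translation_invariant_eq:
  fixes \<mu> :: "'a::euclidean_space measure"
  assumes "sets \<mu> = sets borel" "sigma_finite_measure \<mu>"
    and "\<And>a. distr \<mu> borel (\<lambda>x. x + a) = \<mu>" "A \<in> sets borel"
  shows "emeasure \<mu> A = (emeasure \<mu> (cball 0 1) / emeasure lborel (cball (0::'a) 1)) * emeasure lborel A"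
proof -
  have "emeasure \<mu> A = emeasure \<mu> A * emeasure lborel (cball (0::'a) 1) / emeasure lborel (cball (0::'a) 1)"
    using emeasure_cball_pos_fin[where 'a='a] by (intro ennreal_mult_divide_eq[symmetric]) auto
  also have "\<dots> = emeasure lborel A * emeasure \<mu> (cball 0 1) / emeasure lborel (cball (0::'a) 1)"
    by (simp only: translation_invariant_unique[OF assms])
  finally show ?thesis by (simp only: ennreal_times_divide[symmetric] mult.commute)
qed

text \<open>\<open>stretch f\<close> plays the role of \<open>\<bar>det f\<bar>\<close>, which is not available over an abstract Euclidean space.\<close>

definition stretch :: "('a::euclidean_space \<Rightarrow> 'a) \<Rightarrow> ennreal" where
  "stretch f = emeasure lborel (f ` cball 0 1) / emeasure lborel (cball (0::'a) 1)"

lemma linear_image_eq_vimage: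
  fixes f :: "'a::euclidean_space \<Rightarrow> 'a"
  assumes "linear f" "inj f"
  obtains g where "linear g" "\<And>x. g (f x) = x" "\<And>x. f (g x) = x"
    "\<And>A. f ` A = g -` A"
proof -
  obtain g where g: "linear g" "\<And>x. g (f x) = x" "\<And>x. f (g x) = x"
    using linear_injective_isomorphism[OF assms] by auto
  have "f ` A = g -` A" for A using g(2,3) by (auto simp: image_iff) metis
  with g that show thesis by blast
qed

lemma borel_measurable_linear [measurable_dest]:
  fixes f :: "'a::euclidean_space \<Rightarrow> 'b::euclidean_space"
  shows "linear f \<Longrightarrow> f \<in> borel_measurable borel"
  by (simp add: borel_measurable_continuous_onI linear_continuous_on linear_conv_bounded_linear)

text \<open>Pulling Lebesgue measure back along \<open>f\<close> gives a translation invariant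
  measure, hence a multiple of Lebesgue measure; the multiple is read off on the unit ball.\<close>

lemma emeasure_linear_image:
  fixes f :: "'a::euclidean_space \<Rightarrow> 'a"
  assumes f: "linear f" "inj f" and A: "A \<in> sets borel"
  shows "f ` A \<in> sets borel" "emeasure lborel (f ` A) = stretch f * emeasure lborel A"
proof -
  obtain g where g: "linear g" "\<And>x. g (f x) = x" "\<And>x. f (g x) = x" "\<And>A. f ` A = g -` A"
    by (rule linear_image_eq_vimage[OF f]) blast
  have [measurable]: "g \<in> borel_measurable borel" using g(1) by (rule borel_measurable_linear)
  show "f ` A \<in> sets borel" unfolding g(4) using measurable_sets[OF \<open>g \<in> borel_measurable borel\<close> A] by simp
  let ?\<mu> = "distr lborel borel g"
  have em: "emeasure ?\<mu> B = emeasure lborel (f ` B)" if "B \<in> sets borel" for B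
    using that by (simp add: emeasure_distr g(4))
  have sf: "sigma_finite_measure ?\<mu>"
  proof (rule sigma_finite_cball)
    fix n :: nat
    have "compact (f ` cball 0 (real n))"
      by (intro compact_continuous_image linear_continuous_on) (use f linear_conv_bounded_linear in auto)
    then show "emeasure ?\<mu> (cball 0 (real n)) < \<infinity>"
      using em[of "cball 0 (real n)"] emeasure_compact_finite by fastforce
  qed simp
  have inv: "distr ?\<mu> borel (\<lambda>x. x + a) = ?\<mu>" for a
  proof -
    have "distr ?\<mu> borel (\<lambda>x. x + a) = distr lborel borel (\<lambda>x. g (f a + x))"
      by (subst distr_distr) (auto simp: comp_def linear_add[OF g(1)] g(2) add.commute)
    also have "\<dots> = distr (distr lborel borel ((+) (f a))) borel g"
      by (subst distr_distr) (auto simp: comp_def)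
    also have "\<dots> = ?\<mu>" by (simp add: lborel_distr_plus)
    finally show ?thesis .
  qed
  show "emeasure lborel (f ` A) = stretch f * emeasure lborel A"
    using translation_invariant_eq[OF _ sf inv A] em[OF A] em[of "cball 0 1"] by (simp add: stretch_def)
qed

lemma stretch_singular:
  fixes f :: "'a::euclidean_space \<Rightarrow> 'a"
  assumes "linear f" "\<not> inj f"
  shows "stretch f = 0"
proof -
  have "negligible (f ` cball 0 1)" using negligible_linear_singular_image[OF assms] .
  then have "emeasure lebesgue (f ` cball 0 1) = 0"
    by (simp add: negligible_iff_null_sets null_sets_def)
  moreover have "f ` cball 0 1 \<in> sets borel"
    using assms(1) by (intro borel_compact compact_continuous_image linear_continuous_on) (auto simp: linear_conv_bounded_linear)
  ultimately show ?thesis by (simp add: stretch_def emeasure_completion)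
qed

text \<open>The translation \<open>a\<close> comes from invariance of Lebesgue measure; it is
  included so that the affine maps on the cells of a polytope are covered.\<close>

lemma nn_integral_linear_image:
  fixes f :: "'a::euclidean_space \<Rightarrow> 'a"
  assumes f: "linear f" "inj f" and u[measurable]: "u \<in> borel_measurable borel"
  shows "(\<integral>\<^sup>+y. u y \<partial>lborel) = stretch f * (\<integral>\<^sup>+x. u (f x + a) \<partial>lborel)"
proof -
  have [measurable]: "f \<in> borel_measurable borel" using f(1) by (rule borel_measurable_linear)
  have surj: "surj f" using f linear_injective_imp_surjective by blast
  have "lborel = density (distr lborel borel f) (\<lambda>_. stretch f)"
  proof (rule measure_eqI)
    fix B :: "'a set" assume "B \<in> sets lborel"
    then have B: "B \<in> sets borel" by simp
    have "emeasure lborel (f ` (f -` B)) = stretch f * emeasure lborel (f -` B)"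
      using measurable_sets[OF \<open>f \<in> borel_measurable borel\<close> B] by (intro emeasure_linear_image f) simp
    then show "emeasure lborel B = emeasure (density (distr lborel borel f) (\<lambda>_. stretch f)) B"
      using B surj by (simp add: emeasure_density nn_integral_cmult emeasure_distr surj_image_vimage_eq)
  qed simp
  then have "(\<integral>\<^sup>+y. u (y + a) \<partial>lborel) = (\<integral>\<^sup>+y. u (y + a) \<partial>(density (distr lborel borel f) (\<lambda>_. stretch f)))"
    by simp
  also have "\<dots> = stretch f * (\<integral>\<^sup>+x. u (f x + a) \<partial>lborel)"
    by (subst nn_integral_density) (auto simp: nn_integral_distr nn_integral_cmult)
  finally have 1: "(\<integral>\<^sup>+y. u (y + a) \<partial>lborel) = stretch f * (\<integral>\<^sup>+x. u (f x + a) \<partial>lborel)" .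
  have "(\<integral>\<^sup>+y. u (y + a) \<partial>lborel) = (\<integral>\<^sup>+y. u y \<partial>lborel)"
    by (subst (2) lborel_distr_plus[of a, symmetric], subst nn_integral_distr) (auto simp: add.commute)
  with 1 show ?thesis by simp
qed

lemma stretch_orthogonal: "orthogonal_transformation f \<Longrightarrow> stretch f = 1"
  unfolding stretch_def using image_orthogonal_transformation_cball[of f 0 1] emeasure_cball_pos_fin[where 'a='a]
  by (simp add: orthogonal_transformation_linear linear_0 ennreal_divide_self top.not_eq_extremum)

lemma stretch_comp:
  fixes f g :: "'a::euclidean_space \<Rightarrow> 'a"
  assumes "linear f" "inj f" "linear g" "inj g"
  shows "stretch (f \<circ> g) = stretch f * stretch g"
proof -
  have "g ` cball 0 1 \<in> sets borel" using emeasure_linear_image(1)[OF assms(3,4)] by simp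
  from emeasure_linear_image(2)[OF assms(1,2) this]
  show ?thesis unfolding stretch_def[of "f \<circ> g"] stretch_def[of g] image_comp[symmetric]
    by (simp only: ennreal_times_divide)
qed

lemma stretch_diag:
  fixes c :: "'a::euclidean_space \<Rightarrow> real"
  assumes c: "\<And>j. j \<in> Basis \<Longrightarrow> c j \<noteq> 0"
  shows "stretch (\<lambda>x. \<Sum>j\<in>Basis. (c j * (x \<bullet> j)) *\<^sub>R j) = (\<Prod>j\<in>Basis. \<bar>c j\<bar>)"
proof -
  let ?T = "\<lambda>x::'a. \<Sum>j\<in>Basis. (c j * (x \<bullet> j)) *\<^sub>R j"
  have lin: "linear ?T" by (intro linearI) (simp_all add: inner_add_left algebra_simps sum.distrib scaleR_sum_right)
  have inj: "inj ?T"
  proof (rule injI)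
    fix x y assume e: "?T x = ?T y"
    show "x = y"
    proof (rule euclidean_eqI)
      fix i :: 'a assume i: "i \<in> Basis"
      have "?T x \<bullet> i = ?T y \<bullet> i" using e by simp
      then show "x \<bullet> i = y \<bullet> i" using c[OF i] i by simp
    qed
  qed
  have [measurable]: "?T \<in> borel_measurable borel" using lin by (rule borel_measurable_linear)
  define B where "B = ?T ` cball 0 1"
  have B: "B \<in> sets borel" unfolding B_def by (rule emeasure_linear_image(1)[OF lin inj]) simp
  have vi: "?T -` B = cball 0 1" unfolding B_def using inj by (rule inj_vimage_image_eq)
  have "emeasure lborel B = emeasure (density (distr lborel borel (\<lambda>x. 0 + ?T x)) (\<lambda>_. (\<Prod>j\<in>Basis. \<bar>c j\<bar>))) B"
    by (subst lborel_affine_euclidean[OF c, where t=0]) auto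
  also have "\<dots> = (\<Prod>j\<in>Basis. \<bar>c j\<bar>) * emeasure lborel (cball (0::'a) 1)"
    using B by (simp add: emeasure_density nn_integral_cmult emeasure_distr vi)
  finally show ?thesis unfolding stretch_def B_def[symmetric]
    using emeasure_cball_pos_fin[where 'a='a] by (simp add: ennreal_mult_divide_eq)
qed

definition scale_along :: "'a::euclidean_space set \<Rightarrow> real \<Rightarrow> 'a \<Rightarrow> 'a" where
  "scale_along S r x = (x - proj S x) + r *\<^sub>R proj S x"

lemma linear_scale_along: "linear (scale_along S r)"
  unfolding scale_along_def by (intro linearI) (simp_all add: proj_add proj_scaleR algebra_simps)

lemma scale_along_scale_along:
  "subspace S \<Longrightarrow> scale_along S r (scale_along S t x) = scale_along S (r * t) x"
  by (simp add: scale_along_def proj_add proj_diff proj_scaleR)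

lemma scale_along_1 [simp]: "scale_along S 1 x = x"
  by (simp add: scale_along_def)

lemma inj_scale_along: "subspace S \<Longrightarrow> r \<noteq> 0 \<Longrightarrow> inj (scale_along S r)"
  by (rule inj_on_inverseI[of _ "scale_along S (1 / r)"]) (simp add: scale_along_scale_along)

text \<open>An orthogonal map carries a coordinate subspace to \<open>S\<close>. On the coordinate
  subspace the dilation is diagonal with \<open>dim S\<close> entries \<open>r\<close>, and
  conjugation by an orthogonal map leaves \<open>stretch\<close> unchanged.\<close>

lemma stretch_scale_along:
  fixes S :: "'a::euclidean_space set"
  assumes S: "subspace S" and r: "r > 0"
  shows "stretch (scale_along S r) = ennreal (r ^ dim S)"
proof -
  obtain B :: "'a set" where B: "B \<subseteq> Basis" "card B = dim S"
    using ex_card[of "dim S" "Basis::'a set"] dim_subset_UNIV[of S] by auto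
  have fB: "finite B" using B(1) finite_Basis finite_subset by blast
  have ind: "independent B" using B(1) independent_Basis independent_mono by blast
  define S0 where "S0 = span B"
  have S0: "subspace S0" "dim S0 = dim S"
    using B ind by (auto simp: S0_def dim_eq_card_independent)
  obtain h where h: "orthogonal_transformation h" "h ` S0 = S"
    using orth_trans_subspaces[OF S0(1) S S0(2)] .
  define c where "c j = (if j \<in> B then r else 1)" for j :: 'a
  let ?T = "\<lambda>x::'a. \<Sum>j\<in>Basis. (c j * (x \<bullet> j)) *\<^sub>R j"
  have p0: "proj S0 x = (\<Sum>j\<in>B. (x \<bullet> j) *\<^sub>R j)" for x
  proof (rule proj_unique[OF S0(1)])
    show "(\<Sum>j\<in>B. (x \<bullet> j) *\<^sub>R j) \<in> S0" unfolding S0_def by (intro span_sum span_scale span_base)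
    fix z assume "z \<in> S0"
    then show "(x - (\<Sum>j\<in>B. (x \<bullet> j) *\<^sub>R j)) \<bullet> z = 0" unfolding S0_def
    proof (induction rule: span_induct)
      case base
      then show ?case using subspace_hyperplane by blast
    next
      case (step z)
      have "(\<Sum>j\<in>B. (x \<bullet> j) *\<^sub>R j) \<bullet> z = (\<Sum>j\<in>B. (x \<bullet> j) * (if j = z then 1 else 0))"
        unfolding inner_sum_left inner_scaleR_left
        by (intro sum.cong refl arg_cong2[of _ _ _ _ "(*)"]) (use B(1) step in \<open>auto simp: inner_Basis subset_iff\<close>)
      also have "\<dots> = x \<bullet> z" using step fB by (simp add: if_distrib cong: if_cong)
      finally show ?case by (simp add: inner_diff_left)
    qed
  qed
  have T: "?T = scale_along S0 r"
  proof
    fix x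
    have "?T x = (\<Sum>j\<in>Basis. (x \<bullet> j) *\<^sub>R j) + (r - 1) *\<^sub>R (\<Sum>j\<in>Basis. if j \<in> B then (x \<bullet> j) *\<^sub>R j else 0)"
      unfolding scaleR_sum_right sum.distrib[symmetric]
      by (intro sum.cong refl) (auto simp: c_def algebra_simps)
    also have "(\<Sum>j\<in>Basis. if j \<in> B then (x \<bullet> j) *\<^sub>R j else 0) = proj S0 x"
      unfolding p0 using B(1) by (simp add: sum.inter_restrict[symmetric] Int_absorb1)
    finally show "?T x = scale_along S0 r x"
      by (simp add: euclidean_representation scale_along_def algebra_simps)
  qed
  have "stretch (scale_along S0 r) = (\<Prod>j\<in>Basis. \<bar>c j\<bar>)"
    unfolding T[symmetric] by (rule stretch_diag) (use r in \<open>auto simp: c_def\<close>)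
  also have "(\<Prod>j\<in>Basis. \<bar>c j\<bar>) = (\<Prod>j\<in>Basis. if j \<in> B then r else 1)"
    by (intro prod.cong) (use r in \<open>auto simp: c_def\<close>)
  also have "\<dots> = r ^ dim S" using B by (simp add: prod.inter_restrict[symmetric] Int_absorb1)
  finally have 1: "stretch (scale_along S0 r) = ennreal (r ^ dim S)" .
  have "scale_along S r (h x) = h (scale_along S0 r x)" for x
    using proj_orth_image[OF h(1) S0(1), of x] h
    by (simp add: scale_along_def orthogonal_transformation_add orthogonal_transformation_diff orthogonal_transformation_scaleR)
  then have "scale_along S r \<circ> h = h \<circ> scale_along S0 r" by (auto simp: comp_def)
  moreover have "stretch (scale_along S r \<circ> h) = stretch (scale_along S r) * stretch h"
    using h r S by (intro stretch_comp linear_scale_along inj_scale_along)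
      (auto simp: orthogonal_transformation_linear orthogonal_transformation_inj)
  moreover have "stretch (h \<circ> scale_along S0 r) = stretch h * stretch (scale_along S0 r)"
    using h r S0 by (intro stretch_comp linear_scale_along inj_scale_along)
      (auto simp: orthogonal_transformation_linear orthogonal_transformation_inj)
  ultimately show ?thesis using 1 h by (simp add: stretch_orthogonal)
qed

lemma nn_integral_scale_along:
  fixes S :: "'a::euclidean_space set"
  assumes S: "subspace S" and r: "r > 0" and u[measurable]: "u \<in> borel_measurable borel"
  shows "(\<integral>\<^sup>+y. u y \<partial>lborel) = ennreal (r ^ dim S) * (\<integral>\<^sup>+x. u (scale_along S r x + a) \<partial>lborel)"
  using nn_integral_linear_image[OF linear_scale_along inj_scale_along[OF S] u, of r a] r
  by (simp add: stretch_scale_along[OF S r])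

lemma nn_integral_orthogonal:
  fixes h :: "'a::euclidean_space \<Rightarrow> 'a"
  assumes h: "orthogonal_transformation h" and u[measurable]: "u \<in> borel_measurable borel"
  shows "(\<integral>\<^sup>+x. u (h x) \<partial>lborel) = (\<integral>\<^sup>+y. u y \<partial>lborel)"
  using nn_integral_linear_image[OF orthogonal_transformation_linear[OF h] orthogonal_transformation_inj[OF h] u, where a=0]
  by (simp add: stretch_orthogonal[OF h])

section \<open>Haar measure on the Grassmannian\<close>

text \<open>Source of randomness for the Haar measure: rotation invariant, without mass on proper
  subspaces, and available directly from Lebesgue measure.\<close>

definition ball_unif :: "'a::euclidean_space measure" where
  "ball_unif = uniform_measure lborel (cball 0 1)"

definition frames :: "(nat \<Rightarrow> 'a::euclidean_space) measure" where
  "frames = PiM {..<DIM('a)} (\<lambda>_. ball_unif)"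

lemma sets_ball_unif [simp, measurable_cong]: "sets ball_unif = sets borel"
  by (simp add: ball_unif_def)

lemma space_ball_unif [simp]: "space ball_unif = UNIV"
  by (simp add: ball_unif_def)

lemma prob_space_ball_unif: "prob_space (ball_unif :: 'a::euclidean_space measure)"
  unfolding ball_unif_def by (rule prob_space_uniform_measure) (use emeasure_cball_pos_fin[where 'a='a] in auto)

interpretation ball_unif: prob_space "ball_unif :: 'a::euclidean_space measure"
  by (rule prob_space_ball_unif)

interpretation ball_unif_prod: product_prob_space "\<lambda>_::nat. ball_unif :: 'a::euclidean_space measure" UNIV
  by unfold_locales

lemma prob_space_frames: "prob_space (frames :: (nat \<Rightarrow> 'a::euclidean_space) measure)"
  unfolding frames_def by (rule prob_space_PiM) (rule prob_space_ball_unif)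

lemma ball_unif_orthogonal:
  fixes h :: "'a::euclidean_space \<Rightarrow> 'a"
  assumes h: "orthogonal_transformation h"
  shows "distr ball_unif borel h = ball_unif"
proof (rule measure_eqI)
  have [measurable]: "h \<in> borel_measurable borel"
    using h by (intro borel_measurable_linear orthogonal_transformation_linear)
  fix A assume "A \<in> sets (distr ball_unif borel h)"
  then have A[measurable]: "A \<in> sets borel" by simp
  have hA[measurable]: "h -` A \<in> sets borel" using measurable_sets[of h borel borel A] by simp
  have "emeasure lborel (cball 0 1 \<inter> h -` A) = (\<integral>\<^sup>+x. indicator (cball 0 1 \<inter> A) (h x) \<partial>lborel)"
  proof -
    have "emeasure lborel (cball 0 1 \<inter> h -` A) = (\<integral>\<^sup>+x. indicator (cball 0 1 \<inter> h -` A) x \<partial>lborel)"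
      by (rule nn_integral_indicator[symmetric]) (use hA in simp)
    also have "\<dots> = (\<integral>\<^sup>+x. indicator (cball 0 1 \<inter> A) (h x) \<partial>lborel)"
      by (intro nn_integral_cong) (auto simp: indicator_def orthogonal_transformation_norm[OF h])
    finally show ?thesis .
  qed
  also have "\<dots> = emeasure lborel (cball 0 1 \<inter> A)"
    using A by (subst nn_integral_orthogonal[OF h]) (auto intro!: borel_measurable_indicator)
  finally show "emeasure (distr ball_unif borel h) A = emeasure ball_unif A"
    by (simp add: emeasure_distr ball_unif_def emeasure_uniform_measure)
qed simp

section \<open>Gram-Schmidt frames and random rotations\<close>

fun gram_schmidt :: "(nat \<Rightarrow> 'a::euclidean_space) \<Rightarrow> nat \<Rightarrow> 'a" where
  "gram_schmidt x i = sgn (x i - (\<Sum>l<i. (x i \<bullet> gram_schmidt x l) *\<^sub>R gram_schmidt x l))"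

declare gram_schmidt.simps [simp del]

lemma gram_schmidt_cong: "(\<And>l. l \<le> i \<Longrightarrow> x l = y l) \<Longrightarrow> gram_schmidt x i = gram_schmidt y i"
proof (induction i rule: less_induct)
  case (less i)
  have "gram_schmidt x l = gram_schmidt y l" if "l < i" for l using less that by simp
  then show ?case by (simp add: gram_schmidt.simps[of _ i] less.prems)
qed

text \<open>The process uses only linear combinations, norms and inner products, all of which
  \<open>h\<close> respects.\<close>

lemma gram_schmidt_orthogonal:
  assumes h: "orthogonal_transformation h"
  shows "gram_schmidt (\<lambda>i. h (x i)) i = h (gram_schmidt x i)"
proof (induction i rule: less_induct)
  case (less i)
  have sgn: "sgn (h v) = h (sgn v)" for v
    by (simp add: sgn_div_norm orthogonal_transformation_norm[OF h] orthogonal_transformation_scaleR[OF h])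
  have "(\<Sum>l<i. (h (x i) \<bullet> gram_schmidt (\<lambda>i. h (x i)) l) *\<^sub>R gram_schmidt (\<lambda>i. h (x i)) l) = (\<Sum>l<i. (x i \<bullet> gram_schmidt x l) *\<^sub>R h (gram_schmidt x l))"
    by (intro sum.cong) (auto simp: less orthogonal_transformation_inner[OF h])
  also have "\<dots> = h (\<Sum>l<i. (x i \<bullet> gram_schmidt x l) *\<^sub>R gram_schmidt x l)"
    by (simp add: linear_sum[OF orthogonal_transformation_linear[OF h]] orthogonal_transformation_scaleR[OF h])
  finally show ?case
    by (simp only: gram_schmidt.simps[of _ i] orthogonal_transformation_diff[OF h, symmetric] sgn)
qed

lemma measurable_gram_schmidt [measurable]:
  "i < DIM('a) \<Longrightarrow> (\<lambda>x. gram_schmidt x i) \<in> borel_measurable (frames :: (nat \<Rightarrow> 'a::euclidean_space) measure)"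
proof (induction i rule: less_induct)
  case (less i)
  have [measurable]: "(\<lambda>x. x i) \<in> borel_measurable (frames :: (nat \<Rightarrow> 'a) measure)"
    using measurable_component_singleton[of i "{..<DIM('a)}" "\<lambda>_. ball_unif :: 'a measure"] less.prems
    by (simp add: frames_def cong: measurable_cong_sets)
  have [measurable]: "l < i \<Longrightarrow> (\<lambda>x. gram_schmidt x l) \<in> borel_measurable (frames :: (nat \<Rightarrow> 'a) measure)" for l
    using less by simp
  show ?case unfolding gram_schmidt.simps[of _ i] sgn_div_norm by measurable
qed

lemma gram_schmidt_orthonormal:
  assumes "\<And>l. l < n \<Longrightarrow> gram_schmidt x l \<noteq> 0"
  shows "i < n \<Longrightarrow> j < n \<Longrightarrow> gram_schmidt x i \<bullet> gram_schmidt x j = (if i = j then 1 else 0)"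
proof -
  have nrm: "gram_schmidt x i \<bullet> gram_schmidt x i = 1" if "i < n" for i
  proof -
    have "norm (gram_schmidt x i) = 1" using assms[OF that] by (subst (asm) gram_schmidt.simps, subst gram_schmidt.simps) (auto simp: norm_sgn)
    then show ?thesis by (simp add: norm_eq_1)
  qed
  have orth: "gram_schmidt x i \<bullet> gram_schmidt x j = 0" if "j < i" "i < n" for i j
    using that
  proof (induction i arbitrary: j rule: less_induct)
    case (less i)
    have d: "gram_schmidt x l \<bullet> gram_schmidt x j = (if l = j then 1 else 0)" if "l < i" for l
    proof (cases l j rule: linorder_cases)
      case less': less
      then show ?thesis using less.IH[OF less.prems(1), of l] less.prems by (simp add: inner_commute)
    next
      case equal then show ?thesis using nrm less.prems by simp
    next
      case greater then show ?thesis using less.IH[OF that greater] that less.prems by simp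
    qed
    have "(\<Sum>l<i. (x i \<bullet> gram_schmidt x l) *\<^sub>R gram_schmidt x l) \<bullet> gram_schmidt x j = (\<Sum>l<i. if l = j then x i \<bullet> gram_schmidt x l else 0)"
      unfolding inner_sum_left by (intro sum.cong) (auto simp: d)
    also have "\<dots> = x i \<bullet> gram_schmidt x j" using less.prems by simp
    finally have "(x i - (\<Sum>l<i. (x i \<bullet> gram_schmidt x l) *\<^sub>R gram_schmidt x l)) \<bullet> gram_schmidt x j = 0" by (simp add: inner_diff_left)
    then show ?case by (subst gram_schmidt.simps) (simp add: sgn_div_norm)
  qed
  show "i < n \<Longrightarrow> j < n \<Longrightarrow> gram_schmidt x i \<bullet> gram_schmidt x j = (if i = j then 1 else 0)"
    using nrm orth[of i j] orth[of j i] by (cases i j rule: linorder_cases) (auto simp: inner_commute)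
qed

lemma ball_unif_lowdim:
  fixes S :: "'a::euclidean_space set"
  assumes "subspace S" "dim S < DIM('a)"
  shows "emeasure ball_unif S = 0"
proof -
  have S: "S \<in> sets borel" using closed_subspace[OF assms(1)] by simp
  have "emeasure lebesgue S = 0" using negligible_lowdim[OF assms(2)]
    by (simp add: negligible_iff_null_sets null_sets_def)
  then have "emeasure lborel S = 0" using S by (simp add: emeasure_completion)
  then have "emeasure lborel (cball 0 1 \<inter> S) = 0"
    using emeasure_mono[of "cball 0 1 \<inter> S" S lborel] S by simp
  then show ?thesis unfolding ball_unif_def using S by (subst emeasure_uniform_measure) auto
qed

text \<open>Since \<open>sgn\<close> vanishes only at \<open>0\<close>, a zero in position
  \<open>i\<close> forces \<open>x i\<close> into the span of the earlier frame vectors. That span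
  does not involve \<open>x i\<close>, so after Fubini in this coordinate it is a fixed proper
  subspace, hence null.\<close>

lemma AE_gram_schmidt_nonzero: "AE x in (frames :: (nat \<Rightarrow> 'a::euclidean_space) measure). \<forall>i<DIM('a). gram_schmidt x i \<noteq> 0"
proof (subst AE_all_countable, rule allI, rule AE_impI)
  fix i assume i: "i < DIM('a)"
  define I where "I = {..<DIM('a)} - {i}"
  have I: "{..<DIM('a)} = insert i I" "i \<notin> I" "finite I" using i by (auto simp: I_def)
  have F: "frames = PiM (insert i I) (\<lambda>_. ball_unif :: 'a measure)" by (simp add: frames_def I(1))
  let ?f = "\<lambda>x::nat \<Rightarrow> 'a. indicator {x. gram_schmidt x i = 0} x :: ennreal"
  have meas: "{x \<in> space (frames :: (nat \<Rightarrow> 'a) measure). gram_schmidt x i = 0} \<in> sets frames"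
    using measurable_gram_schmidt[OF i] by measurable
  have [measurable]: "?f \<in> borel_measurable frames"
    using meas by (subst borel_measurable_indicator_iff) (simp add: Int_def conj_commute)
  have "(\<integral>\<^sup>+x. ?f x \<partial>frames) = (\<integral>\<^sup>+x. (\<integral>\<^sup>+y. ?f (x(i := y)) \<partial>ball_unif) \<partial>PiM I (\<lambda>_. ball_unif))"
    unfolding F using I by (intro ball_unif_prod.product_nn_integral_insert) (auto simp: F[symmetric])
  also have "\<dots> = (\<integral>\<^sup>+x. 0 \<partial>PiM I (\<lambda>_. ball_unif :: 'a measure))"
  proof (rule nn_integral_cong)
    fix x :: "nat \<Rightarrow> 'a"
    let ?S = "span (gram_schmidt x ` {..<i})"
    have "dim ?S \<le> card (gram_schmidt x ` {..<i})" using dim_le_card'[of "gram_schmidt x ` {..<i}"] by simp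
    also have "\<dots> \<le> i" using card_image_le[of "{..<i}" "gram_schmidt x"] by simp
    finally have dS: "dim ?S < DIM('a)" using i by simp
    have "y \<in> ?S" if "gram_schmidt (x(i := y)) i = 0" for y
    proof -
      have eq: "gram_schmidt (x(i := y)) l = gram_schmidt x l" if "l < i" for l using that by (intro gram_schmidt_cong) auto
      have "y - (\<Sum>l<i. (y \<bullet> gram_schmidt x l) *\<^sub>R gram_schmidt x l) = 0"
        using that by (simp add: gram_schmidt.simps[of _ i] sgn_zero_iff eq)
      then have "y = (\<Sum>l<i. (y \<bullet> gram_schmidt x l) *\<^sub>R gram_schmidt x l)" by simp
      moreover have "\<dots> \<in> ?S" by (intro span_sum span_scale span_base) auto
      ultimately show ?thesis by simp
    qed
    then have "(\<integral>\<^sup>+y. ?f (x(i := y)) \<partial>ball_unif) \<le> (\<integral>\<^sup>+y. indicator ?S y \<partial>ball_unif)"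
      by (intro nn_integral_mono) (auto simp: indicator_def)
    also have "\<dots> = emeasure ball_unif ?S"
      using closed_subspace[OF subspace_span, of "gram_schmidt x ` {..<i}"] by (intro nn_integral_indicator) simp
    also have "\<dots> = 0" using dS by (intro ball_unif_lowdim) auto
    finally show "(\<integral>\<^sup>+y. ?f (x(i := y)) \<partial>ball_unif) = 0" by simp
  qed
  finally have "(\<integral>\<^sup>+x. ?f x \<partial>frames) = 0" by simp
  then have "AE x in frames. ?f x = 0" by (subst (asm) nn_integral_0_iff_AE) auto
  then show "AE x in (frames :: (nat \<Rightarrow> 'a) measure). gram_schmidt x i \<noteq> 0"
    by (rule AE_mp) (auto intro!: AE_I2 simp: indicator_def split: if_splits)
qed

text \<open>Takes the fixed basis \<open>onb UNIV\<close> to the Gram-Schmidt frame of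
  \<open>x\<close>. The identity as default value on degenerate tuples keeps it orthogonal for every
  \<open>x\<close>, not only almost everywhere.\<close>

definition rot :: "(nat \<Rightarrow> 'a::euclidean_space) \<Rightarrow> 'a \<Rightarrow> 'a" where
  "rot x v = (if \<forall>i<DIM('a). gram_schmidt x i \<noteq> 0 then \<Sum>i<DIM('a). (v \<bullet> onb UNIV i) *\<^sub>R gram_schmidt x i else v)"

text \<open>Inverse of \<open>rot x\<close>, given by its own formula so that measurability in
  \<open>x\<close> can be read off.\<close>

definition rotinv :: "(nat \<Rightarrow> 'a::euclidean_space) \<Rightarrow> 'a \<Rightarrow> 'a" where
  "rotinv x v = (if \<forall>i<DIM('a). gram_schmidt x i \<noteq> 0 then \<Sum>i<DIM('a). (v \<bullet> gram_schmidt x i) *\<^sub>R onb UNIV i else v)"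

lemma onb_UNIV_expand:
  fixes v :: "'a::euclidean_space" shows "(\<Sum>i<DIM('a). (v \<bullet> onb UNIV i) *\<^sub>R onb UNIV i) = v"
  using proj_UNIV[of v] by (simp add: proj_def)

lemma onb_UNIV_inner:
  fixes v w :: "'a::euclidean_space" shows "(\<Sum>i<DIM('a). (v \<bullet> onb UNIV i) * (w \<bullet> onb UNIV i)) = v \<bullet> w"
proof -
  have "v \<bullet> w = (\<Sum>i<DIM('a). (v \<bullet> onb UNIV i) *\<^sub>R onb UNIV i) \<bullet> w" by (simp only: onb_UNIV_expand)
  also have "\<dots> = (\<Sum>i<DIM('a). (v \<bullet> onb UNIV i) * (w \<bullet> onb UNIV i))"
    by (simp add: inner_sum_left inner_commute[of w])
  finally show ?thesis by simp
qed

lemma rot_inner_gram_schmidt: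
  fixes x :: "nat \<Rightarrow> 'a::euclidean_space"
  assumes x: "\<forall>i<DIM('a). gram_schmidt x i \<noteq> 0" and j: "j < DIM('a)"
  shows "rot x v \<bullet> gram_schmidt x j = v \<bullet> onb UNIV j"
proof -
  have "rot x v \<bullet> gram_schmidt x j = (\<Sum>i<DIM('a). (v \<bullet> onb UNIV i) * (gram_schmidt x i \<bullet> gram_schmidt x j))"
    using x by (simp add: rot_def inner_sum_left)
  also have "\<dots> = (\<Sum>i<DIM('a). if i = j then v \<bullet> onb UNIV i else 0)"
    using gram_schmidt_orthonormal[of "DIM('a)" x _ j] x j by (intro sum.cong) auto
  finally show ?thesis using j by simp
qed

lemma rot_orthogonal: "orthogonal_transformation (rot (x :: nat \<Rightarrow> 'a::euclidean_space))"
proof (cases "\<forall>i<DIM('a). gram_schmidt x i \<noteq> 0")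
  case True
  have "rot x v \<bullet> rot x w = v \<bullet> w" for v w
  proof -
    have "rot x v \<bullet> rot x w = rot x v \<bullet> (\<Sum>j<DIM('a). (w \<bullet> onb UNIV j) *\<^sub>R gram_schmidt x j)"
      using True by (simp add: rot_def[of x w])
    also have "\<dots> = (\<Sum>j<DIM('a). (w \<bullet> onb UNIV j) * (rot x v \<bullet> gram_schmidt x j))"
      by (simp only: inner_sum_right inner_scaleR_right)
    also have "\<dots> = (\<Sum>j<DIM('a). (v \<bullet> onb UNIV j) * (w \<bullet> onb UNIV j))"
      by (intro sum.cong) (auto simp: rot_inner_gram_schmidt[OF True])
    finally show ?thesis by (simp add: onb_UNIV_inner)
  qed
  moreover have "linear (rot x)"
    using True by (intro linearI) (simp_all add: rot_def inner_add_left scaleR_add_left sum.distrib scaleR_sum_right)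
  ultimately show ?thesis by (simp add: orthogonal_transformation_def)
next
  case False
  then have "rot x = (\<lambda>v. v)" by (auto simp: rot_def fun_eq_iff)
  then show ?thesis by simp
qed

lemma rotinv_rot: "rotinv x (rot x v) = v"
proof (cases "\<forall>i<DIM('a). gram_schmidt x i \<noteq> 0")
  case True
  have "rotinv x (rot x v) = (\<Sum>i<DIM('a). (rot x v \<bullet> gram_schmidt x i) *\<^sub>R onb UNIV i)"
    using True by (simp add: rotinv_def)
  also have "\<dots> = (\<Sum>i<DIM('a). (v \<bullet> onb UNIV i) *\<^sub>R onb UNIV i)"
    using rot_inner_gram_schmidt[OF True] by (intro sum.cong) auto
  also have "\<dots> = v" by (rule onb_UNIV_expand)
  finally show ?thesis .
next
  case False
  then have "rot x v = v" "rotinv x v = v" unfolding rot_def rotinv_def by (simp_all only: if_False)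
  then show ?thesis by simp
qed

lemma rot_rotinv: "rot x (rotinv x v) = v"
  by (metis orthogonal_transformation_surj rot_orthogonal rotinv_rot surjD)

lemma rotinv_eq_inv: "rotinv x = inv (rot x)"
  by (metis (no_types, lifting) ext inv_unique_comp o_apply id_apply rot_rotinv rotinv_rot)

lemma rotinv_orthogonal: "orthogonal_transformation (rotinv x)"
  unfolding rotinv_eq_inv by (intro orthogonal_transformation_inv rot_orthogonal)

lemma measurable_rot [measurable (raw)]:
  fixes f :: "'w \<Rightarrow> nat \<Rightarrow> 'a::euclidean_space"
  assumes f[measurable]: "f \<in> measurable N frames" and g[measurable]: "g \<in> borel_measurable N"
  shows "(\<lambda>w. rot (f w) (g w)) \<in> borel_measurable N" "(\<lambda>w. rotinv (f w) (g w)) \<in> borel_measurable N"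
proof -
  have [measurable]: "(\<lambda>w. gram_schmidt (f w) i) \<in> borel_measurable N" if "i < DIM('a)" for i
    using measurable_compose[OF f measurable_gram_schmidt[OF that]] by simp
  have p[measurable]: "Measurable.pred N (\<lambda>w. \<forall>i<DIM('a). gram_schmidt (f w) i \<noteq> 0)"
  proof -
    have "Measurable.pred N (\<lambda>w. \<forall>i\<in>{..<DIM('a)}. gram_schmidt (f w) i \<noteq> 0)"
      by (intro pred_intros_finite) auto
    then show ?thesis by (simp add: Ball_def)
  qed
  show "(\<lambda>w. rot (f w) (g w)) \<in> borel_measurable N" "(\<lambda>w. rotinv (f w) (g w)) \<in> borel_measurable N"
    unfolding rot_def rotinv_def by measurable
qed

lemma rot_image_grass:
  fixes h :: "'a::euclidean_space \<Rightarrow> 'a"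
  shows "L \<in> grass k \<Longrightarrow> orthogonal_transformation h \<Longrightarrow> h ` L \<in> grass k"
  using dim_orth_image[of h L] subspace_orth_image[of h L] by (simp add: grass_def)

lemma measurable_rot_image [measurable (raw)]:
  assumes f[measurable]: "f \<in> measurable N frames" and g[measurable]: "g \<in> measurable N (grass_space k)"
  shows "(\<lambda>w. rot (f w) ` g w) \<in> measurable N (grass_space k)"
    "(\<lambda>w. rotinv (f w) ` g w) \<in> measurable N (grass_space k)"
proof -
  have gw: "g w \<in> grass k" if "w \<in> space N" for w using measurable_space[OF g that] by simp
  show "(\<lambda>w. rot (f w) ` g w) \<in> measurable N (grass_space k)"
  proof (rule measurable_into_grass)
    fix x
    have "(\<lambda>w. rot (f w) (proj (g w) (rotinv (f w) x))) \<in> borel_measurable N" by measurable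
    then show "(\<lambda>w. proj (rot (f w) ` g w) x) \<in> borel_measurable N"
      by (rule measurable_cong[THEN iffD1, rotated])
        (metis (no_types, lifting) grass_def gw mem_Collect_eq proj_orth_image rot_orthogonal rot_rotinv)
  qed (simp add: gw rot_image_grass rot_orthogonal)
  show "(\<lambda>w. rotinv (f w) ` g w) \<in> measurable N (grass_space k)"
  proof (rule measurable_into_grass)
    fix x
    have "(\<lambda>w. rotinv (f w) (proj (g w) (rot (f w) x))) \<in> borel_measurable N" by measurable
    then show "(\<lambda>w. proj (rotinv (f w) ` g w) x) \<in> borel_measurable N"
      by (rule measurable_cong[THEN iffD1, rotated])
        (metis (no_types, lifting) grass_def gw mem_Collect_eq proj_orth_image rotinv_orthogonal rotinv_rot)
  qed (simp add: gw rot_image_grass rotinv_orthogonal)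
qed

lemma measurable_orth_image:
  fixes h :: "'a::euclidean_space \<Rightarrow> 'a"
  assumes h: "orthogonal_transformation h"
  shows "(\<lambda>L. h ` L) \<in> measurable (grass_space k) (grass_space k)"
proof (rule measurable_into_grass)
  have [measurable]: "h \<in> borel_measurable borel"
    using h by (intro borel_measurable_linear orthogonal_transformation_linear)
  fix x
  have "(\<lambda>L. h (proj L (inv h x))) \<in> borel_measurable (grass_space k)" by measurable
  moreover have "h (inv h x) = x" by (metis h orthogonal_transformation_surj surj_f_inv_f)
  ultimately show "(\<lambda>L. proj (h ` L) x) \<in> borel_measurable (grass_space k)"
    by (elim measurable_cong[THEN iffD1, rotated]) (auto simp: grass_def proj_orth_image[OF h, symmetric])
qed (simp add: rot_image_grass h)

text \<open>Restricted to the index set because the points of the product space are extensional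
  functions.\<close>

definition rotate_frame :: "('a \<Rightarrow> 'a) \<Rightarrow> (nat \<Rightarrow> 'a::euclidean_space) \<Rightarrow> nat \<Rightarrow> 'a" where
  "rotate_frame h x = (\<lambda>i\<in>{..<DIM('a)}. h (x i))"

lemma distr_rotate_frame:
  fixes h :: "'a::euclidean_space \<Rightarrow> 'a"
  assumes h: "orthogonal_transformation h"
  shows "distr frames frames (rotate_frame h) = frames"
proof -
  have [measurable]: "h \<in> borel_measurable borel"
    using h by (intro borel_measurable_linear orthogonal_transformation_linear)
  have d: "distr ball_unif ball_unif h = ball_unif"
    using ball_unif_orthogonal[OF h] by (metis distr_cong sets_ball_unif)
  have "distr frames (PiM {..<DIM('a)} (\<lambda>_. ball_unif)) (compose {..<DIM('a)} h)
      = PiM {..<DIM('a)} (\<lambda>i. distr ball_unif ball_unif h)"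
    unfolding frames_def
    by (rule distr_PiM_finite_prob_space') (auto intro: prob_space_ball_unif)
  then show ?thesis by (simp add: d frames_def rotate_frame_def[abs_def] compose_def[abs_def])
qed

lemma measurable_rotate_frame:
  fixes h :: "'a::euclidean_space \<Rightarrow> 'a"
  assumes h: "orthogonal_transformation h"
  shows "rotate_frame h \<in> measurable frames frames"
proof -
  have [measurable]: "h \<in> borel_measurable borel"
    using h by (intro borel_measurable_linear orthogonal_transformation_linear)
  show ?thesis unfolding frames_def rotate_frame_def[abs_def] by measurable
qed

lemma gram_schmidt_rotate_frame:
  fixes h :: "'a::euclidean_space \<Rightarrow> 'a"
  assumes h: "orthogonal_transformation h" and "i < DIM('a)"
  shows "gram_schmidt (rotate_frame h x) i = h (gram_schmidt x i)"
  using gram_schmidt_cong[of i "rotate_frame h x" "\<lambda>i. h (x i)"] gram_schmidt_orthogonal[OF h, of x i] assms(2)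
  by (simp add: rotate_frame_def)

text \<open>At degenerate tuples both rotations default to the identity and equivariance can fail;
  such tuples form a null set.\<close>

lemma rot_rotate_frame:
  fixes h :: "'a::euclidean_space \<Rightarrow> 'a"
  assumes h: "orthogonal_transformation h" and x: "\<forall>i<DIM('a). gram_schmidt x i \<noteq> 0"
  shows "rot (rotate_frame h x) v = h (rot x v)" "rotinv (rotate_frame h x) (h v) = rotinv x v"
proof -
  have h0: "h u = 0 \<longleftrightarrow> u = 0" for u
    using orthogonal_transformation_norm[OF h, of u] by (metis norm_eq_zero)
  have g: "\<forall>i<DIM('a). gram_schmidt (rotate_frame h x) i \<noteq> 0" using x by (simp add: gram_schmidt_rotate_frame[OF h] h0)
  show "rot (rotate_frame h x) v = h (rot x v)"
    using x g by (simp add: rot_def gram_schmidt_rotate_frame[OF h] linear_sum[OF orthogonal_transformation_linear[OF h]]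
        orthogonal_transformation_scaleR[OF h])
  show "rotinv (rotate_frame h x) (h v) = rotinv x v"
    using x g by (simp add: rotinv_def gram_schmidt_rotate_frame[OF h] orthogonal_transformation_inner[OF h])
qed

text \<open>The predicate under the description in \<open>haar_grass\<close>, isolated so that
  existence and uniqueness can be proved for it.\<close>

definition haar_like :: "nat \<Rightarrow> 'a::euclidean_space set measure \<Rightarrow> bool" where
  "haar_like k M \<longleftrightarrow> sets M = sets (grass_space k) \<and> emeasure M (space M) = 1 \<and>
       (\<forall>f. orthogonal_transformation f \<longrightarrow> distr M (grass_space k) (\<lambda>L. f ` L) = M)"

text \<open>Rotating a random frame by \<open>h\<close> preserves its law and multiplies
  \<open>rot x\<close> by \<open>h\<close> from the left, almost surely. So the law of
  \<open>rot x\<close> is left invariant, and the image of a fixed \<open>L\<close> inherits the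
  invariance.\<close>

lemma haar_like_exists:
  fixes L :: "'a::euclidean_space set"
  assumes L: "L \<in> grass k"
  shows "haar_like k (distr frames (grass_space k) (\<lambda>x. rot x ` L))"
  unfolding haar_like_def
proof (intro conjI allI impI)
  interpret prob_space "frames :: (nat \<Rightarrow> 'a) measure" by (rule prob_space_frames)
  have m[measurable]: "(\<lambda>x. rot x ` L) \<in> measurable frames (grass_space k)"
    using L by (intro measurable_rot_image measurable_const) auto
  show "emeasure (distr frames (grass_space k) (\<lambda>x. rot x ` L)) (space (distr frames (grass_space k) (\<lambda>x. rot x ` L))) = 1"
    using prob_space.emeasure_space_1[OF prob_space_distr[OF m]] .
  fix h :: "'a \<Rightarrow> 'a" assume h: "orthogonal_transformation h"
  note [measurable] = measurable_orth_image[OF h] measurable_rotate_frame[OF h]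
  have "distr (distr frames (grass_space k) (\<lambda>x. rot x ` L)) (grass_space k) (\<lambda>L. h ` L)
     = distr frames (grass_space k) (\<lambda>x. h ` rot x ` L)"
    by (subst distr_distr) (auto simp: comp_def)
  also have "\<dots> = distr frames (grass_space k) (\<lambda>x. rot (rotate_frame h x) ` L)"
  proof (rule distr_cong_AE)
    show "AE x in frames. h ` rot x ` L = rot (rotate_frame h x) ` L"
      using AE_gram_schmidt_nonzero by eventually_elim (auto simp: rot_rotate_frame[OF h] image_iff)
  qed measurable
  also have "\<dots> = distr (distr frames frames (rotate_frame h)) (grass_space k) (\<lambda>x. rot x ` L)"
    by (subst distr_distr) (auto simp: comp_def)
  also have "\<dots> = distr frames (grass_space k) (\<lambda>x. rot x ` L)" by (simp add: distr_rotate_frame[OF h])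
  finally show "distr (distr frames (grass_space k) (\<lambda>x. rot x ` L)) (grass_space k) (\<lambda>L. h ` L)
     = distr frames (grass_space k) (\<lambda>x. rot x ` L)" .
qed simp

text \<open>The random rotation \<open>rot x\<close> has a left-invariant law, so the average of
  \<open>A\<close> over \<open>rotinv x ` L\<close> does not depend on \<open>L\<close>; integrating it against \<open>M\<close> gives \<open>M A\<close>.\<close>

lemma haar_like_unique:
  fixes M :: "'a::euclidean_space set measure"
  assumes M: "haar_like k M" and L0: "L0 \<in> grass k" and A: "A \<in> sets (grass_space k)"
  shows "emeasure M A = (\<integral>\<^sup>+x. indicator A (rotinv x ` L0) \<partial>frames)"
proof -
  note A[measurable]
  have s[measurable_cong]: "sets M = sets (grass_space k)" using M by (simp add: haar_like_def)
  have sp: "space M = grass k" using sets_eq_imp_space_eq[OF s] by simp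
  interpret M: prob_space M using M by (intro prob_spaceI) (simp add: haar_like_def)
  interpret F: prob_space "frames :: (nat \<Rightarrow> 'a) measure" by (rule prob_space_frames)
  interpret pair_sigma_finite M "frames :: (nat \<Rightarrow> 'a) measure" ..
  define J where "J L = (\<integral>\<^sup>+x. indicator A (rotinv x ` L) \<partial>frames)" for L
  \<comment> \<open>Left invariance of \<open>rot x\<close> is right invariance of
    \<open>rotinv x\<close>, which absorbs the rotation carrying \<open>L0\<close> to
    \<open>L\<close>.\<close>
  have J: "J L = J L0" if L: "L \<in> grass k" for L
  proof -
    obtain h where h: "orthogonal_transformation h" "h ` L0 = L"
      using orth_trans_subspaces[of L0 L] L L0 by (auto simp: grass_def)
    note [measurable] = measurable_rotate_frame[OF h(1)]
    have [measurable]: "(\<lambda>x. rotinv x ` L) \<in> measurable frames (grass_space k)"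
      "(\<lambda>x. rotinv x ` L0) \<in> measurable frames (grass_space k)"
      using L L0 by (auto intro!: measurable_rot_image)
    have "J L = (\<integral>\<^sup>+x. indicator A (rotinv x ` L) \<partial>distr frames frames (rotate_frame h))"
      by (simp add: J_def distr_rotate_frame[OF h(1)])
    also have "\<dots> = (\<integral>\<^sup>+x. indicator A (rotinv (rotate_frame h x) ` L) \<partial>frames)"
      by (subst nn_integral_distr) auto
    also have "\<dots> = J L0" unfolding J_def
    proof (rule nn_integral_cong_AE)
      show "AE x in frames. (indicator A (rotinv (rotate_frame h x) ` L) :: ennreal) = indicator A (rotinv x ` L0)"
        using AE_gram_schmidt_nonzero
      proof eventually_elim
        case (elim x)
        then have "rotinv (rotate_frame h x) ` L = rotinv x ` L0"
          unfolding h(2)[symmetric] image_image by (simp add: rot_rotate_frame[OF h(1)])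
        then show ?case by simp
      qed
    qed
    finally show ?thesis .
  qed
  have e: "emeasure M A = (\<integral>\<^sup>+L. indicator A (rotinv x ` L) \<partial>M)" for x
  proof -
    note [measurable] = measurable_orth_image[OF rotinv_orthogonal[of x]]
    have "distr M (grass_space k) (\<lambda>L. rotinv x ` L) = M"
      using M rotinv_orthogonal[of x] by (simp add: haar_like_def)
    then have "emeasure M A = (\<integral>\<^sup>+L. indicator A L \<partial>distr M (grass_space k) (\<lambda>L. rotinv x ` L))"
      using A s by simp
    also have "\<dots> = (\<integral>\<^sup>+L. indicator A (rotinv x ` L) \<partial>M)" by (subst nn_integral_distr) auto
    finally show ?thesis .
  qed
  have "emeasure M A = (\<integral>\<^sup>+x. emeasure M A \<partial>(frames :: (nat \<Rightarrow> 'a) measure))"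
    by (simp add: F.emeasure_space_1)
  also have "\<dots> = (\<integral>\<^sup>+x. (\<integral>\<^sup>+L. indicator A (rotinv x ` L) \<partial>M) \<partial>frames)"
    by (intro nn_integral_cong e)
  also have "\<dots> = (\<integral>\<^sup>+L. J L \<partial>M)" unfolding J_def by (rule Fubini') measurable
  also have "\<dots> = (\<integral>\<^sup>+L. J L0 \<partial>M)" by (intro nn_integral_cong J) (simp add: sp)
  also have "\<dots> = J L0" by (simp add: M.emeasure_space_1)
  finally show ?thesis by (simp add: J_def)
qed

lemma haar_like_haar_grass:
  assumes "k \<le> DIM('a::euclidean_space)"
  shows "haar_like k (haar_grass k :: 'a set measure)"
proof -
  obtain L0 :: "'a set" where L0: "L0 \<in> grass k"
    using choose_subspace_of_subspace[of k "UNIV :: 'a set"] assms by (auto simp: grass_def)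
  let ?N = "distr frames (grass_space k) (\<lambda>x. rot x ` L0)"
  have N: "haar_like k ?N" by (rule haar_like_exists[OF L0])
  have "haar_grass k = ?N" unfolding haar_grass_def haar_like_def[symmetric]
  proof (rule the_equality[where P = "haar_like k", OF N])
    fix M :: "'a set measure" assume M: "haar_like k M"
    show "M = ?N"
    proof (rule measure_eqI)
      show "sets M = sets ?N" using M by (simp add: haar_like_def)
      fix A assume "A \<in> sets M"
      then have "A \<in> sets (grass_space k)" using M by (simp add: haar_like_def)
      then show "emeasure M A = emeasure ?N A"
        using haar_like_unique[OF M L0] haar_like_unique[OF N L0] by simp
    qed
  qed
  then show ?thesis using N by simp
qed

section \<open>Parallel sets along a subspace\<close>

text \<open>For \<open>\<epsilon> \<ge> 0\<close> the sum of \<open>K\<close> and the ball of radius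
  \<open>\<epsilon>\<close> in \<open>L\<close>. It covers \<open>par_body\<close> with
  \<open>L = UNIV\<close> and \<open>par_in\<close> with the direction space of \<open>E\<close>,
  and stating it through differences avoids dividing by \<open>\<epsilon>\<close>.\<close>

definition par_along :: "'a::euclidean_space set \<Rightarrow> 'a set \<Rightarrow> real \<Rightarrow> 'a set" where
  "par_along L K \<epsilon> = {s. \<exists>x\<in>K. s - x \<in> L \<and> norm (s - x) \<le> \<epsilon>}"

lemma par_body_eq: "\<epsilon> \<ge> 0 \<Longrightarrow> par_body K \<epsilon> = par_along UNIV K \<epsilon>"
proof (intro set_eqI iffI)
  fix s assume e: "\<epsilon> \<ge> 0"
  { assume "s \<in> par_body K \<epsilon>"
    then obtain x u where "s = x + \<epsilon> *\<^sub>R u" "x \<in> K" "norm u \<le> 1" by (auto simp: par_body_def)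
    then show "s \<in> par_along UNIV K \<epsilon>" using e by (auto simp: par_along_def intro!: bexI[of _ x] mult_left_le) }
  { assume "s \<in> par_along UNIV K \<epsilon>"
    then obtain x where x: "x \<in> K" "norm (s - x) \<le> \<epsilon>" by (auto simp: par_along_def)
    show "s \<in> par_body K \<epsilon>"
    proof (cases "\<epsilon> = 0")
      case True then show ?thesis using x unfolding par_body_def by (auto intro!: exI[of _ s] exI[of _ 0])
    next
      case False
      then have "s = x + \<epsilon> *\<^sub>R ((1 / \<epsilon>) *\<^sub>R (s - x))" "norm ((1 / \<epsilon>) *\<^sub>R (s - x)) \<le> 1" using e x by auto
      then show ?thesis using x unfolding par_body_def by blast
    qed }
qed

lemma par_in_eq: 
  assumes "subspace (lin_part E)" "\<epsilon> \<ge> 0"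
  shows "par_in E M \<epsilon> = par_along (lin_part E) M \<epsilon>"
proof (intro set_eqI iffI)
  fix s 
  { assume "s \<in> par_in E M \<epsilon>"
    then obtain x u where "s = x + \<epsilon> *\<^sub>R u" "x \<in> M" "norm u \<le> 1" "u \<in> lin_part E" by (auto simp: par_in_def)
    then show "s \<in> par_along (lin_part E) M \<epsilon>" using assms
      by (auto simp: par_along_def intro!: bexI[of _ x] mult_left_le subspace_mul) }
  { assume "s \<in> par_along (lin_part E) M \<epsilon>"
    then obtain x where x: "x \<in> M" "norm (s - x) \<le> \<epsilon>" "s - x \<in> lin_part E" by (auto simp: par_along_def)
    show "s \<in> par_in E M \<epsilon>"
    proof (cases "\<epsilon> = 0")
      case True then show ?thesis using x assms unfolding par_in_def by (auto intro!: exI[of _ s] exI[of _ 0] subspace_0)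
    next
      case False
      then have "s = x + \<epsilon> *\<^sub>R ((1 / \<epsilon>) *\<^sub>R (s - x))" "norm ((1 / \<epsilon>) *\<^sub>R (s - x)) \<le> 1" using assms x by auto
      moreover have "(1 / \<epsilon>) *\<^sub>R (s - x) \<in> lin_part E" using assms x by (intro subspace_mul)
      ultimately show ?thesis using x unfolding par_in_def by blast
    qed }
qed

text \<open>Writes the parallel set as the image of a product under addition, from which compactness
  and convexity follow.\<close>

lemma par_along_image: "par_along L K \<epsilon> = (\<lambda>(x, v). x + v) ` (K \<times> (L \<inter> cball 0 \<epsilon>))"
proof (intro set_eqI iffI)
  fix s
  { assume "s \<in> par_along L K \<epsilon>"
    then obtain x where "x \<in> K" "s - x \<in> L" "norm (s - x) \<le> \<epsilon>" by (auto simp: par_along_def)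
    then show "s \<in> (\<lambda>(x, v). x + v) ` (K \<times> (L \<inter> cball 0 \<epsilon>))" by (intro image_eqI[of _ _ "(x, s - x)"]) auto }
qed (auto simp: par_along_def intro!: bexI)

lemma compact_par_along: "compact K \<Longrightarrow> subspace L \<Longrightarrow> compact (par_along L K \<epsilon>)"
  unfolding par_along_image
  by (intro compact_continuous_image compact_Times closed_Int_compact closed_subspace)
    (auto simp: case_prod_beta intro!: continuous_intros)

lemma borel_par_along: "compact K \<Longrightarrow> subspace L \<Longrightarrow> par_along L K \<epsilon> \<in> sets borel"
  by (simp add: compact_par_along borel_compact)

text \<open>Membership is the vanishing of \<open>?g\<close> at some point of the compact
  \<open>K\<close>: one summand is the distance of \<open>s - x\<close> from \<open>L\<close>, the
  other the excess of its norm over \<open>\<epsilon>\<close>.\<close>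

lemma sets_par_along_pair:
  fixes K :: "'a::euclidean_space set"
  assumes "compact K"
  shows "{w \<in> space (grass_space k \<Otimes>\<^sub>M borel). snd w \<in> par_along (fst w) K \<epsilon>} \<in> sets (grass_space k \<Otimes>\<^sub>M borel)"
proof -
  let ?N = "grass_space k \<Otimes>\<^sub>M (borel :: 'a measure)"
  let ?g = "\<lambda>w x. norm ((snd w - x) - proj (fst w) (snd w - x)) + max 0 (norm (snd w - x) - \<epsilon>)"
  have "{w \<in> space ?N. \<exists>x\<in>K. ?g w x = 0} \<in> sets ?N"
  proof (rule sets_exists_compact[OF assms])
    show "(\<lambda>w. ?g w x) \<in> borel_measurable ?N" for x by measurable
    show "continuous_on K (?g w)" for w by (intro continuous_intros)
  qed simp
  also have "{w \<in> space ?N. \<exists>x\<in>K. ?g w x = 0} = {w \<in> space ?N. snd w \<in> par_along (fst w) K \<epsilon>}"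
  proof -
    have "?g w x = 0 \<longleftrightarrow> snd w - x \<in> fst w \<and> norm (snd w - x) \<le> \<epsilon>" if "w \<in> space ?N" for w x
    proof -
      have L: "subspace (fst w)" using that by (auto simp: space_pair_measure grass_def)
      have "?g w x = 0 \<longleftrightarrow> norm ((snd w - x) - proj (fst w) (snd w - x)) = 0 \<and> max 0 (norm (snd w - x) - \<epsilon>) = 0"
        by (intro add_nonneg_eq_0_iff) auto
      also have "\<dots> \<longleftrightarrow> snd w - x \<in> fst w \<and> norm (snd w - x) \<le> \<epsilon>"
        using proj_eq_iff[OF L, of "snd w - x"] by (auto simp: max_def)
      finally show ?thesis .
    qed
    then show ?thesis unfolding par_along_def by blast
  qed
  finally show ?thesis .
qed

section \<open>Lebesgue measure on a subspace\<close>

interpretation lborel_prod: product_sigma_finite "\<lambda>_::nat. lborel :: real measure" ..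

text \<open>The product measure is determined on boxes, where a shift acts factor by factor.\<close>

lemma PiM_lborel_shift:
  "distr (PiM {..<n} (\<lambda>_. lborel)) (PiM {..<n} (\<lambda>_. lborel)) (\<lambda>t. \<lambda>i\<in>{..<n}. t i + a i) = PiM {..<n::nat} (\<lambda>_. lborel :: real measure)"
proof (rule lborel_prod.PiM_eqI)
  have m[measurable]: "(\<lambda>t. \<lambda>i\<in>{..<n}. t i + a i) \<in> measurable (PiM {..<n} (\<lambda>_. lborel :: real measure)) (PiM {..<n} (\<lambda>_. lborel))"
    by measurable
  fix A :: "nat \<Rightarrow> real set" assume A: "\<And>i. i \<in> {..<n} \<Longrightarrow> A i \<in> sets lborel"
  have A': "(\<lambda>x. x + a i) -` A i \<in> sets borel" if "i < n" for i
    using measurable_sets[of "\<lambda>x. x + a i" borel borel "A i"] A[of i] that by simp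
  have e: "emeasure lborel ((\<lambda>x. x + a i) -` A i) = emeasure lborel (A i)" if "i < n" for i
  proof -
    have comm: "(\<lambda>x. x + a i) = (+) (a i)" by (auto simp: add.commute)
    have "emeasure lborel (A i) = emeasure (distr lborel borel ((+) (a i))) (A i)" by (simp add: lborel_distr_plus)
    also have "\<dots> = emeasure lborel ((\<lambda>x. x + a i) -` A i)"
      using A[of i] that by (subst emeasure_distr) (auto simp: comm)
    finally show ?thesis by simp
  qed
  have "(\<lambda>t. \<lambda>i\<in>{..<n}. t i + a i) -` (Pi\<^sub>E {..<n} A) \<inter> space (PiM {..<n} (\<lambda>_. lborel :: real measure))
    = Pi\<^sub>E {..<n} (\<lambda>i. (\<lambda>x. x + a i) -` A i)"
  proof (intro set_eqI)
    fix t
    have "(\<lambda>i\<in>{..<n}. t i + a i) \<in> Pi\<^sub>E {..<n} A \<longleftrightarrow> (\<forall>i<n. t i + a i \<in> A i)"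
      by (simp add: PiE_iff Ball_def)
    moreover have "t \<in> space (PiM {..<n} (\<lambda>_. lborel :: real measure)) \<longleftrightarrow> t \<in> extensional {..<n}"
      by (simp add: space_PiM PiE_iff)
    moreover have "t \<in> Pi\<^sub>E {..<n} (\<lambda>i. (\<lambda>x. x + a i) -` A i) \<longleftrightarrow> (\<forall>i<n. t i + a i \<in> A i) \<and> t \<in> extensional {..<n}"
      by (simp add: PiE_iff Ball_def)
    ultimately show "t \<in> (\<lambda>t. \<lambda>i\<in>{..<n}. t i + a i) -` (Pi\<^sub>E {..<n} A) \<inter> space (PiM {..<n} (\<lambda>_. lborel :: real measure))
      \<longleftrightarrow> t \<in> Pi\<^sub>E {..<n} (\<lambda>i. (\<lambda>x. x + a i) -` A i)"
      by (simp only: vimage_eq Int_iff)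
  qed
  moreover have "emeasure (PiM {..<n} (\<lambda>_. lborel)) (Pi\<^sub>E {..<n} (\<lambda>i. (\<lambda>x. x + a i) -` A i))
      = (\<Prod>i\<in>{..<n}. emeasure lborel ((\<lambda>x. x + a i) -` A i))"
    using A' by (intro lborel_prod.emeasure_PiM) auto
  moreover have "(\<Prod>i\<in>{..<n}. emeasure lborel ((\<lambda>x. x + a i) -` A i)) = (\<Prod>i\<in>{..<n}. emeasure lborel (A i))"
    using e by (intro prod.cong) auto
  moreover have "Pi\<^sub>E {..<n} A \<in> sets (PiM {..<n} (\<lambda>_. lborel :: real measure))"
    using A by (intro sets_PiM_I_finite) auto
  ultimately show "emeasure (distr (PiM {..<n} (\<lambda>_. lborel)) (PiM {..<n} (\<lambda>_. lborel)) (\<lambda>t. \<lambda>i\<in>{..<n}. t i + a i)) (Pi\<^sub>E {..<n} A)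
     = (\<Prod>i\<in>{..<n}. emeasure lborel (A i))"
    by (simp only: emeasure_distr[OF m])
qed auto

abbreviation (input) coord_space :: "nat \<Rightarrow> (nat \<Rightarrow> real) measure" where
  "coord_space n \<equiv> PiM {..<n} (\<lambda>_. lborel)"

definition emb :: "'a::euclidean_space set \<Rightarrow> (nat \<Rightarrow> real) \<Rightarrow> 'a" where
  "emb S t = (\<Sum>i<dim S. t i *\<^sub>R onb S i)"

lemma lebesgue_subspace_emb: "lebesgue_subspace S = distr (coord_space (dim S)) borel (emb S)"
  by (simp add: lebesgue_subspace_def emb_def[abs_def])

lemma measurable_emb [measurable]: "emb S \<in> borel_measurable (coord_space (dim S))"
  unfolding emb_def[abs_def] by measurable

lemma sets_lebesgue_subspace [simp, measurable_cong]: "sets (lebesgue_subspace S) = sets borel"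
  by (simp add: lebesgue_subspace_def)

lemma space_lebesgue_subspace [simp]: "space (lebesgue_subspace S) = UNIV"
  by (simp add: lebesgue_subspace_def)

lemma emb_in: "subspace S \<Longrightarrow> emb S t \<in> S"
  unfolding emb_def by (intro subspace_sum subspace_mul onb_in) auto

text \<open>\<open>lebesgue_subspace S\<close> is a measure on the whole space carried by
  \<open>S\<close>; this lets integrands be compared on \<open>S\<close> alone.\<close>

lemma AE_lebesgue_subspace: "subspace S \<Longrightarrow> AE x in lebesgue_subspace S. x \<in> S"
  unfolding lebesgue_subspace_emb using closed_subspace[of S]
  by (subst AE_distr_iff) (auto simp: emb_in)

lemma norm_emb:
  assumes S: "subspace S" shows "(norm (emb S t))\<^sup>2 = (\<Sum>i<dim S. (t i)\<^sup>2)"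
proof -
  have "(norm (emb S t))\<^sup>2 = (\<Sum>i<dim S. t i * (emb S t \<bullet> onb S i))"
    unfolding power2_norm_eq_inner by (subst (2) emb_def) (simp add: inner_sum_right)
  also have "\<dots> = (\<Sum>i<dim S. (t i)\<^sup>2)"
  proof (intro sum.cong refl)
    fix i assume i: "i \<in> {..<dim S}"
    have "emb S t \<bullet> onb S i = (\<Sum>j<dim S. if j = i then t j else 0)"
      unfolding emb_def inner_sum_left by (intro sum.cong) (use onb_inner[OF S] i in auto)
    also have "\<dots> = t i" using i by simp
    finally show "t i * (emb S t \<bullet> onb S i) = (t i)\<^sup>2" by (simp add: power2_eq_square)
  qed
  finally show ?thesis .
qed

lemma lebesgue_subspace_cball_finite:
  assumes S: "subspace S" shows "emeasure (lebesgue_subspace S) (cball 0 r) < \<infinity>"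
proof -
  have "emeasure (lebesgue_subspace S) (cball 0 r) = emeasure (coord_space (dim S)) (emb S -` cball 0 r \<inter> space (coord_space (dim S)))"
    unfolding lebesgue_subspace_emb by (subst emeasure_distr) auto
  also have "\<dots> \<le> emeasure (coord_space (dim S)) (Pi\<^sub>E {..<dim S} (\<lambda>_. {-r..r}))"
  proof (intro emeasure_mono)
    show "emb S -` cball 0 r \<inter> space (coord_space (dim S)) \<subseteq> Pi\<^sub>E {..<dim S} (\<lambda>_. {-r..r})"
    proof
      fix t assume t: "t \<in> emb S -` cball 0 r \<inter> space (coord_space (dim S))"
      have "\<bar>t i\<bar> \<le> r" if "i < dim S" for i
      proof -
        have r: "norm (emb S t) \<le> r" using t by simp
        have "(t i)\<^sup>2 \<le> (\<Sum>i<dim S. (t i)\<^sup>2)" using that by (intro member_le_sum) auto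
        also have "\<dots> \<le> r\<^sup>2" unfolding norm_emb[OF S, symmetric] using r by (intro power_mono) auto
        finally show ?thesis using r norm_ge_zero[of "emb S t"] by (metis abs_le_square_iff abs_of_nonneg order_trans)
      qed
      then show "t \<in> Pi\<^sub>E {..<dim S} (\<lambda>_. {-r..r})" using t by (force simp: space_PiM PiE_iff abs_le_iff)
    qed
  qed (auto intro!: sets_PiM_I_finite)
  also have "\<dots> = (\<Prod>i<dim S. emeasure lborel {-r..r})" by (rule lborel_prod.emeasure_PiM) auto
  also have "\<dots> < \<infinity>" by (simp add: ennreal_power[symmetric] emeasure_lborel_Icc_eq power_less_top_ennreal)
  finally show ?thesis .
qed

lemma sigma_finite_lebesgue_subspace: "subspace S \<Longrightarrow> sigma_finite_measure (lebesgue_subspace S)"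
  by (intro sigma_finite_cball lebesgue_subspace_cball_finite) auto

text \<open>In the coordinates of \<open>emb\<close>, translation by \<open>a\<close> is the shift
  by the inner products of \<open>a\<close> with the basis vectors; membership of \<open>a\<close>
  in \<open>S\<close> ensures that these recover \<open>a\<close>.\<close>

lemma lebesgue_subspace_shift:
  assumes S: "subspace S" and a: "a \<in> S"
  shows "distr (lebesgue_subspace S) borel (\<lambda>x. x + a) = lebesgue_subspace S"
proof -
  let ?C = "coord_space (dim S)"
  let ?sh = "\<lambda>t. \<lambda>i\<in>{..<dim S}. t i + a \<bullet> onb S i"
  have e: "emb S (?sh t) = emb S t + a" for t
  proof -
    have "emb S (?sh t) = emb S t + proj S a"
      by (simp add: emb_def proj_def scaleR_add_left sum.distrib)
    then show ?thesis using proj_id[OF S a] by simp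
  qed
  have "lebesgue_subspace S = distr (distr ?C ?C ?sh) borel (emb S)"
    unfolding lebesgue_subspace_emb PiM_lborel_shift ..
  also have "\<dots> = distr ?C borel (\<lambda>t. emb S t + a)"
    by (subst distr_distr) (auto simp: comp_def e)
  also have "\<dots> = distr (lebesgue_subspace S) borel (\<lambda>x. x + a)"
    unfolding lebesgue_subspace_emb by (subst distr_distr) (auto simp: comp_def)
  finally show ?thesis by simp
qed

lemma nn_integral_subspace_shift:
  assumes S: "subspace S" and a: "a \<in> S" and u[measurable]: "u \<in> borel_measurable borel"
  shows "(\<integral>\<^sup>+x. u (x + a) \<partial>lebesgue_subspace S) = (\<integral>\<^sup>+x. u x \<partial>lebesgue_subspace S)"
  by (subst (2) lebesgue_subspace_shift[OF S a, symmetric], subst nn_integral_distr) auto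

text \<open>Ratio of the mass of the unit ball for the product of the two coordinate measures to its
  volume in \<open>'a\<close>, which is \<open>1\<close> for \<open>k \<le> DIM('a)\<close>. Writing
  it through \<open>k\<close> alone makes visible that it depends on no particular subspace; it is
  carried along as a factor of the final constants.\<close>

definition split_const :: "'a::euclidean_space itself \<Rightarrow> nat \<Rightarrow> ennreal" where
  "split_const _ k = (\<integral>\<^sup>+t'. (\<integral>\<^sup>+t. indicator {..1} ((\<Sum>i<k. (t i)\<^sup>2) + (\<Sum>i<DIM('a) - k. (t' i)\<^sup>2))
      \<partial>coord_space k) \<partial>coord_space (DIM('a) - k)) / emeasure lborel (cball (0::'a) 1)"

text \<open>The image under addition of the two subspace measures is translation invariant on the
  whole space, hence a multiple of Lebesgue measure.\<close>

lemma nn_integral_split: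
  fixes L :: "'a::euclidean_space set"
  assumes L: "subspace L" and u[measurable]: "u \<in> borel_measurable borel"
  shows "(\<integral>\<^sup>+y. (\<integral>\<^sup>+x. u (x + y) \<partial>lebesgue_subspace L) \<partial>lebesgue_subspace (L\<^sup>\<bottom>))
     = split_const TYPE('a) (dim L) * (\<integral>\<^sup>+s. u s \<partial>lborel)" (is ?eq)
    and "split_const TYPE('a) (dim L) < \<infinity>"
proof -
  let ?m = "lebesgue_subspace L" and ?m' = "lebesgue_subspace (L\<^sup>\<bottom>)"
  have L': "subspace (L\<^sup>\<bottom>)" by (rule subspace_orthogonal_comp)
  interpret m: sigma_finite_measure ?m using L by (rule sigma_finite_lebesgue_subspace)
  interpret m': sigma_finite_measure ?m' using L' by (rule sigma_finite_lebesgue_subspace)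
  interpret pair_sigma_finite ?m' ?m ..
  define \<mu> where "\<mu> = distr (?m' \<Otimes>\<^sub>M ?m) borel (\<lambda>(y, x). x + y)"
  have s[simp, measurable_cong]: "sets \<mu> = sets borel" by (simp add: \<mu>_def)
  have \<mu>: "(\<integral>\<^sup>+s. v s \<partial>\<mu>) = (\<integral>\<^sup>+y. (\<integral>\<^sup>+x. v (x + y) \<partial>?m) \<partial>?m')" if [measurable]: "v \<in> borel_measurable borel" for v
  proof -
    have "(\<integral>\<^sup>+s. v s \<partial>\<mu>) = (\<integral>\<^sup>+p. v (snd p + fst p) \<partial>(?m' \<Otimes>\<^sub>M ?m))"
      unfolding \<mu>_def by (subst nn_integral_distr) (auto simp: case_prod_beta)
    also have "\<dots> = (\<integral>\<^sup>+y. (\<integral>\<^sup>+x. v (x + y) \<partial>?m) \<partial>?m')"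
      by (subst m.nn_integral_fst[symmetric]) auto
    finally show ?thesis .
  qed
  have py: "(norm (x + y))\<^sup>2 = (norm x)\<^sup>2 + (norm y)\<^sup>2" if "x \<in> L" "y \<in> L\<^sup>\<bottom>" for x y
    using that by (intro norm_add_Pythagorean) (auto simp: orthogonal_comp_def)
  have AEL: "AE x in ?m. x \<in> L" "AE y in ?m'. y \<in> L\<^sup>\<bottom>" using L L' by (auto intro: AE_lebesgue_subspace)
  \<comment> \<open>By Pythagoras the indicator depends on \<open>x\<close> and \<open>y\<close>
    only through their norms, so the mass of a ball does not depend on the position of
    \<open>L\<close>.\<close>
  have ball: "emeasure \<mu> (cball 0 r) = (\<integral>\<^sup>+y. (\<integral>\<^sup>+x. indicator {..r\<^sup>2} ((norm x)\<^sup>2 + (norm y)\<^sup>2) \<partial>?m) \<partial>?m')"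
    if r: "r \<ge> 0" for r
  proof -
    have "emeasure \<mu> (cball 0 r) = (\<integral>\<^sup>+s. indicator (cball 0 r) s \<partial>\<mu>)" by (simp add: nn_integral_indicator)
    also have "\<dots> = (\<integral>\<^sup>+y. (\<integral>\<^sup>+x. indicator (cball 0 r) (x + y) \<partial>?m) \<partial>?m')"
      by (rule \<mu>) (auto intro!: borel_measurable_indicator)
    also have "\<dots> = (\<integral>\<^sup>+y. (\<integral>\<^sup>+x. indicator {..r\<^sup>2} ((norm x)\<^sup>2 + (norm y)\<^sup>2) \<partial>?m) \<partial>?m')"
    proof (rule nn_integral_cong_AE)
      show "AE y in ?m'. (\<integral>\<^sup>+x. indicator (cball 0 r) (x + y) \<partial>?m) = (\<integral>\<^sup>+x. indicator {..r\<^sup>2} ((norm x)\<^sup>2 + (norm y)\<^sup>2) \<partial>?m)"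
        using AEL(2)
      proof eventually_elim
        case (elim y)
        show ?case
        proof (rule nn_integral_cong_AE)
          show "AE x in ?m. (indicator (cball 0 r) (x + y) :: ennreal) = indicator {..r\<^sup>2} ((norm x)\<^sup>2 + (norm y)\<^sup>2)"
            using AEL(1)
          proof eventually_elim
            case (elim x)
            have "norm (x + y) \<le> r \<longleftrightarrow> (norm (x + y))\<^sup>2 \<le> r\<^sup>2"
              using r by (metis abs_le_square_iff abs_norm_cancel abs_of_nonneg)
            then show ?case using py[OF elim \<open>y \<in> L\<^sup>\<bottom>\<close>] by (simp add: indicator_def)
          qed
        qed
      qed
    qed
    finally show ?thesis .
  qed
  have fin: "emeasure \<mu> (cball 0 r) < \<infinity>" if r: "r \<ge> 0" for r
  proof -
    have "emeasure \<mu> (cball 0 r) \<le> (\<integral>\<^sup>+y. (\<integral>\<^sup>+x. indicator (cball 0 r) y * indicator (cball 0 r) x \<partial>?m) \<partial>?m')"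
      unfolding ball[OF r]
    proof (intro nn_integral_mono)
      fix x y :: 'a
      have "norm x \<le> r \<and> norm y \<le> r" if "(norm x)\<^sup>2 + (norm y)\<^sup>2 \<le> r\<^sup>2"
      proof -
        have "(norm x)\<^sup>2 \<le> r\<^sup>2" "(norm y)\<^sup>2 \<le> r\<^sup>2"
          using that zero_le_power2[of "norm x"] zero_le_power2[of "norm y"] by linarith+
        then show ?thesis using r by (metis power2_le_imp_le)
      qed
      then show "(indicator {..r\<^sup>2} ((norm x)\<^sup>2 + (norm y)\<^sup>2) :: ennreal) \<le> indicator (cball 0 r) y * indicator (cball 0 r) x"
        by (auto simp: indicator_def)
    qed
    also have "\<dots> = emeasure ?m' (cball 0 r) * emeasure ?m (cball 0 r)"
      by (simp add: nn_integral_cmult nn_integral_multc borel_measurable_indicator nn_integral_indicator)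
    also have "\<dots> < \<infinity>" using lebesgue_subspace_cball_finite[OF L, of r] lebesgue_subspace_cball_finite[OF L', of r]
      by (simp add: ennreal_mult_less_top)
    finally show ?thesis .
  qed
  have sf: "sigma_finite_measure \<mu>" by (intro sigma_finite_cball s fin) simp
  \<comment> \<open>A translation splits into one along \<open>L\<close> and one along the
    complement, each absorbed by its own measure.\<close>
  have inv: "distr \<mu> borel (\<lambda>x. x + a) = \<mu>" for a
  proof (rule measure_eqI)
    fix A assume "A \<in> sets (distr \<mu> borel (\<lambda>x. x + a))"
    then have A[measurable]: "A \<in> sets borel" by simp
    have [measurable]: "(indicator A :: 'a \<Rightarrow> ennreal) \<in> borel_measurable borel" using A by (rule borel_measurable_indicator)
    have aL: "proj L a \<in> L" "a - proj L a \<in> L\<^sup>\<bottom>" using L by (auto simp: proj_in orth_comp_mem proj_perp)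
    have "emeasure (distr \<mu> borel (\<lambda>x. x + a)) A = (\<integral>\<^sup>+s. indicator A s \<partial>distr \<mu> borel (\<lambda>x. x + a))"
      using A by (intro nn_integral_indicator[symmetric]) simp
    also have "\<dots> = (\<integral>\<^sup>+s. indicator A (s + a) \<partial>\<mu>)" by (subst nn_integral_distr) auto
    also have "\<dots> = (\<integral>\<^sup>+y. (\<integral>\<^sup>+x. indicator A ((x + proj L a) + (y + (a - proj L a))) \<partial>?m) \<partial>?m')"
      by (subst \<mu>) (auto simp: algebra_simps)
    also have "\<dots> = (\<integral>\<^sup>+y. (\<integral>\<^sup>+x. indicator A (x + (y + (a - proj L a))) \<partial>?m) \<partial>?m')"
      by (intro nn_integral_cong nn_integral_subspace_shift[OF L aL(1), of "\<lambda>x. indicator A (x + b)" for b]) measurable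
    also have "\<dots> = (\<integral>\<^sup>+y. (\<integral>\<^sup>+x. indicator A (x + y) \<partial>?m) \<partial>?m')"
      by (rule nn_integral_subspace_shift[OF L' aL(2), of "\<lambda>y. \<integral>\<^sup>+x. indicator A (x + y) \<partial>?m"]) measurable
    also have "\<dots> = (\<integral>\<^sup>+s. indicator A s \<partial>\<mu>)" by (rule \<mu>[symmetric]) measurable
    also have "\<dots> = emeasure \<mu> A" by simp
    finally show "emeasure (distr \<mu> borel (\<lambda>x. x + a)) A = emeasure \<mu> A" .
  qed simp
  have c: "split_const TYPE('a) (dim L) = emeasure \<mu> (cball 0 1) / emeasure lborel (cball (0::'a) 1)"
  proof -
    have "emeasure \<mu> (cball 0 1) = (\<integral>\<^sup>+y. (\<integral>\<^sup>+t. indicator {..1} ((\<Sum>i<dim L. (t i)\<^sup>2) + (norm y)\<^sup>2) \<partial>coord_space (dim L)) \<partial>?m')"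
      using ball[of 1] by (simp add: lebesgue_subspace_emb[of L] nn_integral_distr norm_emb[OF L])
    also have "\<dots> = (\<integral>\<^sup>+t'. (\<integral>\<^sup>+t. indicator {..1} ((\<Sum>i<dim L. (t i)\<^sup>2) + (\<Sum>i<DIM('a) - dim L. (t' i)\<^sup>2)) \<partial>coord_space (dim L)) \<partial>coord_space (DIM('a) - dim L))"
    proof -
      interpret C: sigma_finite_measure "coord_space (dim L)" by (rule lborel_prod.sigma_finite) simp
      have [measurable]: "(\<lambda>y. \<integral>\<^sup>+t. indicator {..1} ((\<Sum>i<dim L. (t i)\<^sup>2) + (norm y)\<^sup>2) \<partial>coord_space (dim L)) \<in> borel_measurable (borel :: 'a measure)"
        by measurable
      show ?thesis
        unfolding lebesgue_subspace_emb[of "L\<^sup>\<bottom>"]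
        using measurable_emb[of "L\<^sup>\<bottom>"]
        by (subst nn_integral_distr) (auto simp: norm_emb[OF L'] dim_orth_comp[OF L])
    qed
    finally show ?thesis by (simp add: split_const_def)
  qed
  show fc: "split_const TYPE('a) (dim L) < \<infinity>"
    unfolding c using fin[of 1] emeasure_cball_pos_fin[where 'a='a]
    by (auto simp: ennreal_divide_eq_top_iff less_top[symmetric])
  have em: "emeasure \<mu> A = split_const TYPE('a) (dim L) * emeasure lborel A" if A: "A \<in> sets borel" for A
    unfolding c by (rule translation_invariant_eq[OF s sf inv A])
  have "\<mu> = density lborel (\<lambda>_. split_const TYPE('a) (dim L))"
    by (rule measure_eqI) (auto simp: em emeasure_density nn_integral_cmult)
  then have "(\<integral>\<^sup>+s. u s \<partial>\<mu>) = split_const TYPE('a) (dim L) * (\<integral>\<^sup>+s. u s \<partial>lborel)"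
    by (simp add: nn_integral_density nn_integral_cmult)
  then show ?eq by (simp add: \<mu>)
qed

lemma lin_part_translate:
  assumes "subspace L" shows "lin_part ((\<lambda>x. x + y) ` L) = L"
proof -
  have "x \<in> lin_part ((\<lambda>x. x + y) ` L)" if "x \<in> L" for x
  proof -
    have "x = (x + y) - (0 + y)" "x + y \<in> (\<lambda>x. x + y) ` L" "0 + y \<in> (\<lambda>x. x + y) ` L"
      using that subspace_0[OF assms] by (auto simp del: add_0)
    then show ?thesis unfolding lin_part_def by blast
  qed
  then show ?thesis using assms by (auto simp: lin_part_def subspace_diff)
qed

text \<open>Two normalizations: the base point of \<open>E\<close> picked by \<open>SOME\<close> in
  \<open>lebesgue_affine\<close> disappears by translation invariance, and the intersection with
  \<open>E\<close> is already enforced by moving along \<open>L\<close>.\<close>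

lemma fibre_integral:
  fixes L :: "'a::euclidean_space set" and y :: 'a
  assumes L: "subspace L" and K: "compact K" and e: "\<epsilon> \<ge> 0"
  defines "E \<equiv> (\<lambda>x. x + y) ` L"
  shows "(\<integral>s. indicator (par_in E (K \<inter> E) \<epsilon>) s * (norm s)\<^sup>2 \<partial>lebesgue_affine E)
    = (\<integral>x. indicator (par_along L K \<epsilon>) (x + y) * (norm (x + y))\<^sup>2 \<partial>lebesgue_subspace L)"
proof -
  define a where "a = (SOME a. a \<in> E)"
  have lp: "lin_part E = L" unfolding E_def by (rule lin_part_translate[OF L])
  have "E \<noteq> {}" using subspace_0[OF L] by (auto simp: E_def)
  then have "a \<in> E" unfolding a_def by (simp add: some_in_eq)
  then obtain x0 where x0: "x0 \<in> L" "a = x0 + y" by (auto simp: E_def)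
  have cE: "closed E" unfolding E_def using closed_translation[OF closed_subspace[OF L], of y]
    by (simp add: add.commute image_def)
  have KE: "compact (K \<inter> E)" using K cE by (rule compact_Int_closed)
  let ?f = "\<lambda>s. indicator (par_along L (K \<inter> E) \<epsilon>) s * (norm s)\<^sup>2 :: real"
  have [measurable]: "par_along L (K \<inter> E) \<epsilon> \<in> sets borel" "par_along L K \<epsilon> \<in> sets borel"
    using borel_par_along[OF KE L] borel_par_along[OF K L] by auto
  have "(\<integral>s. indicator (par_in E (K \<inter> E) \<epsilon>) s * (norm s)\<^sup>2 \<partial>lebesgue_affine E)
     = (\<integral>s. ?f s \<partial>distr (lebesgue_subspace L) borel (\<lambda>x. x + a))"
    using par_in_eq[of E \<epsilon>] L e by (simp add: lebesgue_affine_def lp a_def)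
  also have "\<dots> = (\<integral>x. ?f (x + a) \<partial>lebesgue_subspace L)"
    by (subst integral_distr) auto
  also have "\<dots> = (\<integral>x. ?f ((x + x0) + y) \<partial>lebesgue_subspace L)"
    by (simp add: x0(2) add.assoc)
  also have "\<dots> = (\<integral>x. ?f (x + y) \<partial>lebesgue_subspace L)"
    by (subst (2) lebesgue_subspace_shift[OF L x0(1), symmetric], subst integral_distr) auto
  also have "\<dots> = (\<integral>x. indicator (par_along L K \<epsilon>) (x + y) * (norm (x + y))\<^sup>2 \<partial>lebesgue_subspace L)"
  proof (rule integral_cong_AE)
    show "AE x in lebesgue_subspace L. ?f (x + y) = indicator (par_along L K \<epsilon>) (x + y) * (norm (x + y))\<^sup>2"
      using AE_lebesgue_subspace[OF L]
    proof eventually_elim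
      case (elim x)
      \<comment> \<open>A point that differs from \<open>x + y\<close> by an element of
        \<open>L\<close> lies in \<open>E\<close>, so \<open>K\<close> and
        \<open>K \<inter> E\<close> offer the same competitors.\<close>
      have "z \<in> E" if "x + y - z \<in> L" for z
      proof -
        have "z = (x - (x + y - z)) + y" by simp
        moreover have "x - (x + y - z) \<in> L" using subspace_diff[OF L elim that] .
        ultimately show ?thesis unfolding E_def by blast
      qed
      then have "x + y \<in> par_along L (K \<inter> E) \<epsilon> \<longleftrightarrow> x + y \<in> par_along L K \<epsilon>" by (auto simp: par_along_def)
      then show ?case by (simp add: indicator_def)
    qed
  qed measurable
  finally show ?thesis .
qed

section \<open>Nearest points along a subspace\<close>

definition slice :: "'a::euclidean_space set \<Rightarrow> 'a set \<Rightarrow> 'a \<Rightarrow> 'a set" where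
  "slice L K s = {x \<in> K. s - x \<in> L}"

text \<open>Off the shadow \<open>K + L\<close> the choice \<open>near L K s = s\<close> makes the gap vanish,
  so that the gap is measurable on the whole space.\<close>

definition near :: "'a::euclidean_space set \<Rightarrow> 'a set \<Rightarrow> 'a \<Rightarrow> 'a" where
  "near L K s = (if slice L K s = {} then s else closest_point (slice L K s) s)"

locale convex_along =
  fixes L K :: "'a::euclidean_space set"
  assumes L: "subspace L" and K: "compact K" "convex K"
begin

lemma slice_eq: "slice L K s = K \<inter> ((\<lambda>x. x - s) -` L)"
proof -
  have "s - x \<in> L \<longleftrightarrow> x - s \<in> L" for x using subspace_neg[OF L, of "s - x"] subspace_neg[OF L, of "x - s"] by auto
  then show ?thesis by (auto simp: slice_def)
qed

lemma closed_slice: "closed (slice L K s)"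
  unfolding slice_eq using K(1) closed_subspace[OF L]
  by (intro closed_Int compact_imp_closed closed_vimage) (auto intro!: continuous_intros)

lemma convex_slice: "convex (slice L K s)"
proof -
  have "(\<lambda>x. x - s) -` L = (\<lambda>x. x + s) ` L" by (force simp: image_iff)
  moreover have "convex ((\<lambda>x. x + s) ` L)"
    using convex_translation[OF subspace_imp_convex[OF L], of s] by (simp add: add.commute)
  ultimately show ?thesis unfolding slice_eq using K(2) by (simp add: convex_Int)
qed

lemma slice_shift: "w \<in> L \<Longrightarrow> slice L K (s + w) = slice L K s"
proof -
  assume w: "w \<in> L"
  have "s + w - x \<in> L \<longleftrightarrow> s - x \<in> L" for x
    using subspace_add[OF L _ w, of "s - x"] subspace_diff[OF L _ w, of "s + w - x"] by (auto simp: algebra_simps)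
  then show ?thesis by (simp add: slice_def)
qed

text \<open>This is \<open>K + L\<close>, the set where a nearest point along \<open>L\<close>
  exists.\<close>

definition shadow :: "'a set" where "shadow = {s. slice L K s \<noteq> {}}"

lemma shadow_shift: "w \<in> L \<Longrightarrow> s + w \<in> shadow \<longleftrightarrow> s \<in> shadow"
  by (simp add: shadow_def slice_shift)

lemma near_in: "s \<in> shadow \<Longrightarrow> near L K s \<in> slice L K s"
  by (simp add: near_def shadow_def closest_point_in_set closed_slice)

lemma near_diff: "s - near L K s \<in> L"
proof (cases "s \<in> shadow")
  case True then show ?thesis using near_in by (simp add: slice_def)
next
  case False then show ?thesis using subspace_0[OF L] by (simp add: near_def shadow_def)
qed

lemma near_le: "x \<in> slice L K s \<Longrightarrow> norm (s - near L K s) \<le> norm (s - x)"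
  using closest_point_le[OF closed_slice, of x s s] by (auto simp: near_def dist_norm)

lemma near_dot: "s \<in> shadow \<Longrightarrow> x \<in> slice L K s \<Longrightarrow> (s - near L K s) \<bullet> (x - near L K s) \<le> 0"
  using closest_point_dot[OF convex_slice closed_slice, of x s s] by (auto simp: near_def shadow_def)

text \<open>The variational inequality at \<open>x\<close> and the one at the nearest point add up
  to a nonpositive squared distance between the two.\<close>

lemma near_unique:
  assumes "x \<in> slice L K s" "\<And>y. y \<in> slice L K s \<Longrightarrow> (s - x) \<bullet> (y - x) \<le> 0"
  shows "near L K s = x"
proof -
  have s: "s \<in> shadow" using assms(1) by (auto simp: shadow_def)
  let ?n = "near L K s"
  have "(s - x) \<bullet> (?n - x) \<le> 0" by (rule assms(2)) (rule near_in[OF s])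
  moreover have "(s - ?n) \<bullet> (x - ?n) \<le> 0" using near_dot[OF s assms(1)] .
  ultimately have "(?n - x) \<bullet> (?n - x) \<le> 0" by (simp add: inner_diff_left inner_diff_right inner_commute)
  then have "(?n - x) \<bullet> (?n - x) = 0" using inner_ge_zero[of "?n - x"] by linarith
  then show ?thesis by simp
qed

lemma par_along_iff: "s \<in> par_along L K \<epsilon> \<longleftrightarrow> s \<in> shadow \<and> norm (s - near L K s) \<le> \<epsilon>"
proof
  assume "s \<in> par_along L K \<epsilon>"
  then obtain x where x: "x \<in> slice L K s" "norm (s - x) \<le> \<epsilon>" by (auto simp: par_along_def slice_def)
  then show "s \<in> shadow \<and> norm (s - near L K s) \<le> \<epsilon>" using near_le[OF x(1)] by (auto simp: shadow_def)
next
  assume a: "s \<in> shadow \<and> norm (s - near L K s) \<le> \<epsilon>"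
  then have "near L K s \<in> slice L K s" using near_in by blast
  with a show "s \<in> par_along L K \<epsilon>" by (auto simp: par_along_def slice_def)
qed

text \<open>Upper bound: the nearest point of \<open>s\<close> is a competitor for
  \<open>s + w\<close>. Lower bound: the obtuse angle inequality at the nearest point of
  \<open>s\<close>, tested with that of \<open>s + w\<close>. Together they make the squared gap
  differentiable along \<open>L\<close> with gradient twice \<open>v\<close> and a uniform quadratic
  error.\<close>

lemma gap_expansion:
  fixes s w :: 'a
  assumes w: "w \<in> L"
  defines "v \<equiv> s - near L K s"
  assumes s: "s \<in> shadow"
  shows "(norm (s + w - near L K (s + w)))\<^sup>2 \<le> (norm v)\<^sup>2 + 2 * (v \<bullet> w) + (norm w)\<^sup>2"
    and "(norm v)\<^sup>2 + 2 * (v \<bullet> w) \<le> (norm (s + w - near L K (s + w)))\<^sup>2"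
proof -
  let ?p = "near L K s" and ?p' = "near L K (s + w)"
  let ?v = "s + w - ?p'"
  have sw: "s + w \<in> shadow" using s by (simp add: shadow_shift[OF w])
  have p: "?p \<in> slice L K (s + w)" "?p' \<in> slice L K s"
    using near_in[OF s] near_in[OF sw] by (simp_all add: slice_shift[OF w])
  have "norm ?v \<le> norm (v + w)" using near_le[OF p(1)] by (simp add: v_def algebra_simps)
  then have "(norm ?v)\<^sup>2 \<le> (norm (v + w))\<^sup>2" by (simp add: power_mono)
  then show "(norm ?v)\<^sup>2 \<le> (norm v)\<^sup>2 + 2 * (v \<bullet> w) + (norm w)\<^sup>2"
    by (simp add: power2_norm_eq_inner inner_add_left inner_add_right inner_commute)
  have "v \<bullet> (?p' - ?p) \<le> 0" using near_dot[OF s p(2)] by (simp add: v_def)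
  moreover have "?v = v + w - (?p' - ?p)" by (simp add: v_def)
  then have "v \<bullet> ?v = v \<bullet> v + v \<bullet> w - v \<bullet> (?p' - ?p)" by (simp only: inner_add_right inner_diff_right)
  moreover have "0 \<le> (?v - v) \<bullet> (?v - v)" by simp
  then have "2 * (v \<bullet> ?v) \<le> ?v \<bullet> ?v + v \<bullet> v" by (simp add: inner_diff_left inner_diff_right inner_commute)
  ultimately show "(norm v)\<^sup>2 + 2 * (v \<bullet> w) \<le> (norm ?v)\<^sup>2"
    by (simp add: power2_norm_eq_inner)
qed

lemma closed_shadow: "closed shadow"
proof -
  have "shadow = (\<Union>x\<in>K. \<Union>y\<in>L. {x + y})"
  proof (intro set_eqI iffI)
    fix s assume "s \<in> shadow"
    then obtain x where "x \<in> K" "s - x \<in> L" by (auto simp: shadow_def slice_def)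
    moreover have "s \<in> {x + (s - x)}" by simp
    ultimately show "s \<in> (\<Union>x\<in>K. \<Union>y\<in>L. {x + y})" by blast
  next
    fix s assume "s \<in> (\<Union>x\<in>K. \<Union>y\<in>L. {x + y})"
    then obtain x y where "x \<in> K" "y \<in> L" "s = x + y" by auto
    then show "s \<in> shadow" by (auto simp: shadow_def slice_def intro!: exI[of _ x])
  qed
  then show ?thesis using compact_closed_sums[OF K(1) closed_subspace[OF L]] by auto
qed

lemma borel_shadow [measurable]: "shadow \<in> sets borel"
  using closed_shadow by simp

text \<open>Sublevel sets at nonnegative levels are parallel sets together with the complement of
  the shadow, where the gap is \<open>0\<close> by convention.\<close>

lemma measurable_gap2 [measurable]: "(\<lambda>s. (norm (s - near L K s))\<^sup>2) \<in> borel_measurable borel"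
proof (rule borel_measurableI_le)
  fix r :: real
  show "{s \<in> space borel. (norm (s - near L K s))\<^sup>2 \<le> r} \<in> sets borel"
  proof (cases "r < 0")
    case True
    then have "{s \<in> space borel. (norm (s - near L K s))\<^sup>2 \<le> r} = {}"
      by (auto simp: not_le intro: less_le_trans)
    then show ?thesis by simp
  next
    case False
    have "(norm (s - near L K s))\<^sup>2 \<le> r \<longleftrightarrow> s \<in> par_along L K (sqrt r) \<or> s \<notin> shadow" for s
    proof (cases "s \<in> shadow")
      case True
      then show ?thesis using False par_along_iff[of s "sqrt r"] by (simp add: real_le_rsqrt sqrt_ge_absD) (metis abs_norm_cancel real_le_rsqrt sqrt_ge_absD)
    next
      case False': False
      then show ?thesis using False by (simp add: shadow_def near_def)
    qed
    then have "{s \<in> space borel. (norm (s - near L K s))\<^sup>2 \<le> r} = par_along L K (sqrt r) \<union> (- shadow)" by auto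
    also have "\<dots> \<in> sets borel" using borel_par_along[OF K(1) L] borel_shadow by (intro sets.Un) (auto simp: Compl_in_sets_lebesgue sets.compl_sets)
    finally show ?thesis .
  qed
qed

text \<open>The shadow is invariant under translation along \<open>L\<close> and all gaps vanish off
  it, so the expansion becomes an estimate on the whole space, usable for domination.\<close>

lemma gap_difference_bounds:
  fixes s w :: 'a
  assumes w: "w \<in> L"
  defines "v \<equiv> s - near L K s"
  shows "\<bar>(norm (s + w - near L K (s + w)))\<^sup>2 - (norm v)\<^sup>2 - 2 * (v \<bullet> w)\<bar> \<le> (norm w)\<^sup>2"
proof (cases "s \<in> shadow")
  case True
  then show ?thesis using gap_expansion[OF w True] unfolding v_def by simp
next
  case False
  then have "s + w \<notin> shadow" by (simp add: shadow_shift[OF w])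
  then show ?thesis using False by (simp add: v_def near_def shadow_def)
qed

lemma gap_directional_limit:
  assumes w: "w \<in> L"
  shows "(\<lambda>n. real (Suc n) * ((norm (s + w /\<^sub>R real (Suc n) - near L K (s + w /\<^sub>R real (Suc n))))\<^sup>2 - (norm (s - near L K s))\<^sup>2))
    \<longlonglongrightarrow> 2 * ((s - near L K s) \<bullet> w)" (is "?X \<longlonglongrightarrow> ?c")
proof -
  let ?v = "s - near L K s"
  have b: "norm (?X n - ?c) \<le> (norm w)\<^sup>2 / real (Suc n)" for n
  proof -
    let ?w = "w /\<^sub>R real (Suc n)"
    let ?d = "(norm (s + ?w - near L K (s + ?w)))\<^sup>2 - (norm ?v)\<^sup>2"
    have "\<bar>?d - 2 * (?v \<bullet> ?w)\<bar> \<le> (norm ?w)\<^sup>2"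
      by (rule gap_difference_bounds) (intro subspace_mul L w)
    then have "real (Suc n) * \<bar>?d - 2 * (?v \<bullet> ?w)\<bar> \<le> real (Suc n) * (norm ?w)\<^sup>2" by (intro mult_left_mono) auto
    also have "real (Suc n) * (norm ?w)\<^sup>2 = (norm w)\<^sup>2 / real (Suc n)"
    proof -
      have "m * (norm (w /\<^sub>R m))\<^sup>2 = (norm w)\<^sup>2 / m" if "m > 0" for m
        using that by (simp add: power2_eq_square field_simps)
      then show ?thesis by simp
    qed
    also have "real (Suc n) * \<bar>?d - 2 * (?v \<bullet> ?w)\<bar> = \<bar>real (Suc n) * (?d - 2 * (?v \<bullet> ?w))\<bar>" by (simp only: abs_mult abs_of_nat)
    also have "real (Suc n) * (?d - 2 * (?v \<bullet> ?w)) = real (Suc n) * ?d - ?c"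
      by (simp only: right_diff_distrib inner_scaleR_right) simp
    finally show ?thesis by (simp only: real_norm_def)
  qed
  have "(\<lambda>n. (norm w)\<^sup>2 * inverse (real (Suc n))) \<longlonglongrightarrow> (norm w)\<^sup>2 * 0"
    by (intro tendsto_intros LIMSEQ_inverse_real_of_nat)
  then have "(\<lambda>n. (norm w)\<^sup>2 / real (Suc n)) \<longlonglongrightarrow> 0" by (simp add: divide_inverse)
  then have "(\<lambda>n. ?X n - ?c) \<longlonglongrightarrow> 0"
    by (rule Lim_null_comparison[OF always_eventually[OF allI[OF b]]])
  then show ?thesis by (rule LIM_zero_cancel)
qed

lemma gap_limit:
  assumes w: "w \<in> L"
  shows "(\<lambda>n. (norm (s + w /\<^sub>R real (Suc n) - near L K (s + w /\<^sub>R real (Suc n))))\<^sup>2) \<longlonglongrightarrow> (norm (s - near L K s))\<^sup>2"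
proof -
  let ?X = "\<lambda>n. (norm (s + w /\<^sub>R real (Suc n) - near L K (s + w /\<^sub>R real (Suc n))))\<^sup>2 - (norm (s - near L K s))\<^sup>2"
  have "(\<lambda>n. inverse (real (Suc n)) * (real (Suc n) * ?X n)) \<longlonglongrightarrow> 0 * (2 * ((s - near L K s) \<bullet> w))"
    by (intro tendsto_mult LIMSEQ_inverse_real_of_nat gap_directional_limit w)
  then have "?X \<longlonglongrightarrow> 0" by (simp add: mult.assoc[symmetric] del: of_nat_Suc)
  then show ?thesis by (rule LIM_zero_cancel)
qed

text \<open>The nearest point is recovered from the gradient of the squared gap: the components of
  \<open>s - near L K s\<close> along \<open>L\<close> are limits of difference quotients of a
  measurable function.\<close>

lemma measurable_near [measurable]: "near L K \<in> borel_measurable borel"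
proof -
  have v: "(\<lambda>s. (s - near L K s) \<bullet> b) \<in> borel_measurable borel" if b: "b \<in> L" for b
  proof -
    have "(\<lambda>s. 2 * ((s - near L K s) \<bullet> b)) \<in> borel_measurable borel"
      by (rule borel_measurable_LIMSEQ_real[OF gap_directional_limit[OF b]]) measurable
    then have "(\<lambda>s. 2 * ((s - near L K s) \<bullet> b) / 2) \<in> borel_measurable borel" by measurable
    then show ?thesis by simp
  qed
  have "(\<lambda>s. s - (\<Sum>i<dim L. ((s - near L K s) \<bullet> onb L i) *\<^sub>R onb L i)) \<in> borel_measurable borel"
    using v onb_in[OF L] by measurable
  moreover have "s - (\<Sum>i<dim L. ((s - near L K s) \<bullet> onb L i) *\<^sub>R onb L i) = near L K s" for s
    using proj_id[OF L near_diff, of s] by (simp add: proj_def)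
  ultimately show ?thesis by simp
qed

end

section \<open>Moments of the parallel set compared with moments of the nearest point\<close>

lemma integrable_cball_bound:
  fixes f :: "'a::euclidean_space \<Rightarrow> real"
  assumes "f \<in> borel_measurable borel" "\<And>s. \<bar>f s\<bar> \<le> B * indicator (cball 0 R) s"
  shows "integrable lborel f"
proof (rule Bochner_Integration.integrable_bound[of _ "\<lambda>s. B * indicator (cball 0 R) s :: real"])
  show "integrable lborel (\<lambda>s::'a. B * indicator (cball 0 R) s :: real)"
    using emeasure_lborel_cball_finite[of "0::'a" R] by (intro integrable_mult_right integrable_real_indicator) auto
  show "AE s in lborel. norm (f s) \<le> norm (B * indicator (cball 0 R) s :: real)"
    using assms(2) by (auto intro!: AE_I2 intro: order_trans[OF _ abs_ge_self])
qed (use assms(1) in simp)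

lemma integral_scale_along:
  fixes S :: "'a::euclidean_space set"
  assumes S: "subspace S" and r: "r > 0" and u[measurable]: "u \<in> borel_measurable borel" and pos: "\<And>x. 0 \<le> u x"
  shows "(\<integral>y. u y \<partial>lborel) = r ^ dim S * (\<integral>x. u (scale_along S r x + a) \<partial>lborel :: real)"
proof -
  have [measurable]: "scale_along S r \<in> borel_measurable borel"
    by (intro borel_measurable_linear linear_scale_along)
  have "(\<integral>y. u y \<partial>lborel) = enn2real (\<integral>\<^sup>+y. ennreal (u y) \<partial>lborel)"
    by (intro integral_eq_nn_integral) (auto simp: pos)
  also have "\<dots> = enn2real (ennreal (r ^ dim S) * (\<integral>\<^sup>+x. ennreal (u (scale_along S r x + a)) \<partial>lborel))"
    by (subst nn_integral_scale_along[OF S r, where a=a]) auto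
  also have "\<dots> = r ^ dim S * enn2real (\<integral>\<^sup>+x. ennreal (u (scale_along S r x + a)) \<partial>lborel)"
    using r by (simp add: enn2real_mult)
  also have "enn2real (\<integral>\<^sup>+x. ennreal (u (scale_along S r x + a)) \<partial>lborel) = (\<integral>x. u (scale_along S r x + a) \<partial>lborel)"
    by (intro integral_eq_nn_integral[symmetric]) (auto simp: pos)
  finally show ?thesis .
qed

context convex_along
begin

text \<open>Chosen because its integral can be computed in two ways: its derivative under dilation
  along \<open>L\<close> gives \<open>dilation\<close>, and as the integral of \<open>2 * r\<close>
  for \<open>r\<close> from the gap to \<open>\<epsilon>\<close> it yields the volumes of parallel
  sets in \<open>integral_excess\<close>.\<close>

definition excess :: "real \<Rightarrow> 'a \<Rightarrow> real" where
  "excess \<epsilon> s = indicator shadow s * max 0 (\<epsilon>\<^sup>2 - (norm (s - near L K s))\<^sup>2)"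

lemma measurable_excess [measurable]: "excess \<epsilon> \<in> borel_measurable borel"
  unfolding excess_def[abs_def] by measurable

lemma excess_nonneg: "0 \<le> excess \<epsilon> s" by (simp add: excess_def)

lemma radius: obtains R where "R > 0" "\<And>\<epsilon>. par_along L K \<epsilon> \<subseteq> cball 0 (R + \<epsilon>)" "\<And>s. s \<in> shadow \<Longrightarrow> norm (near L K s) \<le> R"
proof -
  obtain R where R: "R > 0" "\<And>x. x \<in> K \<Longrightarrow> norm x \<le> R"
    using compact_imp_bounded[OF K(1)] bounded_pos by blast
  show thesis
  proof (rule that[OF R(1)])
    show "norm (near L K s) \<le> R" if "s \<in> shadow" for s using near_in[OF that] R(2) by (simp add: slice_def)
    show "par_along L K \<epsilon> \<subseteq> cball 0 (R + \<epsilon>)" for \<epsilon>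
    proof
      fix s assume "s \<in> par_along L K \<epsilon>"
      then obtain x where x: "x \<in> K" "norm (s - x) \<le> \<epsilon>" by (auto simp: par_along_def)
      then show "s \<in> cball 0 (R + \<epsilon>)" using R(2)[OF x(1)] norm_triangle_sub[of s x] by simp
    qed
  qed
qed

lemma power_difference_limit:
  "(\<lambda>n. real (Suc n) * (1 / (1 + inverse (real (Suc n))) ^ k - 1)) \<longlonglongrightarrow> - real k"
proof -
  have "((\<lambda>x::real. 1 / (1 + x) ^ k) has_real_derivative - real k) (at 0)"
    by (auto intro!: derivative_eq_intros)
  then have "((\<lambda>h. (1 / (1 + h) ^ k - 1) / h) \<longlongrightarrow> - real k) (at (0::real))"
    by (simp add: DERIV_def)
  moreover have "filterlim (\<lambda>n. inverse (real (Suc n))) (at 0) sequentially"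
    by (rule filterlim_atI[OF LIMSEQ_inverse_real_of_nat]) simp
  ultimately have "(\<lambda>n. (1 / (1 + inverse (real (Suc n))) ^ k - 1) / inverse (real (Suc n))) \<longlonglongrightarrow> - real k"
    by (rule filterlim_compose)
  then show ?thesis by (simp add: divide_inverse mult.commute del: of_nat_Suc)
qed

text \<open>The integral of \<open>excess \<epsilon>\<close> scales by a power of the factor under dilations along \<open>L\<close>;
  differentiate at the identity, using that the squared gap has gradient twice \<open>s - near L K s\<close> along \<open>L\<close>.\<close>

lemma dilation:
  assumes e: "\<epsilon> > 0" and null: "AE s in lborel. s \<in> shadow \<longrightarrow> norm (s - near L K s) \<noteq> \<epsilon>"
  shows "(\<integral>s. indicator (par_along L K \<epsilon>) s * (2 * ((s - near L K s) \<bullet> s)) \<partial>lborel)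
    = real (dim L) * (\<integral>s. excess \<epsilon> s \<partial>lborel)"
proof -
  note of_nat_Suc [simp del]
  let ?G = "excess \<epsilon>" and ?Q = "\<lambda>s. (norm (s - near L K s))\<^sup>2"
  \<comment> \<open>Moving by \<open>?w n s\<close> is the dilation along \<open>L\<close> by the
    factor \<open>1 + 1 / (n + 1)\<close>; \<open>?h\<close> is the corresponding difference
    quotient.\<close>
  let ?w = "\<lambda>n s. proj L s /\<^sub>R real (Suc n)"
  let ?h = "\<lambda>n s. real (Suc n) * (?G (s + ?w n s) - ?G s)"
  let ?l = "\<lambda>s. - (indicator (par_along L K \<epsilon>) s * (2 * ((s - near L K s) \<bullet> s)))"
  have [measurable]: "proj L \<in> borel_measurable borel" by (intro borel_measurable_linear linear_proj)
  have [measurable]: "par_along L K \<epsilon> \<in> sets borel" using K(1) L by (rule borel_par_along)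
  obtain R where R: "R > 0" "\<And>\<epsilon>. par_along L K \<epsilon> \<subseteq> cball 0 (R + \<epsilon>)" "\<And>s. s \<in> shadow \<Longrightarrow> norm (near L K s) \<le> R"
    by (rule radius) blast
  have w: "?w n s \<in> L" for n s by (intro subspace_mul L proj_in)
  have Gsupp: "norm s \<le> R + \<epsilon>" if "?G s \<noteq> 0" for s
  proof -
    have "s \<in> shadow" "?Q s \<le> \<epsilon>\<^sup>2" using that by (auto simp: excess_def indicator_def split: if_splits)
    then have "s \<in> par_along L K \<epsilon>" using e by (auto simp: par_along_iff power2_le_iff_abs_le)
    then show ?thesis using R(2)[of \<epsilon>] by auto
  qed
  have scale: "s + ?w n s = scale_along L (1 + inverse (real (Suc n))) s" for n s
    by (simp add: scale_along_def algebra_simps)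
  have Gi: "integrable lborel ?G"
  proof (rule integrable_cball_bound[of _ "\<epsilon>\<^sup>2" "R + \<epsilon>"])
    show "\<bar>?G s\<bar> \<le> \<epsilon>\<^sup>2 * indicator (cball 0 (R + \<epsilon>)) s" for s
    proof (cases "?G s = 0")
      case False
      moreover have "\<bar>?G s\<bar> \<le> \<epsilon>\<^sup>2" by (auto simp: excess_def indicator_def)
      ultimately show ?thesis using Gsupp[of s] by simp
    qed simp
  qed measurable
  have bound: "\<bar>?h n s\<bar> \<le> (5 * (2 * R + \<epsilon>)\<^sup>2) * indicator (cball 0 (R + \<epsilon>)) s" for n s
  proof (cases "?G s = 0 \<and> ?G (s + ?w n s) = 0")
    case True then show ?thesis by (auto simp: indicator_def)
  next
    case False
    then have sh: "s \<in> shadow" using shadow_shift[OF w, of s n s] by (auto simp: excess_def)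
    \<comment> \<open>If only the dilated point lies in the support, \<open>s\<close> is still
      controlled, because a dilation by a factor above \<open>1\<close> does not decrease the
      norm.\<close>
    have ns: "norm s \<le> R + \<epsilon>"
    proof (cases "?G s = 0")
      case True
      then have *: "norm (s + ?w n s) \<le> R + \<epsilon>" using False Gsupp by blast
      have "(norm s)\<^sup>2 \<le> (norm (s + ?w n s))\<^sup>2"
      proof -
        have "(norm (s + ?w n s))\<^sup>2 = (norm s)\<^sup>2 + 2 * (s \<bullet> ?w n s) + (norm (?w n s))\<^sup>2"
        proof -
          have "(norm (a + b))\<^sup>2 = (norm a)\<^sup>2 + 2 * (a \<bullet> b) + (norm b)\<^sup>2" for a b :: 'a
            by (simp add: power2_norm_eq_inner inner_add_left inner_add_right inner_commute)
          then show ?thesis .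
        qed
        moreover have "0 \<le> s \<bullet> ?w n s"
          using inner_proj_left[OF L, of s s] by (simp add: inner_commute)
        ultimately show ?thesis by simp
      qed
      then have "norm s \<le> norm (s + ?w n s)" by (rule power2_le_imp_le) simp
      with * show ?thesis by linarith
    qed (use Gsupp in blast)
    let ?v = "s - near L K s"
    have nv: "norm ?v \<le> 2 * R + \<epsilon>" using norm_triangle_ineq4[of s "near L K s"] ns R(3)[OF sh] by linarith
    have np: "norm (proj L s) \<le> 2 * R + \<epsilon>" using norm_proj_le[OF L, of s] ns R(1) by linarith
    have "\<bar>?G (s + ?w n s) - ?G s\<bar> \<le> \<bar>?Q (s + ?w n s) - ?Q s\<bar>"
    proof -
      have "\<bar>max 0 (c - a) - max 0 (c - b)\<bar> \<le> \<bar>a - b\<bar>" for a b c :: real by (auto simp: max_def abs_if)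
      then show ?thesis using sh by (simp add: excess_def shadow_shift[OF w])
    qed
    also have "\<dots> \<le> \<bar>2 * (?v \<bullet> ?w n s)\<bar> + (norm (?w n s))\<^sup>2"
      using gap_difference_bounds[OF w, of s n s] by linarith
    finally have "real (Suc n) * \<bar>?G (s + ?w n s) - ?G s\<bar> \<le> real (Suc n) * (\<bar>2 * (?v \<bullet> ?w n s)\<bar> + (norm (?w n s))\<^sup>2)"
      by (rule mult_left_mono) simp
    also have "\<dots> = \<bar>2 * (?v \<bullet> proj L s)\<bar> + (norm (proj L s))\<^sup>2 / real (Suc n)"
    proof -
      have "m * (\<bar>2 * (?v \<bullet> (proj L s /\<^sub>R m))\<bar> + (norm (proj L s /\<^sub>R m))\<^sup>2) = \<bar>2 * (?v \<bullet> proj L s)\<bar> + (norm (proj L s))\<^sup>2 / m"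
        if "m > 0" for m
        using that by (simp add: abs_mult power2_eq_square field_simps)
      then show ?thesis by simp
    qed
    also have "\<dots> \<le> 4 * (2 * R + \<epsilon>)\<^sup>2 + (2 * R + \<epsilon>)\<^sup>2"
    proof (rule add_mono)
      have "\<bar>?v \<bullet> proj L s\<bar> \<le> norm ?v * norm (proj L s)" by (rule Cauchy_Schwarz_ineq2)
      also have "\<dots> \<le> (2 * R + \<epsilon>) * (2 * R + \<epsilon>)" using nv np by (intro mult_mono) (use R e in auto)
      finally have "\<bar>?v \<bullet> proj L s\<bar> \<le> (2 * R + \<epsilon>)\<^sup>2" by (simp add: power2_eq_square)
      then show "\<bar>2 * (?v \<bullet> proj L s)\<bar> \<le> 4 * (2 * R + \<epsilon>)\<^sup>2"
        using zero_le_power2[of "2 * R + \<epsilon>"] by linarith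
      have "(norm (proj L s))\<^sup>2 / real (Suc n) \<le> (norm (proj L s))\<^sup>2 / 1" by (intro divide_left_mono) auto
      also have "\<dots> \<le> (2 * R + \<epsilon>)\<^sup>2" using np by (simp add: power_mono)
      finally show "(norm (proj L s))\<^sup>2 / real (Suc n) \<le> (2 * R + \<epsilon>)\<^sup>2" .
    qed
    finally show ?thesis using ns by (simp add: abs_mult del: of_nat_Suc)
  qed
  \<comment> \<open>Where the gap is below \<open>\<epsilon>\<close> the quotient differentiates the
    squared gap, where it is above \<open>\<epsilon>\<close> the quotient is eventually
    \<open>0\<close>; the level set in between is null by assumption.\<close>
  have lim: "AE s in lborel. (\<lambda>n. ?h n s) \<longlonglongrightarrow> ?l s"
    using null
  proof eventually_elim
    case (elim s)
    show ?case
    proof (cases "s \<in> shadow")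
      case False
      then have "?h n s = 0" for n by (simp add: excess_def shadow_shift[OF w])
      moreover have "?l s = 0" using False by (simp add: par_along_iff)
      ultimately show ?thesis by (simp only: tendsto_const)
    next
      case True
      note ql = gap_limit[OF proj_in[OF L], of s s]
      have sh: "s + ?w n s \<in> shadow" for n using True by (simp add: shadow_shift[OF w])
      have "norm (s - near L K s) < \<epsilon> \<or> norm (s - near L K s) > \<epsilon>" using elim True by auto
      then show ?thesis
      proof
        assume lt: "norm (s - near L K s) < \<epsilon>"
        then have Q: "?Q s < \<epsilon>\<^sup>2" by (simp add: power_strict_mono)
        have "eventually (\<lambda>n. ?Q (s + ?w n s) < \<epsilon>\<^sup>2) sequentially"
          using order_tendstoD(2)[OF ql Q] .
        then have ev: "eventually (\<lambda>n. - (real (Suc n) * (?Q (s + ?w n s) - ?Q s)) = ?h n s) sequentially"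
        proof eventually_elim
          case (elim n)
          have "?G (s + ?w n s) = \<epsilon>\<^sup>2 - ?Q (s + ?w n s)" "?G s = \<epsilon>\<^sup>2 - ?Q s"
            using elim Q True sh[of n] by (simp_all add: excess_def)
          then have "?G (s + ?w n s) - ?G s = - (?Q (s + ?w n s) - ?Q s)" by linarith
          then show ?case by (simp only: minus_mult_right)
        qed
        have "(\<lambda>n. - (real (Suc n) * (?Q (s + ?w n s) - ?Q s))) \<longlonglongrightarrow> - (2 * ((s - near L K s) \<bullet> proj L s))"
          by (intro tendsto_minus gap_directional_limit proj_in L)
        moreover have "(s - near L K s) \<bullet> proj L s = (s - near L K s) \<bullet> s"
          using inner_proj_in[OF L near_diff, of s s] by (simp add: inner_commute)
        moreover have "s \<in> par_along L K \<epsilon>" using lt True by (simp add: par_along_iff)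
        ultimately have "(\<lambda>n. - (real (Suc n) * (?Q (s + ?w n s) - ?Q s))) \<longlonglongrightarrow> ?l s" by simp
        then show ?thesis using Lim_transform_eventually[OF _ ev] by blast
      next
        assume gt: "norm (s - near L K s) > \<epsilon>"
        then have Q: "?Q s > \<epsilon>\<^sup>2" using e by (simp add: power_strict_mono)
        have "eventually (\<lambda>n. ?Q (s + ?w n s) > \<epsilon>\<^sup>2) sequentially"
          using order_tendstoD(1)[OF ql Q] .
        then have ev: "eventually (\<lambda>n. 0 = ?h n s) sequentially"
          by eventually_elim (use Q in \<open>simp add: excess_def\<close>)
        have "?l s = 0" using gt by (simp add: par_along_iff)
        then show ?thesis using Lim_transform_eventually[OF tendsto_const ev] by (simp only:)
      qed
    qed
  qed
  have "(\<lambda>n. \<integral>s. ?h n s \<partial>lborel) \<longlonglongrightarrow> (\<integral>s. ?l s \<partial>lborel)"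
  proof (rule integral_dominated_convergence[where w = "\<lambda>s. (5 * (2 * R + \<epsilon>)\<^sup>2) * indicator (cball 0 (R + \<epsilon>)) s"])
    show "integrable lborel (\<lambda>s::'a. (5 * (2 * R + \<epsilon>)\<^sup>2) * indicator (cball 0 (R + \<epsilon>)) s :: real)"
      using emeasure_lborel_cball_finite[of "0::'a" "R + \<epsilon>"] by (intro integrable_mult_right integrable_real_indicator) auto
    show "AE s in lborel. (\<lambda>n. ?h n s) \<longlonglongrightarrow> ?l s" by (rule lim)
    show "AE s in lborel. norm (?h n s) \<le> (5 * (2 * R + \<epsilon>)\<^sup>2) * indicator (cball 0 (R + \<epsilon>)) s" for n
      using bound[of n] by (intro AE_I2) (simp only: real_norm_def)
  qed measurable
  moreover have "(\<lambda>n. \<integral>s. ?h n s \<partial>lborel) \<longlonglongrightarrow> - real (dim L) * (\<integral>s. ?G s \<partial>lborel)"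
  proof -
    let ?J = "\<integral>s. ?G s \<partial>lborel"
    \<comment> \<open>Undoing the dilation is an exact change of variables with Jacobian a power of
      exponent \<open>dim L\<close>, and differentiating that power at factor \<open>1\<close>
      produces the number \<open>dim L\<close>.\<close>
    have "(\<integral>s. ?h n s \<partial>lborel) = real (Suc n) * (1 / (1 + inverse (real (Suc n))) ^ dim L - 1) * ?J" for n
    proof -
      have p: "1 + inverse (real (Suc n)) > 0" by (simp add: add_pos_pos)
      have "?J = (1 + inverse (real (Suc n))) ^ dim L * (\<integral>s. ?G (s + ?w n s) \<partial>lborel)"
        using integral_scale_along[OF L p measurable_excess excess_nonneg, where a=0] by (simp only: scale add_0_right)
      then have a: "(\<integral>s. ?G (s + ?w n s) \<partial>lborel) = 1 / (1 + inverse (real (Suc n))) ^ dim L * ?J"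
        using p by (simp add: field_simps del: of_nat_Suc)
      have i: "integrable lborel (\<lambda>s. ?G (s + ?w n s))"
      proof -
        have hi: "integrable lborel (?h n)"
          by (rule integrable_cball_bound[OF _ bound]) measurable
        then have "integrable lborel (\<lambda>s. ?h n s / real (Suc n) + ?G s)" using Gi by (intro Bochner_Integration.integrable_add integrable_divide)
        then show ?thesis by (simp del: of_nat_Suc)
      qed
      have "(\<integral>s. ?h n s \<partial>lborel) = real (Suc n) * ((\<integral>s. ?G (s + ?w n s) \<partial>lborel) - ?J)"
        using i Gi by (simp del: of_nat_Suc)
      then show ?thesis unfolding a by (simp only: left_diff_distrib right_diff_distrib mult.assoc mult_1)
    qed
    moreover have "(\<lambda>n. real (Suc n) * (1 / (1 + inverse (real (Suc n))) ^ dim L - 1) * ?J) \<longlonglongrightarrow> - real (dim L) * ?J"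
      by (intro tendsto_mult power_difference_limit tendsto_const)
    ultimately show ?thesis by presburger
  qed
  ultimately have "(\<integral>s. ?l s \<partial>lborel) = - real (dim L) * (\<integral>s. ?G s \<partial>lborel)"
    by (rule LIMSEQ_unique)
  then show ?thesis by (simp add: integral_minus)
qed

text \<open>The level set lies in the difference of the parallel sets of radii
  \<open>\<epsilon>\<close> and \<open>r\<close> for every smaller \<open>r\<close>, and a
  polynomial volume is continuous from the left at \<open>\<epsilon>\<close>.\<close>

lemma gap_level_null:
  assumes F: "\<And>r. 0 < r \<Longrightarrow> measure lborel (par_along L K r) = (\<Sum>j\<le>n. C j * r ^ j)" and e: "\<epsilon> > 0"
  shows "AE s in lborel. s \<in> shadow \<longrightarrow> norm (s - near L K s) \<noteq> \<epsilon>"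
proof -
  define N where "N = {s. s \<in> shadow \<and> norm (s - near L K s) = \<epsilon>}"
  have N[measurable]: "N \<in> sets borel" unfolding N_def by measurable
  have par[measurable]: "par_along L K r \<in> sets borel" for r using K(1) L by (rule borel_par_along)
  have fin: "par_along L K r \<in> fmeasurable lborel" for r
    using compact_par_along[OF K(1) L, of r] fmeasurable_compact by blast
  let ?F = "\<lambda>r. \<Sum>j\<le>n. C j * r ^ j"
  have le: "measure lborel N \<le> ?F \<epsilon> - ?F r" if r: "0 < r" "r < \<epsilon>" for r
  proof -
    have sub: "par_along L K r \<subseteq> par_along L K \<epsilon>" using r by (auto simp: par_along_iff)
    have "measure lborel N \<le> measure lborel (par_along L K \<epsilon> - par_along L K r)"
      using r by (intro measure_mono_fmeasurable fmeasurable.Diff fin) (auto simp: N_def par_along_iff)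
    also have "\<dots> = measure lborel (par_along L K \<epsilon>) - measure lborel (par_along L K r)"
      using fin[of \<epsilon>] fin[of r] sub by (intro measure_Diff) (auto simp: fmeasurable_def)
    finally show ?thesis using F[of r] F[of \<epsilon>] r e by simp
  qed
  have "((\<lambda>r. ?F \<epsilon> - ?F r) \<longlongrightarrow> ?F \<epsilon> - ?F \<epsilon>) (at_left \<epsilon>)"
    by (intro tendsto_intros)
  moreover have "eventually (\<lambda>r. measure lborel N \<le> ?F \<epsilon> - ?F r) (at_left \<epsilon>)"
    using eventually_at_left_field e le by (metis (mono_tags, lifting) less_eq_real_def)
  ultimately have "measure lborel N \<le> ?F \<epsilon> - ?F \<epsilon>"
    by (rule tendsto_lowerbound) simp
  then have "measure lborel N = 0" using measure_nonneg[of lborel N] by simp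
  moreover have "emeasure lborel N \<noteq> \<infinity>"
  proof -
    have "emeasure lborel N \<le> emeasure lborel (par_along L K \<epsilon>)"
      by (intro emeasure_mono) (auto simp: N_def par_along_iff)
    then show ?thesis using fin[of \<epsilon>] by (auto simp: fmeasurable_def top_unique)
  qed
  ultimately have "N \<in> null_sets lborel" using N by (auto simp: null_sets_def measure_def enn2real_eq_0_iff)
  then show ?thesis by (rule AE_I'[of N]) (auto simp: N_def)
qed

text \<open>By Fubini over the layers the integral equals that of \<open>2 * r\<close> times the
  volume of the parallel set of radius \<open>r\<close>, for \<open>r\<close> from \<open>0\<close>
  to \<open>\<epsilon>\<close>; the polynomial is integrated termwise.\<close>

lemma integral_excess:
  assumes F: "\<And>r. 0 < r \<Longrightarrow> measure lborel (par_along L K r) = (\<Sum>j\<le>n. C j * r ^ j)" and e: "\<epsilon> > 0"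
  shows "(\<integral>s. excess \<epsilon> s \<partial>lborel) = (\<Sum>j\<le>n. C j * 2 * \<epsilon> ^ (j + 2) / real (j + 2))"
proof -
  let ?F = "\<lambda>r. \<Sum>j\<le>n. C j * r ^ j"
  let ?H = "\<lambda>r::real. \<Sum>j\<le>n. C j * 2 * r ^ (j + 2) / real (j + 2)"
  have par[measurable]: "par_along L K r \<in> sets borel" for r using K(1) L by (rule borel_par_along)
  have Fpos: "0 \<le> ?F r" if "0 < r" for r unfolding F[OF that, symmetric] by simp
  have em: "emeasure lborel (par_along L K r) = ennreal (?F r)" if "0 < r" for r
    using F[OF that] compact_par_along[OF K(1) L, of r] emeasure_compact_finite[of "par_along L K r"]
    by (subst emeasure_eq_ennreal_measure) auto
  have der: "(?H has_real_derivative (2 * r * ?F r)) (at r)" for r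
  proof -
    have "(?H has_real_derivative (\<Sum>j\<le>n. C j * 2 * (real (j + 2) * r ^ (j + 1)) / real (j + 2))) (at r)"
      by (intro derivative_eq_intros DERIV_sum) (auto simp del: of_nat_add)
    moreover have "(\<Sum>j\<le>n. C j * 2 * (real (j + 2) * r ^ (j + 1)) / real (j + 2)) = 2 * r * ?F r"
      unfolding sum_distrib_left by (intro sum.cong) auto
    ultimately show ?thesis by simp
  qed
  have inner: "ennreal (excess \<epsilon> s) = (\<integral>\<^sup>+r. ennreal (2 * r) * indicator {0..\<epsilon>} r * indicator (par_along L K r) s \<partial>lborel)" for s
  proof (cases "s \<in> shadow \<and> norm (s - near L K s) \<le> \<epsilon>")
    case True
    let ?g = "norm (s - near L K s)"
    have "(\<integral>\<^sup>+r. ennreal (2 * r) * indicator {0..\<epsilon>} r * indicator (par_along L K r) s \<partial>lborel)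
      = (\<integral>\<^sup>+r. ennreal (2 * r) * indicator {?g..\<epsilon>} r \<partial>lborel)"
    proof (intro nn_integral_cong)
      fix r :: real
      have "r \<ge> ?g \<Longrightarrow> r \<ge> 0" using norm_ge_zero order_trans by blast
      then show "ennreal (2 * r) * indicator {0..\<epsilon>} r * indicator (par_along L K r) s = ennreal (2 * r) * indicator {?g..\<epsilon>} r"
        using True by (auto simp: indicator_def par_along_iff)
    qed
    also have "\<dots> = ennreal (\<epsilon>\<^sup>2 - ?g\<^sup>2)"
    proof (rule nn_integral_FTC_Icc)
      show "0 \<le> 2 * x" if "x \<in> {?g..\<epsilon>}" for x
      proof -
        have "?g \<le> x" using that by (simp only: atLeastAtMost_iff)
        then show ?thesis using norm_ge_zero[of "s - near L K s"] by linarith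
      qed
      show "((\<lambda>x. x\<^sup>2) has_real_derivative 2 * x) (at x)" for x :: real
        by (auto intro!: derivative_eq_intros)
    qed (use True in auto)
    also have "\<epsilon>\<^sup>2 - ?g\<^sup>2 = excess \<epsilon> s" using True by (simp add: excess_def power_mono)
    finally show ?thesis by simp
  next
    case False
    then have "excess \<epsilon> s = 0"
      using e by (auto simp: excess_def indicator_def power_mono)
    moreover have "ennreal (2 * r) * indicator {0..\<epsilon>} r * indicator (par_along L K r) s = 0" for r
      using False by (auto simp: indicator_def par_along_iff)
    ultimately show ?thesis by (simp only: nn_integral_const) simp
  qed
  have meas: "(\<lambda>(s, r). ennreal (2 * r) * indicator {0..\<epsilon>} r * indicator (par_along L K r) s) \<in> borel_measurable ((lborel :: 'a measure) \<Otimes>\<^sub>M lborel)"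
  proof -
    have "(\<lambda>p. ennreal (2 * snd p) * indicator {0..\<epsilon>} (snd p) * indicator {p \<in> space (lborel \<Otimes>\<^sub>M lborel). fst p \<in> shadow \<and> norm (fst p - near L K (fst p)) \<le> snd p} p)
      \<in> borel_measurable ((lborel :: 'a measure) \<Otimes>\<^sub>M lborel)" by measurable
    also have "(\<lambda>p. ennreal (2 * snd p) * indicator {0..\<epsilon>} (snd p) * indicator {p \<in> space (lborel \<Otimes>\<^sub>M lborel). fst p \<in> shadow \<and> norm (fst p - near L K (fst p)) \<le> snd p} p)
      = (\<lambda>(s, r). ennreal (2 * r) * indicator {0..\<epsilon>} r * indicator (par_along L K r) s)"
      by (auto simp: fun_eq_iff indicator_def par_along_iff space_pair_measure)
    finally show ?thesis .
  qed
  have "(\<integral>\<^sup>+s. ennreal (excess \<epsilon> s) \<partial>lborel)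
    = (\<integral>\<^sup>+r. (\<integral>\<^sup>+s. ennreal (2 * r) * indicator {0..\<epsilon>} r * indicator (par_along L K r) s \<partial>lborel) \<partial>lborel)"
    unfolding inner by (rule lborel_pair.Fubini'[symmetric, OF meas])
  also have "\<dots> = (\<integral>\<^sup>+r. ennreal (2 * r * ?F r) * indicator {0..\<epsilon>} r \<partial>lborel)"
  proof (intro nn_integral_cong)
    fix r :: real
    have "(\<integral>\<^sup>+s. ennreal (2 * r) * indicator {0..\<epsilon>} r * indicator (par_along L K r) s \<partial>lborel)
      = ennreal (2 * r) * indicator {0..\<epsilon>} r * emeasure lborel (par_along L K r)"
      by (subst nn_integral_cmult) auto
    then show "(\<integral>\<^sup>+s. ennreal (2 * r) * indicator {0..\<epsilon>} r * indicator (par_along L K r) s \<partial>lborel)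
      = ennreal (2 * r * ?F r) * indicator {0..\<epsilon>} r"
      \<comment> \<open>At \<open>r = 0\<close> the assumption says nothing about the volume, but
        the factor \<open>2 * r\<close> vanishes on both sides.\<close>
      using em[of r] Fpos[of r] by (cases "r \<in> {0<..\<epsilon>}") (auto simp: ennreal_mult indicator_def)
  qed
  also have "\<dots> = ennreal (?H \<epsilon> - ?H 0)"
  proof (rule nn_integral_FTC_Icc)
    show "(?H has_real_derivative 2 * x * ?F x) (at x)" for x :: real by (rule der)
    show "0 \<le> 2 * x * ?F x" if "x \<in> {0..\<epsilon>}" for x using that Fpos[of x] by (cases "x = 0") (auto intro!: mult_nonneg_nonneg)
  qed (use e in auto)
  also have "?H \<epsilon> - ?H 0 = ?H \<epsilon>" by simp
  finally have nn: "(\<integral>\<^sup>+s. ennreal (excess \<epsilon> s) \<partial>lborel) = ennreal (?H \<epsilon>)" .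
  have "?H 0 \<le> ?H \<epsilon>"
  proof (rule DERIV_nonneg_imp_nondecreasing[of 0 \<epsilon>])
    fix x assume "0 \<le> x" "x \<le> \<epsilon>"
    then show "\<exists>y. (?H has_real_derivative y) (at x) \<and> 0 \<le> y"
      using der[of x] Fpos[of x] by (intro exI[of _ "2 * x * ?F x"]) (cases "x = 0", auto intro!: mult_nonneg_nonneg)
  qed (use e in simp)
  then have "0 \<le> ?H \<epsilon>" by simp
  then show ?thesis
    using nn by (subst integral_eq_nn_integral) (auto simp: excess_nonneg)
qed

text \<open>With \<open>v = s - p\<close>, the difference of squared norms is
  \<open>2 * (v \<bullet> s)\<close> minus the squared norm of \<open>v\<close>. The first term
  integrates to \<open>dim L\<close> times the integral of the excess by \<open>dilation\<close>,
  the second to \<open>\<epsilon>\<close> squared times the volume minus the same integral. This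
  accounts for the factor \<open>dim L + 1\<close> and for the \<open>- 1\<close>.\<close>

lemma moment_relation:
  assumes F: "\<And>r. 0 < r \<Longrightarrow> measure lborel (par_along L K r) = (\<Sum>j\<le>n. C j * r ^ j)" and e: "\<epsilon> > 0"
  shows "(\<integral>s. indicator (par_along L K \<epsilon>) s * ((norm s)\<^sup>2 - (norm (near L K s))\<^sup>2) \<partial>lborel)
    = (\<Sum>j\<le>n. (2 * real (dim L + 1) / real (j + 2) - 1) * C j * \<epsilon> ^ (j + 2))"
proof -
  have par[measurable]: "par_along L K \<epsilon> \<in> sets borel" using K(1) L by (rule borel_par_along)
  obtain R where R: "R > 0" "\<And>\<epsilon>. par_along L K \<epsilon> \<subseteq> cball 0 (R + \<epsilon>)" "\<And>s. s \<in> shadow \<Longrightarrow> norm (near L K s) \<le> R"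
    by (rule radius) blast
  let ?i = "indicator (par_along L K \<epsilon>) :: 'a \<Rightarrow> real"
  let ?v = "\<lambda>s. s - near L K s"
  have i1: "integrable lborel (\<lambda>s. ?i s * (norm (?v s))\<^sup>2)"
  proof (rule integrable_cball_bound[of _ "\<epsilon>\<^sup>2" "R + \<epsilon>"])
    fix s
    show "\<bar>?i s * (norm (?v s))\<^sup>2\<bar> \<le> \<epsilon>\<^sup>2 * indicator (cball 0 (R + \<epsilon>)) s"
      using R(2)[of \<epsilon>] par_along_iff[of s \<epsilon>] by (auto simp: indicator_def intro: power_mono)
  qed measurable
  have i2: "integrable lborel (\<lambda>s. ?i s * (2 * (?v s \<bullet> s)))"
  proof (rule integrable_cball_bound[of _ "2 * \<epsilon> * (R + \<epsilon>)" "R + \<epsilon>"])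
    fix s
    show "\<bar>?i s * (2 * (?v s \<bullet> s))\<bar> \<le> (2 * \<epsilon> * (R + \<epsilon>)) * indicator (cball 0 (R + \<epsilon>)) s"
    proof (cases "s \<in> par_along L K \<epsilon>")
      case True
      then have s: "norm s \<le> R + \<epsilon>" "norm (?v s) \<le> \<epsilon>" using R(2)[of \<epsilon>] par_along_iff[of s \<epsilon>] by auto
      have "\<bar>?v s \<bullet> s\<bar> \<le> norm (?v s) * norm s" by (rule Cauchy_Schwarz_ineq2)
      also have "\<dots> \<le> \<epsilon> * (R + \<epsilon>)" using s e R(1) by (intro mult_mono) auto
      finally show ?thesis using True s by (simp add: abs_mult)
    qed (use e R(1) in \<open>auto simp: indicator_def\<close>)
  qed measurable
  have i3: "integrable lborel (\<lambda>s. ?i s * \<epsilon>\<^sup>2)"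
    using compact_par_along[OF K(1) L, of \<epsilon>] emeasure_compact_finite[of "par_along L K \<epsilon>"]
    by (intro integrable_mult_left integrable_real_indicator) auto
  let ?J = "\<integral>s. excess \<epsilon> s \<partial>lborel" and ?F = "measure lborel (par_along L K \<epsilon>)"
  have J: "?J = \<epsilon>\<^sup>2 * ?F - (\<integral>s. ?i s * (norm (?v s))\<^sup>2 \<partial>lborel)"
  proof -
    have "excess \<epsilon> s = ?i s * \<epsilon>\<^sup>2 - ?i s * (norm (?v s))\<^sup>2" for s
      using e power_mono[of "norm (?v s)" \<epsilon> 2] power_strict_mono[of \<epsilon> "norm (?v s)" 2]
      by (auto simp: excess_def indicator_def par_along_iff not_le)
    then show ?thesis using i1 i3 by simp
  qed
  have "?i s * ((norm s)\<^sup>2 - (norm (near L K s))\<^sup>2) = ?i s * (2 * (?v s \<bullet> s)) - ?i s * (norm (?v s))\<^sup>2" for s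
    by (simp add: power2_norm_eq_inner inner_diff_left inner_diff_right inner_commute algebra_simps)
  then have "(\<integral>s. ?i s * ((norm s)\<^sup>2 - (norm (near L K s))\<^sup>2) \<partial>lborel)
    = (\<integral>s. ?i s * (2 * (?v s \<bullet> s)) \<partial>lborel) - (\<integral>s. ?i s * (norm (?v s))\<^sup>2 \<partial>lborel)"
    using i1 i2 by simp
  also have "\<dots> = real (dim L) * ?J - (\<epsilon>\<^sup>2 * ?F - ?J)"
    using dilation[OF e gap_level_null[OF F e]] J by simp
  also have "\<dots> = real (dim L + 1) * (\<Sum>j\<le>n. C j * 2 * \<epsilon> ^ (j + 2) / real (j + 2)) - \<epsilon>\<^sup>2 * (\<Sum>j\<le>n. C j * \<epsilon> ^ j)"
    using integral_excess[OF F e] F[of \<epsilon>] e by (simp add: algebra_simps)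
  also have "\<dots> = (\<Sum>j\<le>n. (2 * real (dim L + 1) / real (j + 2) - 1) * C j * \<epsilon> ^ (j + 2))"
    unfolding sum_distrib_left sum_subtractf[symmetric]
    by (intro sum.cong refl) (simp add: field_simps power_add power2_eq_square)
  finally show ?thesis .
qed

end

section \<open>Cells of a polytope\<close>

text \<open>For \<open>w = x + n\<close> with \<open>n\<close> an outer normal at \<open>x \<in> P\<close>, the point \<open>x + proj L n\<close>
  has \<open>x\<close> as its nearest point along \<open>L\<close>; on a cell of \<open>P\<close> with normal space \<open>S\<close> this map is, up to a translation,
  \<open>squash L S\<close>.\<close>

definition squash :: "'a::euclidean_space set \<Rightarrow> 'a set \<Rightarrow> 'a \<Rightarrow> 'a" where
  "squash L S w = (w - proj S w) + proj L (proj S w)"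

lemma linear_squash: "linear (squash L S)"
  unfolding squash_def[abs_def] by (intro linearI) (simp_all add: proj_add proj_scaleR algebra_simps)

text \<open>The half-spaces, given as pairs of a normal and an offset, are kept as part of the data
  because subsets of \<open>J\<close> index the faces and hence the cells.\<close>

locale polyhedral =
  fixes J :: "('a::euclidean_space \<times> real) set" and P :: "'a set"
  assumes J: "finite J" and P_def: "P = {x. \<forall>h\<in>J. fst h \<bullet> x \<le> snd h}"
    and bnd: "bounded P" and ne: "P \<noteq> {}"
begin

lemma compact_P: "compact P" and convex_P: "convex P"
proof -
  have e: "P = (\<Inter>h\<in>J. {x. fst h \<bullet> x \<le> snd h})" by (auto simp: P_def)
  have "closed P" unfolding e by (intro closed_INT ballI closed_halfspace_le)
  then show "compact P" using bnd compact_eq_bounded_closed by blast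
  show "convex P" unfolding e by (intro convex_INT convex_halfspace_le)
qed

abbreviation p :: "'a \<Rightarrow> 'a" where "p \<equiv> near UNIV P"

text \<open>Points of \<open>P\<close> with the same active set form the relative interior of one
  face. \<open>N\<close> is its normal cone, \<open>S\<close> the normal space, whose dimension is
  the codimension of the face, and \<open>cell\<close> collects the points whose metric projection
  falls on it. Subsets of \<open>J\<close> that belong to no face have empty cells.\<close>

definition act :: "'a \<Rightarrow> ('a \<times> real) set" where "act x = {h\<in>J. fst h \<bullet> x = snd h}"
definition S :: "('a \<times> real) set \<Rightarrow> 'a set" where "S A = span (fst ` A)"
definition N :: "('a \<times> real) set \<Rightarrow> 'a set" where "N A = convex_cone hull (fst ` A)"
definition cell :: "('a \<times> real) set \<Rightarrow> 'a set" where "cell A = {w. act (p w) = A}"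

sublocale U: convex_along UNIV P
  by unfold_locales (auto simp: compact_P convex_P)

lemma shadow_UNIV: "U.shadow = UNIV"
  using ne by (auto simp: U.shadow_def slice_def)

lemma p_in: "p w \<in> P"
  using U.near_in[of w] by (simp add: shadow_UNIV slice_def)

lemma subspace_S: "subspace (S A)" by (simp add: S_def)

lemma N_subset_S: "N A \<subseteq> S A"
  unfolding N_def S_def by (intro hull_minimal span_superset subspace_imp_convex_cone subspace_span)

lemma N_scale: "n \<in> N A \<Longrightarrow> 0 \<le> t \<Longrightarrow> t *\<^sub>R n \<in> N A"
  unfolding N_def by (meson conic_convex_cone_hull conicD)

lemma N_normal:
  assumes n: "n \<in> N (act x)" and y: "y \<in> P"
  shows "n \<bullet> (y - x) \<le> 0"
proof -
  have "N (act x) \<subseteq> {n. (y - x) \<bullet> n \<le> 0}" unfolding N_def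
  proof (rule hull_minimal)
    show "fst ` act x \<subseteq> {n. (y - x) \<bullet> n \<le> 0}"
    proof
      fix m assume "m \<in> fst ` act x"
      then obtain h where h: "h \<in> J" "fst h \<bullet> x = snd h" "m = fst h" by (auto simp: act_def)
      moreover have "fst h \<bullet> y \<le> snd h" using y h by (simp add: P_def)
      ultimately show "m \<in> {n. (y - x) \<bullet> n \<le> 0}" by (simp add: inner_diff_left inner_diff_right inner_commute)
    qed
  qed (rule convex_cone_halfspace_le)
  then show ?thesis using n by (auto simp: inner_commute)
qed

text \<open>The cone of projected normals is finitely generated, hence closed. If \<open>v\<close>
  were outside it, a separating functional would give a direction in \<open>L\<close> that stays in
  \<open>P\<close> for a while and makes a positive inner product with \<open>v\<close>, against the
  assumption on \<open>v\<close>.\<close>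

lemma farkas_along:
  assumes L: "subspace L" and x: "x \<in> P" and v: "v \<in> L"
    and nrm: "\<And>y. y \<in> P \<Longrightarrow> y - x \<in> L \<Longrightarrow> v \<bullet> (y - x) \<le> 0"
  obtains n where "n \<in> N (act x)" "proj L n = v"
proof -
  let ?C = "convex_cone hull (proj L ` fst ` act x)"
  have C: "?C = proj L ` N (act x)"
    unfolding N_def by (rule convex_cone_hull_linear_image[OF linear_proj])
  have "v \<in> ?C"
  proof (rule ccontr)
    assume "v \<notin> ?C"
    moreover have cl: "closed ?C" using J by (intro closed_convex_cone_hull) (simp add: act_def)
    moreover have cv: "convex ?C" by (simp add: convex_convex_cone_hull)
    ultimately obtain a b where ab: "a \<bullet> v < b" "\<And>z. z \<in> ?C \<Longrightarrow> b < a \<bullet> z"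
      using separating_hyperplane_closed_point by metis
    have "0 \<in> ?C" by (rule convex_cone_hull_contains_0)
    then have b: "b < 0" using ab(2) by force
    \<comment> \<open>A functional bounded below on a cone is nonnegative there: a negative value
      could be scaled to the forbidden bound \<open>b\<close>.\<close>
    have pos: "0 \<le> a \<bullet> z" if z: "z \<in> ?C" for z
    proof (rule ccontr)
      assume neg: "\<not> 0 \<le> a \<bullet> z"
      define t where "t = b / (a \<bullet> z)"
      have "0 \<le> t" using neg b by (simp add: t_def divide_nonpos_nonpos)
      then have "t *\<^sub>R z \<in> ?C" using z by (meson conic_convex_cone_hull conicD)
      then have "b < a \<bullet> (t *\<^sub>R z)" by (rule ab(2))
      moreover have "a \<bullet> (t *\<^sub>R z) = b" using neg by (simp add: t_def)
      ultimately show False by simp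
    qed
    \<comment> \<open>The negative of the projected functional: active constraints do not increase
      along it, while the inner product with \<open>v\<close> does.\<close>
    define a' where "a' = - proj L a"
    have a'L: "a' \<in> L" using L by (simp add: a'_def proj_in subspace_neg)
    have va: "v \<bullet> a' > 0"
      using ab(1) b inner_proj_in[OF L v, of a] by (simp add: a'_def inner_commute)
    have act: "fst h \<bullet> a' \<le> 0" if "h \<in> act x" for h
    proof -
      have "proj L (fst h) \<in> ?C" using that by (intro hull_inc) blast
      then have "0 \<le> a \<bullet> proj L (fst h)" by (rule pos)
      then show ?thesis using proj_selfadj[OF L, of a "fst h"] by (simp add: a'_def inner_commute)
    qed
    \<comment> \<open>Active constraints survive every positive step, inactive ones survive small
      steps by continuity.\<close>
    have "eventually (\<lambda>t. fst h \<bullet> (x + t *\<^sub>R a') \<le> snd h) (at_right 0)" if h: "h \<in> J" for h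
    proof (cases "h \<in> act x")
      case True
      have "fst h \<bullet> (x + t *\<^sub>R a') \<le> snd h" if "t > 0" for t
        using True act[OF True] that by (simp add: act_def inner_add_right mult_nonneg_nonpos)
      then show ?thesis by (auto simp: eventually_at_right_field intro!: exI[of _ 1])
    next
      case False
      have "fst h \<bullet> x \<le> snd h" using x h by (simp add: P_def)
      then have lt: "fst h \<bullet> (x + 0 *\<^sub>R a') < snd h" using False h by (simp add: act_def less_le)
      have "((\<lambda>t. fst h \<bullet> (x + t *\<^sub>R a')) \<longlongrightarrow> fst h \<bullet> (x + 0 *\<^sub>R a')) (at_right 0)"
        by (intro tendsto_intros)
      from order_tendstoD(2)[OF this lt] show ?thesis by eventually_elim simp
    qed
    then have "eventually (\<lambda>t. \<forall>h\<in>J. fst h \<bullet> (x + t *\<^sub>R a') \<le> snd h) (at_right 0)"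
      using J by (intro eventually_ball_finite) auto
    moreover have "eventually (\<lambda>t::real. t > 0) (at_right 0)" by (rule eventually_at_right_less)
    ultimately have "eventually (\<lambda>t. t > 0 \<and> x + t *\<^sub>R a' \<in> P) (at_right 0)"
      by eventually_elim (simp add: P_def)
    then obtain t where t: "t > 0" "x + t *\<^sub>R a' \<in> P" using eventually_happens' trivial_limit_at_right_real by blast
    have "v \<bullet> (x + t *\<^sub>R a' - x) \<le> 0" by (rule nrm[OF t(2)]) (simp add: a'L L subspace_mul)
    then show False using t(1) va by (simp add: mult_le_0_iff)
  qed
  then show thesis using that unfolding C by blast
qed

text \<open>The nearest point is the one at which \<open>s - x\<close> is normal to the slice of
  \<open>P\<close>. Those normals are exactly the projections of normals of \<open>P\<close>: one
  inclusion is \<open>farkas_along\<close>, the other tests the normal of \<open>P\<close> on the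
  slice.\<close>

lemma near_iff:
  assumes L: "subspace L" and x: "x \<in> P" and s: "s - x \<in> L"
  shows "near L P s = x \<longleftrightarrow> (\<exists>n\<in>N (act x). proj L n = s - x)"
proof -
  interpret convex_along L P by unfold_locales (auto simp: compact_P convex_P L)
  have xs: "x \<in> slice L P s" using x s by (simp add: slice_def)
  then have sh: "s \<in> shadow" by (auto simp: shadow_def)
  have dL: "y - x \<in> L" if "y \<in> slice L P s" for y
    using that subspace_diff[OF L s, of "s - y"] by (simp add: slice_def)
  show ?thesis
  proof
    assume e: "near L P s = x"
    show "\<exists>n\<in>N (act x). proj L n = s - x"
    proof (rule farkas_along[OF L x s])
      fix y assume y: "y \<in> P" "y - x \<in> L"
      have "s - y \<in> L" using subspace_diff[OF L s y(2)] by simp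
      then show "(s - x) \<bullet> (y - x) \<le> 0" using near_dot[OF sh, of y] y(1) e by (simp add: slice_def)
    qed blast
  next
    assume "\<exists>n\<in>N (act x). proj L n = s - x"
    then obtain n where n: "n \<in> N (act x)" "proj L n = s - x" by blast
    show "near L P s = x"
    proof (rule near_unique[OF xs])
      fix y assume y: "y \<in> slice L P s"
      have "(s - x) \<bullet> (y - x) = n \<bullet> (y - x)" using inner_proj_in[OF L dL[OF y], of n] n(2) by simp
      also have "\<dots> \<le> 0" using N_normal[OF n(1)] y by (simp add: slice_def)
      finally show "(s - x) \<bullet> (y - x) \<le> 0" .
    qed
  qed
qed

lemma p_iff: "x \<in> P \<Longrightarrow> p w = x \<longleftrightarrow> w - x \<in> N (act x)"
  using near_iff[of UNIV x w] by auto

lemma act_subset: "act x \<subseteq> J" by (auto simp: act_def)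

lemma cell_normal: "w \<in> cell A \<Longrightarrow> w - p w \<in> N A"
  using p_iff[OF p_in, of w w] by (simp add: cell_def)

lemma measurable_act [measurable]: "f \<in> borel_measurable M \<Longrightarrow> Measurable.pred M (\<lambda>w. act (f w) = A)"
proof -
  assume f[measurable]: "f \<in> borel_measurable M"
  have "act (f w) = A \<longleftrightarrow> A \<subseteq> J \<and> (\<forall>h\<in>J. (fst h \<bullet> f w = snd h) = (h \<in> A))" for w by (auto simp: act_def)
  moreover have "Measurable.pred M (\<lambda>w. A \<subseteq> J \<and> (\<forall>h\<in>J. (fst h \<bullet> f w = snd h) = (h \<in> A)))"
    by (intro pred_intros_logic pred_intros_finite J) measurable
  ultimately show ?thesis by simp
qed

lemma borel_cell [measurable]: "cell A \<in> sets borel"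
proof -
  have "Measurable.pred borel (\<lambda>w. act (p w) = A)" by measurable
  then show ?thesis by (simp add: cell_def pred_def)
qed

text \<open>The component in \<open>S A\<close> shared by all nearest points of the cell, taken from
  an arbitrary one.\<close>

definition anchor :: "('a \<times> real) set \<Rightarrow> 'a" where "anchor A = proj (S A) (p (SOME w. w \<in> cell A))"

text \<open>Points with the same active constraints solve the same equations, so their difference is
  orthogonal to all normals in \<open>A\<close>.\<close>

lemma anchor:
  assumes "w \<in> cell A" shows "proj (S A) (p w) = anchor A"
proof -
  define w' where "w' = (SOME w. w \<in> cell A)"
  have w': "w' \<in> cell A" unfolding w'_def using assms by (rule someI)
  have "proj (S A) (p w - p w') = 0"
  proof (subst proj_eq_0_iff[OF subspace_S], rule ballI)
    fix z assume "z \<in> S A"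
    then show "(p w - p w') \<bullet> z = 0" unfolding S_def
    proof (induction rule: span_induct)
      case base show ?case by (rule subspace_hyperplane)
    next
      case (step z)
      then obtain h where h: "h \<in> A" "z = fst h" by auto
      then have "h \<in> act (p w)" "h \<in> act (p w')" using assms w' by (simp_all add: cell_def)
      then show ?case using h by (simp add: act_def inner_diff_left inner_diff_right inner_commute)
    qed
  qed
  then show ?thesis by (simp add: proj_diff anchor_def w'_def)
qed

text \<open>Makes \<open>p\<close> affine on the cell: the normal part lies in \<open>S A\<close>,
  and the part of \<open>p w\<close> in that space is constant.\<close>

lemma cell_decomp:
  assumes "w \<in> cell A"
  shows "w - p w = proj (S A) w - anchor A"
proof -
  have "proj (S A) (w - p w) = w - p w"
    using cell_normal[OF assms] N_subset_S by (intro proj_id subspace_S) blast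
  then show ?thesis using anchor[OF assms] by (simp add: proj_diff)
qed

text \<open>An affine map of the whole space that on the cell keeps the nearest point and projects
  the normal part to \<open>L\<close>; the constant term accounts for a face whose affine hull
  misses the origin.\<close>

definition foldmap :: "'a set \<Rightarrow> ('a \<times> real) set \<Rightarrow> 'a \<Rightarrow> 'a" where
  "foldmap L A w = squash L (S A) w + (anchor A - proj L (anchor A))"

lemma foldmap_cell:
  assumes "w \<in> cell A" shows "foldmap L A w = p w + proj L (w - p w)"
proof -
  have e: "proj (S A) w = (w - p w) + anchor A" using cell_decomp[OF assms] by simp
  show ?thesis unfolding foldmap_def squash_def e by (simp add: proj_add proj_diff)
qed

lemma near_foldmap:
  assumes L: "subspace L" and w: "w \<in> cell A" shows "near L P (foldmap L A w) = p w"
proof -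
  have "w - p w \<in> N (act (p w))" using cell_normal[OF w] w by (simp add: cell_def)
  then show ?thesis
    using near_iff[OF L p_in, of "foldmap L A w" w] L by (auto simp: foldmap_cell[OF w] proj_in)
qed

definition piece :: "'a set \<Rightarrow> real \<Rightarrow> ('a \<times> real) set \<Rightarrow> 'a set" where
  "piece L \<epsilon> A = {s \<in> par_along L P \<epsilon>. act (near L P s) = A}"

text \<open>Surjectivity rests on \<open>near_iff\<close>: \<open>s - x\<close> lifts to a normal
  \<open>n\<close> of \<open>P\<close> at its nearest point \<open>x\<close>, and
  \<open>x + n\<close> is a preimage in the cell.\<close>

lemma piece_eq:
  assumes L: "subspace L"
  shows "piece L \<epsilon> A = foldmap L A ` (cell A \<inter> {w. norm (proj L (w - p w)) \<le> \<epsilon>})"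
proof (intro set_eqI iffI)
  interpret convex_along L P by unfold_locales (auto simp: compact_P convex_P L)
  fix s
  { assume s: "s \<in> piece L \<epsilon> A"
    define x where "x = near L P s"
    have sh: "s \<in> shadow" and n: "norm (s - x) \<le> \<epsilon>" and A: "act x = A"
      using s by (auto simp: piece_def par_along_iff x_def)
    have x: "x \<in> P" "s - x \<in> L" using near_in[OF sh] by (auto simp: x_def slice_def)
    then obtain n where n': "n \<in> N (act x)" "proj L n = s - x" using near_iff[OF L x] x_def by blast
    define w where "w = x + n"
    have pw: "p w = x" using p_iff[OF x(1), of w] n'(1) by (simp add: w_def)
    have w: "w \<in> cell A" using pw A by (simp add: cell_def)
    have wn: "w - p w = n" unfolding pw by (simp add: w_def)
    have "foldmap L A w = x + (s - x)" by (simp only: foldmap_cell[OF w] wn n'(2)) (simp only: pw)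
    then have "foldmap L A w = s" by simp
    moreover have "norm (proj L (w - p w)) \<le> \<epsilon>" using n n' by (simp add: wn)
    ultimately show "s \<in> foldmap L A ` (cell A \<inter> {w. norm (proj L (w - p w)) \<le> \<epsilon>})" using w by blast }
  { assume "s \<in> foldmap L A ` (cell A \<inter> {w. norm (proj L (w - p w)) \<le> \<epsilon>})"
    then obtain w where w: "w \<in> cell A" "norm (proj L (w - p w)) \<le> \<epsilon>" "s = foldmap L A w" by blast
    have e: "s - p w = proj L (w - p w)" using foldmap_cell[OF w(1)] w(3) by simp
    have nr: "near L P s = p w" using near_foldmap[OF L w(1)] w(3) by simp
    have "s \<in> par_along L P \<epsilon>" using p_in e w(2) L by (auto simp: par_along_def intro!: bexI[of _ "p w"] proj_in)
    then show "s \<in> piece L \<epsilon> A" using nr w(1) by (simp add: piece_def cell_def) }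
qed

lemma borel_piece:
  assumes L: "subspace L" shows "piece L \<epsilon> A \<in> sets borel"
proof -
  interpret convex_along L P by unfold_locales (auto simp: compact_P convex_P L)
  have [measurable]: "par_along L P \<epsilon> \<in> sets borel" using compact_P L by (rule borel_par_along)
  have "{s \<in> space borel. s \<in> par_along L P \<epsilon> \<and> act (near L P s) = A} \<in> sets borel" by measurable
  then show ?thesis by (simp add: piece_def)
qed

text \<open>The integration runs over the cell in the full space, and \<open>L\<close> enters only
  through the cutoff on the projected normal part; this form allows Fubini with an integration over
  \<open>L\<close>.\<close>

definition cell_integral :: "('a \<Rightarrow> ennreal) \<Rightarrow> 'a set \<Rightarrow> real \<Rightarrow> ('a \<times> real) set \<Rightarrow> ennreal" where
  "cell_integral \<phi> L \<epsilon> A = (\<integral>\<^sup>+w. indicator (cell A) w * indicator {..\<epsilon>} (norm (proj L (w - p w))) * \<phi> (p w) \<partial>lborel)"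

lemma measurable_proj_borel [measurable]: "proj L \<in> borel_measurable borel"
  by (intro borel_measurable_linear linear_proj)

text \<open>If \<open>squash\<close> is injective this is the affine change of variables by
  \<open>foldmap\<close>. Otherwise the piece lies in a proper affine subspace and both sides are
  \<open>0\<close>.\<close>

lemma piece_integral:
  assumes L: "subspace L" and [measurable]: "\<phi> \<in> borel_measurable borel"
  shows "(\<integral>\<^sup>+s. indicator (piece L \<epsilon> A) s * \<phi> (near L P s) \<partial>lborel) = stretch (squash L (S A)) * cell_integral \<phi> L \<epsilon> A"
proof (cases "inj (squash L (S A))")
  interpret convex_along L P by unfold_locales (auto simp: compact_P convex_P L)
  note [measurable] = borel_piece[OF L]
  case True
  have injf: "inj (foldmap L A)" using True by (auto simp: inj_def foldmap_def)
  have "(\<integral>\<^sup>+s. indicator (piece L \<epsilon> A) s * \<phi> (near L P s) \<partial>lborel)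
    = stretch (squash L (S A)) * (\<integral>\<^sup>+w. indicator (piece L \<epsilon> A) (foldmap L A w) * \<phi> (near L P (foldmap L A w)) \<partial>lborel)"
    unfolding foldmap_def by (rule nn_integral_linear_image[OF linear_squash True]) measurable
  also have "(\<integral>\<^sup>+w. indicator (piece L \<epsilon> A) (foldmap L A w) * \<phi> (near L P (foldmap L A w)) \<partial>lborel) = cell_integral \<phi> L \<epsilon> A"
    unfolding cell_integral_def
  proof (rule nn_integral_cong)
    fix w
    have "foldmap L A w \<in> piece L \<epsilon> A \<longleftrightarrow> w \<in> cell A \<and> norm (proj L (w - p w)) \<le> \<epsilon>"
      unfolding piece_eq[OF L] inj_image_mem_iff[OF injf] by blast
    then show "indicator (piece L \<epsilon> A) (foldmap L A w) * \<phi> (near L P (foldmap L A w))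
      = indicator (cell A) w * indicator {..\<epsilon>} (norm (proj L (w - p w))) * \<phi> (p w)"
      by (auto simp: indicator_def near_foldmap[OF L])
  qed
  finally show ?thesis .
next
  interpret convex_along L P by unfold_locales (auto simp: compact_P convex_P L)
  note [measurable] = borel_piece[OF L]
  case False
  have "negligible ((\<lambda>x. (anchor A - proj L (anchor A)) + x) ` squash L (S A) ` UNIV)"
    using negligible_linear_singular_image[OF linear_squash False] by (rule negligible_translation)
  then have "negligible (piece L \<epsilon> A)"
    by (rule negligible_subset) (auto simp: piece_eq[OF L] foldmap_def image_iff add.commute)
  then have "emeasure lebesgue (piece L \<epsilon> A) = 0" by (simp add: negligible_iff_null_sets null_sets_def)
  then have "piece L \<epsilon> A \<in> null_sets lborel" using borel_piece[OF L] by (simp add: emeasure_completion null_sets_def)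
  then have "AE s in lborel. s \<notin> piece L \<epsilon> A" by (rule AE_not_in)
  then have "(\<integral>\<^sup>+s. indicator (piece L \<epsilon> A) s * \<phi> (near L P s) \<partial>lborel) = 0"
    by (subst nn_integral_0_iff_AE) (auto elim!: eventually_mono)
  then show ?thesis by (simp add: stretch_singular[OF linear_squash False])
qed

text \<open>The set of constraints active at the nearest point takes finitely many values and
  thereby partitions the parallel set.\<close>

lemma par_integral:
  assumes L: "subspace L" and [measurable]: "\<phi> \<in> borel_measurable borel"
  shows "(\<integral>\<^sup>+s. indicator (par_along L P \<epsilon>) s * \<phi> (near L P s) \<partial>lborel)
    = (\<Sum>A\<in>Pow J. stretch (squash L (S A)) * cell_integral \<phi> L \<epsilon> A)"
proof -
  interpret convex_along L P by unfold_locales (auto simp: compact_P convex_P L)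
  note [measurable] = borel_piece[OF L]
  have "(\<Sum>A\<in>Pow J. stretch (squash L (S A)) * cell_integral \<phi> L \<epsilon> A)
    = (\<Sum>A\<in>Pow J. (\<integral>\<^sup>+s. indicator (piece L \<epsilon> A) s * \<phi> (near L P s) \<partial>lborel))"
    by (simp add: piece_integral[OF L])
  also have "\<dots> = (\<integral>\<^sup>+s. (\<Sum>A\<in>Pow J. indicator (piece L \<epsilon> A) s * \<phi> (near L P s)) \<partial>lborel)"
    by (rule nn_integral_sum[symmetric]) measurable
  also have "\<dots> = (\<integral>\<^sup>+s. indicator (par_along L P \<epsilon>) s * \<phi> (near L P s) \<partial>lborel)"
  proof (rule nn_integral_cong)
    fix s
    have "(\<Sum>A\<in>Pow J. indicator (piece L \<epsilon> A) s * \<phi> (near L P s))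
      = (\<Sum>A\<in>Pow J. if A = act (near L P s) then indicator (par_along L P \<epsilon>) s * \<phi> (near L P s) else 0)"
      by (intro sum.cong) (auto simp: piece_def indicator_def)
    also have "\<dots> = indicator (par_along L P \<epsilon>) s * \<phi> (near L P s)" using J act_subset by (simp add: sum.delta)
    finally show "(\<Sum>A\<in>Pow J. indicator (piece L \<epsilon> A) s * \<phi> (near L P s)) = indicator (par_along L P \<epsilon>) s * \<phi> (near L P s)" .
  qed
  finally show ?thesis by simp
qed

text \<open>Normal cones are invariant under positive scaling, so stretching the normal part by
  \<open>r\<close> stays in the cell and keeps the nearest point; scaling by \<open>1 / r\<close>
  reverses it.\<close>

lemma cell_scale:
  assumes r: "r > 0"
  shows "scale_along (S A) r w + (anchor A - r *\<^sub>R anchor A) \<in> cell A \<longleftrightarrow> w \<in> cell A" (is ?th1)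
    and "w \<in> cell A \<Longrightarrow> p (scale_along (S A) r w + (anchor A - r *\<^sub>R anchor A)) = p w"
    and "w \<in> cell A \<Longrightarrow> scale_along (S A) r w + (anchor A - r *\<^sub>R anchor A) - p w = r *\<^sub>R (w - p w)"
proof -
  let ?f = "\<lambda>r w. scale_along (S A) r w + (anchor A - r *\<^sub>R anchor A)"
  have eq: "?f r w = p w + r *\<^sub>R (w - p w)" if w: "w \<in> cell A" for r w
  proof -
    have e: "proj (S A) w = (w - p w) + anchor A" using cell_decomp[OF w] by simp
    show ?thesis unfolding scale_along_def e by (simp add: algebra_simps)
  qed
  have pf: "p (?f r w) = p w" if w: "w \<in> cell A" and r: "r > 0" for r w
  proof -
    have "?f r w - p w \<in> N (act (p w))"
      using N_scale[OF cell_normal[OF w], of r] r w eq[OF w, of r] by (simp add: cell_def)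
    then show ?thesis using p_iff[OF p_in] by blast
  qed
  have fw: "?f r w \<in> cell A" if "w \<in> cell A" "r > 0" for r w using pf[OF that] that(1) by (simp add: cell_def)
  have inv: "?f (1 / r) (?f r w) = w" if "r > 0" for r w
  proof -
    have "proj (S A) (anchor A) = anchor A" by (simp add: anchor_def subspace_S)
    then show ?thesis using that subspace_S
      by (simp add: scale_along_def proj_add proj_diff proj_scaleR algebra_simps)
  qed
  show ?th1 using fw[of w r] fw[of "?f r w" "1 / r"] inv[OF r] r by auto
  show "w \<in> cell A \<Longrightarrow> p (?f r w) = p w" by (rule pf[OF _ r])
  show "w \<in> cell A \<Longrightarrow> ?f r w - p w = r *\<^sub>R (w - p w)" by (simp only: eq) simp
qed

text \<open>Stretching the normal part has Jacobian \<open>r ^ dim (S A)\<close>, so the face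
  contributes a monomial of degree equal to its codimension.\<close>

lemma cell_integral_scale:
  assumes r: "r > 0" and L: "subspace L" and [measurable]: "\<phi> \<in> borel_measurable borel"
  shows "cell_integral \<phi> L r A = ennreal (r ^ dim (S A)) * cell_integral \<phi> L 1 A"
proof -
  let ?f = "\<lambda>w. scale_along (S A) r w + (anchor A - r *\<^sub>R anchor A)"
  let ?u = "\<lambda>w. indicator (cell A) w * indicator {..r} (norm (proj L (w - p w))) * \<phi> (p w)"
  have "cell_integral \<phi> L r A = ennreal (r ^ dim (S A)) * (\<integral>\<^sup>+w. ?u (?f w) \<partial>lborel)"
    unfolding cell_integral_def by (rule nn_integral_scale_along[OF subspace_S r]) measurable
  also have "(\<integral>\<^sup>+w. ?u (?f w) \<partial>lborel) = cell_integral \<phi> L 1 A"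
    unfolding cell_integral_def
  proof (rule nn_integral_cong)
    fix w
    show "?u (?f w) = indicator (cell A) w * indicator {..1} (norm (proj L (w - p w))) * \<phi> (p w)"
    proof (cases "w \<in> cell A")
      case True
      have n: "norm (proj L (?f w - p w)) = r * norm (proj L (w - p w))"
        using cell_scale(3)[OF r True] r by (simp add: proj_scaleR)
      have "r * norm (proj L (w - p w)) \<le> r \<longleftrightarrow> norm (proj L (w - p w)) \<le> 1" using r by simp
      then show ?thesis using True cell_scale(1)[OF r, of A w] cell_scale(2)[OF r True] n by (simp add: indicator_def)
    qed (use cell_scale(1)[OF r, of A w] in simp)
  qed
  finally show ?thesis .
qed

theorem par_integral_poly:
  assumes L: "subspace L" and "\<phi> \<in> borel_measurable borel" and "r > 0"
  shows "(\<integral>\<^sup>+s. indicator (par_along L P r) s * \<phi> (near L P s) \<partial>lborel)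
    = (\<Sum>A\<in>Pow J. ennreal (r ^ dim (S A)) * (stretch (squash L (S A)) * cell_integral \<phi> L 1 A))"
  unfolding par_integral[OF assms(1,2)] cell_integral_scale[OF assms(3,1,2)] by (simp add: mult_ac)

end

section \<open>Averages over the Grassmannian\<close>

lemma stretch_orth_conj:
  fixes h f g :: "'a::euclidean_space \<Rightarrow> 'a"
  assumes h: "orthogonal_transformation h" and f: "linear f" and g: "\<And>w. g (h w) = h (f w)"
  shows "stretch g = stretch f"
proof -
  have "h ` cball 0 1 = cball 0 1"
    using image_orthogonal_transformation_cball[OF h, of 0 1] by (simp add: orthogonal_transformation_linear[OF h] linear_0)
  then have "g ` cball 0 1 = g ` h ` cball 0 1" by simp
  also have "\<dots> = h ` f ` cball 0 1" by (auto simp: image_image g)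
  finally have e: "g ` cball 0 1 = h ` f ` cball 0 1" .
  have "f ` cball 0 1 \<in> sets borel"
    by (intro borel_compact compact_continuous_image linear_continuous_on) (use f in \<open>auto simp: linear_conv_bounded_linear\<close>)
  from emeasure_linear_image(2)[OF orthogonal_transformation_linear[OF h] orthogonal_transformation_inj[OF h] this]
  have "emeasure lborel (h ` f ` cball 0 1) = emeasure lborel (f ` cball 0 1)" unfolding stretch_orthogonal[OF h] mult_1 .
  then show ?thesis by (simp only: stretch_def e)
qed

lemma squash_orth:
  assumes h: "orthogonal_transformation h" and "subspace L" "subspace S"
  shows "squash (h ` L) (h ` S) (h w) = h (squash L S w)"
  using assms by (simp add: squash_def proj_orth_image orthogonal_transformation_add orthogonal_transformation_diff)

text \<open>The images of the unit ball under \<open>squash L S\<close> are the sections over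
  \<open>L\<close> of one measurable set in the product, and measures of sections are
  measurable.\<close>

lemma measurable_stretch_squash [measurable]:
  fixes S :: "'a::euclidean_space set"
  shows "(\<lambda>L. stretch (squash L S)) \<in> borel_measurable (grass_space k)"
proof -
  let ?N = "grass_space k \<Otimes>\<^sub>M (lborel :: 'a measure)"
  define B where "B = {p \<in> space ?N. \<exists>u\<in>cball 0 1. norm (squash (fst p) S u - snd p) = 0}"
  have B[measurable]: "B \<in> sets ?N" unfolding B_def
  proof (rule sets_exists_compact)
    show "(\<lambda>p. norm (squash (fst p) S u - snd p)) \<in> borel_measurable ?N" for u unfolding squash_def by measurable
    show "continuous_on (cball 0 1) (\<lambda>u. norm (squash (fst p) S u - snd p))" for p
      unfolding squash_def by (intro continuous_intros)
  qed auto
  have "(\<lambda>L. \<integral>\<^sup>+s. indicator B (L, s) \<partial>lborel) \<in> borel_measurable (grass_space k)" by measurable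
  then have "(\<lambda>L. (\<integral>\<^sup>+s. indicator B (L, s) \<partial>lborel) / emeasure lborel (cball (0::'a) 1)) \<in> borel_measurable (grass_space k)"
    by measurable
  then show ?thesis
  proof (rule measurable_cong[THEN iffD1, rotated])
    fix L :: "'a set" assume L: "L \<in> space (grass_space k)"
    have c: "squash L S ` cball 0 1 \<in> sets borel"
      by (intro borel_compact compact_continuous_image) (auto simp: squash_def intro!: continuous_intros)
    have "indicator B (L, s) = (indicator (squash L S ` cball 0 1) s :: ennreal)" for s
      using L by (auto simp: B_def indicator_def space_pair_measure)
    then have "(\<integral>\<^sup>+s. indicator B (L, s) \<partial>lborel) = emeasure lborel (squash L S ` cball 0 1)"
      using c by simp
    then show "(\<integral>\<^sup>+s. indicator B (L, s) \<partial>lborel) / emeasure lborel (cball (0::'a) 1) = stretch (squash L S)"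
      by (simp add: stretch_def)
  qed
qed

lemma stretch_squash_eq_0:
  assumes S: "subspace S" and z: "z \<in> S" "z \<noteq> 0" "proj L z = 0"
  shows "stretch (squash L S) = 0"
proof (rule stretch_singular[OF linear_squash])
  have "squash L S z = squash L S 0" using z S by (simp add: squash_def proj_id)
  then show "\<not> inj (squash L S)" using z(2) by (auto dest: injD)
qed

text \<open>\<open>proj L\<close> cannot be injective on a space of larger dimension than
  \<open>L\<close>, so \<open>squash\<close> collapses a direction of \<open>S\<close>. Faces of
  codimension above \<open>k\<close> contribute nothing for this reason.\<close>

lemma stretch_squash_dim:
  assumes L: "subspace L" and S: "subspace S" and d: "dim L < dim S"
  shows "stretch (squash L S) = 0"
proof -
  have "\<not> inj_on (proj L) (span S)"
  proof
    assume "inj_on (proj L) (span S)"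
    then have "dim (proj L ` S) = dim S" by (intro dim_image_eq linear_proj)
    moreover have "dim (proj L ` S) \<le> dim L" using L by (intro dim_subset) (auto simp: proj_in)
    ultimately show False using d by simp
  qed
  then obtain x y where xy: "x \<in> S" "y \<in> S" "x \<noteq> y" "proj L x = proj L y"
    using S by (auto simp: inj_on_def span_eq_iff[THEN iffD2])
  show ?thesis by (rule stretch_squash_eq_0[OF S, of "x - y"]) (use xy S in \<open>auto simp: subspace_diff proj_diff\<close>)
qed

locale haar =
  fixes \<nu> :: "'a::euclidean_space set measure" and k :: nat
  assumes haar_like: "haar_like k \<nu>"
begin

lemma sets_nu [simp, measurable_cong]: "sets \<nu> = sets (grass_space k)"
  using haar_like by (simp add: haar_like_def)

lemma space_nu [simp]: "space \<nu> = grass k"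
  using sets_eq_imp_space_eq[OF sets_nu] by simp

sublocale prob_space \<nu>
  using haar_like by (intro prob_spaceI) (simp add: haar_like_def)

lemma nn_integral_orth:
  fixes h :: "'a \<Rightarrow> 'a"
  assumes h: "orthogonal_transformation h" and [measurable]: "u \<in> borel_measurable (grass_space k)"
  shows "(\<integral>\<^sup>+L. u (h ` L) \<partial>\<nu>) = (\<integral>\<^sup>+L. u L \<partial>\<nu>)"
proof -
  note [measurable] = measurable_orth_image[OF h]
  have "distr \<nu> (grass_space k) (\<lambda>L. h ` L) = \<nu>" using haar_like h by (simp add: haar_like_def)
  then have "(\<integral>\<^sup>+L. u L \<partial>\<nu>) = (\<integral>\<^sup>+L. u L \<partial>distr \<nu> (grass_space k) (\<lambda>L. h ` L))" by simp
  also have "\<dots> = (\<integral>\<^sup>+L. u (h ` L) \<partial>\<nu>)" by (subst nn_integral_distr) auto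
  finally show ?thesis by simp
qed

text \<open>A rotation taking \<open>S\<close> to \<open>S0\<close> and \<open>n\<close> to
  \<open>norm n\<close> times \<open>e0\<close> transports the integrand, and invariance of
  \<open>\<nu>\<close> removes the rotation.\<close>

lemma fold_average_eq:
  fixes S S0 :: "'a set"
  assumes S: "subspace S" "subspace S0" "dim S = dim S0" and n: "n \<in> S" "e0 \<in> S0" "norm e0 = 1"
  shows "(\<integral>\<^sup>+L. stretch (squash L S) * indicator {..1} (norm (proj L n)) \<partial>\<nu>)
    = (\<integral>\<^sup>+L. stretch (squash L S0) * indicator {..1} (norm n * norm (proj L e0)) \<partial>\<nu>)"
proof -
  obtain h where h: "orthogonal_transformation h" "h ` S = S0" "h n = norm n *\<^sub>R e0"
    by (rule orth_trans_subspaces_vec[OF S n(1), of "norm n *\<^sub>R e0"]) (use S n in \<open>auto simp: subspace_mul\<close>)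
  have "(\<integral>\<^sup>+L. stretch (squash L S0) * indicator {..1} (norm n * norm (proj L e0)) \<partial>\<nu>)
    = (\<integral>\<^sup>+L. stretch (squash L S0) * indicator {..1} (norm (proj L (h n))) \<partial>\<nu>)"
    by (simp add: h(3) proj_scaleR)
  also have "\<dots> = (\<integral>\<^sup>+L. stretch (squash (h ` L) S0) * indicator {..1} (norm (proj (h ` L) (h n))) \<partial>\<nu>)"
    by (rule nn_integral_orth[OF h(1), symmetric]) measurable
  also have "\<dots> = (\<integral>\<^sup>+L. stretch (squash L S) * indicator {..1} (norm (proj L n)) \<partial>\<nu>)"
  proof (rule nn_integral_cong)
    fix L assume "L \<in> space \<nu>"
    then have L: "subspace L" by (simp add: grass_def)
    have "stretch (squash (h ` L) S0) = stretch (squash L S)"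
      by (rule stretch_orth_conj[OF h(1) linear_squash]) (simp add: h(2)[symmetric] squash_orth[OF h(1) L S(1)])
    then show "stretch (squash (h ` L) S0) * indicator {..1} (norm (proj (h ` L) (h n)))
      = stretch (squash L S) * indicator {..1} (norm (proj L n))"
      by (simp add: proj_orth_image[OF h(1) L] orthogonal_transformation_norm[OF h(1)])
  qed
  finally show ?thesis by simp
qed

end

text \<open>Reference pair for the rotations. A unit vector in the subspace requires
  \<open>1 \<le> j\<close>, which is why degree \<open>0\<close> is treated apart in
  \<open>fold_factor\<close>.\<close>

definition std_flag :: "nat \<Rightarrow> 'a::euclidean_space set \<times> 'a" where
  "std_flag j = (SOME (S, e). subspace S \<and> dim S = j \<and> e \<in> S \<and> norm e = 1)"

lemma std_flag:
  assumes "1 \<le> j" "j \<le> DIM('a::euclidean_space)"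
  shows "subspace (fst (std_flag j :: 'a set \<times> 'a))" "dim (fst (std_flag j :: 'a set \<times> 'a)) = j"
    "snd (std_flag j :: 'a set \<times> 'a) \<in> fst (std_flag j)" "norm (snd (std_flag j :: 'a set \<times> 'a)) = 1"
proof -
  obtain S :: "'a set" where S: "subspace S" "dim S = j"
    using choose_subspace_of_subspace[of j "UNIV :: 'a set"] assms(2) by auto
  have "onb S 0 \<in> S" "norm (onb S 0) = 1"
    using onb_in[OF S(1), of 0] onb_inner[OF S(1), of 0 0] S assms by (auto simp: norm_eq_1)
  with S have "\<exists>q::'a set \<times> 'a. (\<lambda>(S, e). subspace S \<and> dim S = j \<and> e \<in> S \<and> norm e = 1) q"
    by (intro exI[of _ "(S, onb S 0)"]) auto
  from someI_ex[OF this, folded std_flag_def]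
  show "subspace (fst (std_flag j :: 'a set \<times> 'a))" "dim (fst (std_flag j :: 'a set \<times> 'a)) = j"
    "snd (std_flag j :: 'a set \<times> 'a) \<in> fst (std_flag j)" "norm (snd (std_flag j :: 'a set \<times> 'a)) = 1"
    by (auto simp: case_prod_beta)
qed

text \<open>A rotation taking the normal space \<open>S\<close> and a unit normal to a fixed flag makes the average
  depend only on \<open>dim S\<close>; the cutoff \<open>norm n * norm (proj L e) \<le> 1\<close> then yields the power of \<open>norm (proj L e)\<close>.\<close>

definition fold_factor :: "'a::euclidean_space set measure \<Rightarrow> nat \<Rightarrow> ennreal" where
  "fold_factor \<nu> j = (if j = 0 then 1 else
     (\<integral>\<^sup>+L. stretch (squash L (fst (std_flag j))) * ennreal (inverse (norm (proj L (snd (std_flag j)))) ^ j) \<partial>\<nu>))"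

lemma (in haar) fold_factor_eq_0:
  assumes "k < j" "j \<le> DIM('a)" shows "fold_factor \<nu> j = 0"
proof -
  have "(\<integral>\<^sup>+L. stretch (squash L (fst (std_flag j))) * ennreal (inverse (norm (proj L (snd (std_flag j)))) ^ j) \<partial>\<nu>) = (\<integral>\<^sup>+L. 0 \<partial>\<nu>)"
  proof (rule nn_integral_cong)
    fix L assume "L \<in> space \<nu>"
    then have "stretch (squash L (fst (std_flag j))) = 0"
      using assms std_flag[of j, where 'a='a] by (intro stretch_squash_dim) (auto simp: grass_def)
    then show "stretch (squash L (fst (std_flag j))) * ennreal (inverse (norm (proj L (snd (std_flag j)))) ^ j) = 0" by simp
  qed
  then show ?thesis using assms by (simp add: fold_factor_def)
qed

locale polyhedral_haar = polyhedral J P + haar \<nu> k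
  for J :: "('a::euclidean_space \<times> real) set" and P :: "'a set" and \<nu> :: "'a set measure" and k :: nat
begin

text \<open>Fubini freezes \<open>w\<close>; its normal part lies in \<open>S A\<close> and is
  rotated to the reference flag, after which \<open>L\<close> meets \<open>w\<close> only through
  the length of the normal part. Exchanging the integrals back leaves a cell integral for the whole
  space with a radius depending on \<open>L\<close>, and homogeneity separates the two.\<close>

lemma cell_average:
  assumes [measurable]: "\<phi> \<in> borel_measurable borel"
  shows "(\<integral>\<^sup>+L. stretch (squash L (S A)) * cell_integral \<phi> L 1 A \<partial>\<nu>)
    = fold_factor \<nu> (dim (S A)) * cell_integral \<phi> UNIV 1 A"
proof (cases "dim (S A) = 0")
  \<comment> \<open>In codimension \<open>0\<close> there is no normal direction: on the cell
    \<open>p w = w\<close>, and \<open>squash\<close> is the identity.\<close>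
  case True
  then have S0: "S A = {0}" using subspace_S[of A] by (auto simp: subspace_0)
  have n: "w - p w = 0" if "w \<in> cell A" for w using cell_normal[OF that] N_subset_S[of A] S0 by blast
  have ci: "cell_integral \<phi> L 1 A = cell_integral \<phi> UNIV 1 A" for L
    unfolding cell_integral_def
  proof (rule nn_integral_cong)
    fix w
    show "indicator (cell A) w * indicator {..1} (norm (proj L (w - p w))) * \<phi> (p w) =
      indicator (cell A) w * indicator {..1} (norm (proj UNIV (w - p w))) * \<phi> (p w)"
      using n[of w] by (cases "w \<in> cell A") (simp_all add: indicator_def)
  qed
  have "proj {0} w = 0" for w :: 'a by (rule proj_unique) auto
  then have "squash L (S A) = (\<lambda>w. w)" for L by (auto simp: squash_def S0)
  then have st: "stretch (squash L (S A)) = 1" for L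
    using stretch_orthogonal[OF orthogonal_transformation_id] by simp
  have "(\<integral>\<^sup>+L. stretch (squash L (S A)) * cell_integral \<phi> L 1 A \<partial>\<nu>) = (\<integral>\<^sup>+L. cell_integral \<phi> UNIV 1 A \<partial>\<nu>)"
    using st ci by (intro nn_integral_cong) (metis mult_1)
  then show ?thesis using True by (simp add: fold_factor_def emeasure_space_1[unfolded space_nu])
next
  case False
  define j where "j = dim (S A)"
  have j: "1 \<le> j" "j \<le> DIM('a)"
    using False dim_subset_UNIV[of "S A"] unfolding j_def by linarith+
  define S0 where "S0 = fst (std_flag j :: 'a set \<times> 'a)"
  define e0 where "e0 = snd (std_flag j :: 'a set \<times> 'a)"
  have S0: "subspace S0" "dim S0 = j" "e0 \<in> S0" "norm e0 = 1"
    using std_flag[OF j] by (simp_all add: S0_def e0_def)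
  interpret \<nu>l: pair_sigma_finite \<nu> "lborel :: 'a measure" ..
  have "(\<integral>\<^sup>+L. stretch (squash L (S A)) * cell_integral \<phi> L 1 A \<partial>\<nu>)
    = (\<integral>\<^sup>+L. (\<integral>\<^sup>+w. stretch (squash L (S A)) * (indicator (cell A) w * indicator {..1} (norm (proj L (w - p w))) * \<phi> (p w)) \<partial>lborel) \<partial>\<nu>)"
    unfolding cell_integral_def by (intro nn_integral_cong nn_integral_cmult[symmetric]) measurable
  also have "\<dots> = (\<integral>\<^sup>+w. (\<integral>\<^sup>+L. stretch (squash L (S A)) * (indicator (cell A) w * indicator {..1} (norm (proj L (w - p w))) * \<phi> (p w)) \<partial>\<nu>) \<partial>lborel)"
    by (rule \<nu>l.Fubini'[symmetric]) measurable
  also have "\<dots> = (\<integral>\<^sup>+w. (\<integral>\<^sup>+L. stretch (squash L S0) * (indicator (cell A) w * indicator {..1} (norm (w - p w) * norm (proj L e0)) * \<phi> (p w)) \<partial>\<nu>) \<partial>lborel)"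
  proof (rule nn_integral_cong)
    fix w
    show "(\<integral>\<^sup>+L. stretch (squash L (S A)) * (indicator (cell A) w * indicator {..1} (norm (proj L (w - p w))) * \<phi> (p w)) \<partial>\<nu>)
      = (\<integral>\<^sup>+L. stretch (squash L S0) * (indicator (cell A) w * indicator {..1} (norm (w - p w) * norm (proj L e0)) * \<phi> (p w)) \<partial>\<nu>)"
    proof (cases "w \<in> cell A")
      case True
      have nS: "w - p w \<in> S A" using cell_normal[OF True] N_subset_S by blast
      have "(\<integral>\<^sup>+L. stretch (squash L (S A)) * (indicator (cell A) w * indicator {..1} (norm (proj L (w - p w))) * \<phi> (p w)) \<partial>\<nu>)
        = (\<integral>\<^sup>+L. stretch (squash L (S A)) * indicator {..1} (norm (proj L (w - p w))) * \<phi> (p w) \<partial>\<nu>)"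
        using True by (simp add: mult_ac)
      also have "\<dots> = (\<integral>\<^sup>+L. stretch (squash L (S A)) * indicator {..1} (norm (proj L (w - p w))) \<partial>\<nu>) * \<phi> (p w)"
        by (rule nn_integral_multc) measurable
      also have "\<dots> = (\<integral>\<^sup>+L. stretch (squash L S0) * indicator {..1} (norm (w - p w) * norm (proj L e0)) \<partial>\<nu>) * \<phi> (p w)"
        using fold_average_eq[OF subspace_S S0(1) _ nS S0(3,4)] S0(2) j_def by simp
      also have "\<dots> = (\<integral>\<^sup>+L. stretch (squash L S0) * indicator {..1} (norm (w - p w) * norm (proj L e0)) * \<phi> (p w) \<partial>\<nu>)"
        by (rule nn_integral_multc[symmetric]) measurable
      also have "\<dots> = (\<integral>\<^sup>+L. stretch (squash L S0) * (indicator (cell A) w * indicator {..1} (norm (w - p w) * norm (proj L e0)) * \<phi> (p w)) \<partial>\<nu>)"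
        using True by (simp add: mult_ac)
      finally show ?thesis .
    qed simp
  qed
  also have "\<dots> = (\<integral>\<^sup>+L. (\<integral>\<^sup>+w. stretch (squash L S0) * (indicator (cell A) w * indicator {..1} (norm (w - p w) * norm (proj L e0)) * \<phi> (p w)) \<partial>lborel) \<partial>\<nu>)"
    by (rule \<nu>l.Fubini') measurable
  also have "\<dots> = (\<integral>\<^sup>+L. stretch (squash L S0) * ennreal (inverse (norm (proj L e0)) ^ j) * cell_integral \<phi> UNIV 1 A \<partial>\<nu>)"
  proof (rule nn_integral_cong)
    fix L assume "L \<in> space \<nu>"
    let ?i = "\<integral>\<^sup>+w. indicator (cell A) w * indicator {..1} (norm (w - p w) * norm (proj L e0)) * \<phi> (p w) \<partial>lborel"
    have "(\<integral>\<^sup>+w. stretch (squash L S0) * (indicator (cell A) w * indicator {..1} (norm (w - p w) * norm (proj L e0)) * \<phi> (p w)) \<partial>lborel)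
      = stretch (squash L S0) * ?i"
      by (rule nn_integral_cmult) measurable
    also have "\<dots> = stretch (squash L S0) * ennreal (inverse (norm (proj L e0)) ^ j) * cell_integral \<phi> UNIV 1 A"
    proof (cases "proj L e0 = 0")
      \<comment> \<open>Both sides vanish because \<open>squash\<close> collapses \<open>e0\<close>,
        so the default value of \<open>inverse 0\<close> has no effect.\<close>
      case True
      then have "stretch (squash L S0) = 0" using S0 by (intro stretch_squash_eq_0[of _ e0]) auto
      then show ?thesis by simp
    next
      case False
      let ?r = "inverse (norm (proj L e0))"
      have r: "?r > 0" using False by simp
      \<comment> \<open>The factor \<open>norm (proj L e0)\<close> in the cutoff is traded for the
        radius \<open>?r\<close>, to which homogeneity applies.\<close>
      have "?i = cell_integral \<phi> UNIV ?r A" unfolding cell_integral_def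
      proof (rule nn_integral_cong)
        fix w
        have "norm (w - p w) * norm (proj L e0) \<le> 1 \<longleftrightarrow> norm (w - p w) \<le> ?r"
          using False by (simp add: field_simps)
        then show "indicator (cell A) w * indicator {..1} (norm (w - p w) * norm (proj L e0)) * \<phi> (p w)
          = indicator (cell A) w * indicator {..?r} (norm (proj UNIV (w - p w))) * \<phi> (p w)"
          by (simp add: indicator_def)
      qed
      also have "\<dots> = ennreal (?r ^ j) * cell_integral \<phi> UNIV 1 A"
        unfolding j_def by (rule cell_integral_scale[OF r]) auto
      finally show ?thesis by (simp add: mult.assoc)
    qed
    finally show "(\<integral>\<^sup>+w. stretch (squash L S0) * (indicator (cell A) w * indicator {..1} (norm (w - p w) * norm (proj L e0)) * \<phi> (p w)) \<partial>lborel)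
      = stretch (squash L S0) * ennreal (inverse (norm (proj L e0)) ^ j) * cell_integral \<phi> UNIV 1 A" .
  qed
  also have "\<dots> = fold_factor \<nu> j * cell_integral \<phi> UNIV 1 A"
    using j unfolding fold_factor_def S0_def[symmetric] e0_def[symmetric] by (subst nn_integral_multc) auto
  finally show ?thesis by (simp add: j_def)
qed

end

section \<open>Polynomial coefficients as sums over faces\<close>

context polyhedral
begin

definition weight :: "('a \<Rightarrow> real) \<Rightarrow> 'a set \<Rightarrow> ('a \<times> real) set \<Rightarrow> ennreal" where
  "weight \<phi> L A = stretch (squash L (S A)) * cell_integral (\<lambda>x. ennreal (\<phi> x)) L 1 A"

text \<open>The coefficient of \<open>r ^ j\<close> when \<open>\<phi>\<close> of the nearest point
  is integrated over the parallel set of radius \<open>r\<close>; for \<open>\<phi> = 1\<close> and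
  \<open>L = UNIV\<close> a Steiner coefficient of \<open>P\<close>.\<close>

definition coef :: "('a \<Rightarrow> real) \<Rightarrow> 'a set \<Rightarrow> nat \<Rightarrow> real" where
  "coef \<phi> L j = (\<Sum>A | A \<in> Pow J \<and> dim (S A) = j. enn2real (weight \<phi> L A))"

text \<open>Each weight is one nonnegative summand of the integral at radius \<open>1\<close>, taken
  over a set inside a fixed ball. The bound is uniform in \<open>L\<close>, as averaging
  requires.\<close>

lemma weight_bound:
  assumes L: "subspace L" and [measurable]: "\<phi> \<in> borel_measurable borel"
    and B: "\<And>x. x \<in> P \<Longrightarrow> \<phi> x \<le> B" and R: "P \<subseteq> cball 0 R" and A: "A \<in> Pow J"
  shows "weight \<phi> L A \<le> ennreal B * emeasure lborel (cball (0::'a) (R + 1))"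
proof -
  interpret convex_along L P by unfold_locales (auto simp: compact_P convex_P L)
  have "weight \<phi> L A \<le> (\<Sum>A\<in>Pow J. weight \<phi> L A)" using A J by (intro member_le_sum) auto
  also have "\<dots> = (\<integral>\<^sup>+s. indicator (par_along L P 1) s * ennreal (\<phi> (near L P s)) \<partial>lborel)"
    by (subst par_integral_poly[OF L, of "\<lambda>x. ennreal (\<phi> x)" 1]) (auto simp: weight_def)
  also have "\<dots> \<le> (\<integral>\<^sup>+s. ennreal B * indicator (cball (0::'a) (R + 1)) s \<partial>lborel)"
  proof (rule nn_integral_mono)
    fix s
    show "indicator (par_along L P 1) s * ennreal (\<phi> (near L P s)) \<le> ennreal B * indicator (cball 0 (R + 1)) s"
    proof (cases "s \<in> par_along L P 1")
      case True
      then have s: "s \<in> shadow" "norm (s - near L P s) \<le> 1" by (auto simp: par_along_iff)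
      have n: "near L P s \<in> P" using near_in[OF s(1)] by (simp add: slice_def)
      have "norm (near L P s) \<le> R" using n R by auto
      then have "norm s \<le> R + 1" using s(2) norm_triangle_sub[of s "near L P s"] by linarith
      then show ?thesis using True B[OF n] by (simp add: ennreal_leI)
    qed simp
  qed
  also have "\<dots> = ennreal B * emeasure lborel (cball (0::'a) (R + 1))" by (rule nn_integral_cmult_indicator) simp
  finally show ?thesis .
qed

lemma bounded_below: obtains R where "R \<ge> 0" "P \<subseteq> cball 0 R"
proof -
  obtain R where "R > 0" "\<And>x. x \<in> P \<Longrightarrow> norm x \<le> R" using bnd bounded_pos by blast
  then show thesis by (intro that[of R]) auto
qed

lemma weight_finite:
  assumes L: "subspace L" and phi: "\<phi> \<in> borel_measurable borel"
    and B: "\<And>x. x \<in> P \<Longrightarrow> \<phi> x \<le> B" and A: "A \<in> Pow J"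
  shows "weight \<phi> L A < top"
proof -
  obtain R where R: "P \<subseteq> cball 0 R" by (rule bounded_below)
  have "weight \<phi> L A \<le> ennreal B * emeasure lborel (cball (0::'a) (R + 1))" by (rule weight_bound[OF L phi B R A])
  also have "\<dots> < top" using emeasure_lborel_cball_finite[of "0::'a" "R + 1"] by (simp add: ennreal_mult_less_top)
  finally show ?thesis .
qed

lemma dim_S_le: "dim (S A) \<le> DIM('a)" by (rule dim_subset_UNIV)

lemma group_dim: "(\<Sum>A\<in>Pow J. f (dim (S A)) * g A) = (\<Sum>j\<le>DIM('a). f j * (\<Sum>A | A \<in> Pow J \<and> dim (S A) = j. g A :: real))"
proof -
  have "(\<Sum>j\<le>DIM('a). f j * (\<Sum>A | A \<in> Pow J \<and> dim (S A) = j. g A)) = (\<Sum>j\<le>DIM('a). \<Sum>A | A \<in> Pow J \<and> dim (S A) = j. f (dim (S A)) * g A)"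
    unfolding sum_distrib_left by (intro sum.cong) auto
  also have "\<dots> = (\<Sum>A\<in>Pow J. f (dim (S A)) * g A)"
    using J dim_S_le by (intro sum.group) auto
  finally show ?thesis by simp
qed

lemma integral_coef:
  assumes L: "subspace L" and phi[measurable]: "\<phi> \<in> borel_measurable borel" and pos: "\<And>x. 0 \<le> \<phi> x"
    and B: "\<And>x. x \<in> P \<Longrightarrow> \<phi> x \<le> B" and r: "r > 0"
  shows "(\<integral>s. indicator (par_along L P r) s * \<phi> (near L P s) \<partial>lborel) = (\<Sum>j\<le>DIM('a). coef \<phi> L j * r ^ j)"
proof -
  interpret convex_along L P by unfold_locales (auto simp: compact_P convex_P L)
  have [measurable]: "par_along L P r \<in> sets borel" using compact_P L by (rule borel_par_along)
  have "(\<integral>s. indicator (par_along L P r) s * \<phi> (near L P s) \<partial>lborel)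
    = enn2real (\<integral>\<^sup>+s. ennreal (indicator (par_along L P r) s * \<phi> (near L P s)) \<partial>lborel)"
    by (intro integral_eq_nn_integral) (auto simp: pos)
  also have "(\<integral>\<^sup>+s. ennreal (indicator (par_along L P r) s * \<phi> (near L P s)) \<partial>lborel)
     = (\<integral>\<^sup>+s. indicator (par_along L P r) s * ennreal (\<phi> (near L P s)) \<partial>lborel)"
    by (intro nn_integral_cong) (auto simp: indicator_def)
  also have "\<dots> = (\<Sum>A\<in>Pow J. ennreal (r ^ dim (S A)) * weight \<phi> L A)"
    by (subst par_integral_poly[OF L _ r]) (auto simp: weight_def)
  also have "enn2real \<dots> = (\<Sum>A\<in>Pow J. enn2real (ennreal (r ^ dim (S A)) * weight \<phi> L A))"
    using weight_finite[OF L phi, of B] B by (subst enn2real_sum) (auto simp: ennreal_mult_less_top comp_def)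
  also have "\<dots> = (\<Sum>A\<in>Pow J. r ^ dim (S A) * enn2real (weight \<phi> L A))"
    using r by (simp add: enn2real_mult)
  also have "\<dots> = (\<Sum>j\<le>DIM('a). r ^ j * coef \<phi> L j)" unfolding coef_def by (rule group_dim)
  finally show ?thesis by (simp add: mult.commute)
qed

lemma coef_eq_0: "subspace L \<Longrightarrow> dim L < j \<Longrightarrow> coef \<phi> L j = 0"
  by (auto simp: coef_def weight_def subspace_S stretch_squash_dim intro!: sum.neutral)

lemma coef_truncate:
  assumes "subspace L" shows "(\<Sum>j\<le>DIM('a). coef \<phi> L j * f j) = (\<Sum>j\<le>dim L. coef \<phi> L j * f j)"
  using assms dim_subset_UNIV[of L] by (intro sum.mono_neutral_right) (auto simp: coef_eq_0)

lemma volume_coef: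
  assumes L: "subspace L" and r: "r > 0"
  shows "measure lborel (par_along L P r) = (\<Sum>j\<le>DIM('a). coef (\<lambda>_. 1) L j * r ^ j)"
proof -
  have "par_along L P r \<in> sets lborel" using borel_par_along[OF compact_P L] by simp
  then show ?thesis
    using integral_coef[OF L, of "\<lambda>_. 1" 1 r] r by simp
qed

lemma sq_bound: obtains B where "\<And>x. x \<in> P \<Longrightarrow> (norm x)\<^sup>2 \<le> B"
proof -
  obtain R where R: "R \<ge> 0" "P \<subseteq> cball 0 R" by (rule bounded_below)
  show thesis by (rule that[of "R\<^sup>2"]) (use R in \<open>auto intro: power_mono\<close>)
qed

text \<open>Both identities share the same shifted terms: \<open>s\<close> and its nearest point
  have the same component orthogonal to \<open>L\<close>, so the squared norms of \<open>s\<close>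
  and of \<open>proj L s\<close> change by the same amount. The second identity serves the fibre
  integrals.\<close>

lemma moment_coef:
  assumes L: "subspace L" and r: "r > 0"
  shows "(\<integral>s. indicator (par_along L P r) s * (norm s)\<^sup>2 \<partial>lborel)
    = (\<Sum>j\<le>DIM('a). coef (\<lambda>x. (norm x)\<^sup>2) L j * r ^ j)
      + (\<Sum>j\<le>DIM('a). (2 * real (dim L + 1) / real (j + 2) - 1) * coef (\<lambda>_. 1) L j * r ^ (j + 2))" (is ?th1)
    and "(\<integral>s. indicator (par_along L P r) s * (norm (proj L s))\<^sup>2 \<partial>lborel)
    = (\<Sum>j\<le>DIM('a). coef (\<lambda>x. (norm (proj L x))\<^sup>2) L j * r ^ j)
      + (\<Sum>j\<le>DIM('a). (2 * real (dim L + 1) / real (j + 2) - 1) * coef (\<lambda>_. 1) L j * r ^ (j + 2))" (is ?th2)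
proof -
  interpret convex_along L P by unfold_locales (auto simp: compact_P convex_P L)
  have [measurable]: "par_along L P r \<in> sets borel" using compact_P L by (rule borel_par_along)
  obtain B where B: "\<And>x. x \<in> P \<Longrightarrow> (norm x)\<^sup>2 \<le> B" by (rule sq_bound) blast
  obtain R where R: "R > 0" "\<And>\<epsilon>. par_along L P \<epsilon> \<subseteq> cball 0 (R + \<epsilon>)" "\<And>s. s \<in> shadow \<Longrightarrow> norm (near L P s) \<le> R"
    by (rule radius) blast
  let ?i = "indicator (par_along L P r) :: 'a \<Rightarrow> real"
  note rel = moment_relation[OF volume_coef[OF L] r]
  have bd: "integrable lborel (\<lambda>s. ?i s * f s)" if [measurable]: "f \<in> borel_measurable borel"
    and f: "\<And>s. s \<in> par_along L P r \<Longrightarrow> \<bar>f s\<bar> \<le> C" for f :: "'a \<Rightarrow> real" and C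
  proof (rule integrable_cball_bound[of _ C "R + r"])
    fix s
    show "\<bar>?i s * f s\<bar> \<le> C * indicator (cball 0 (R + r)) s"
    proof (cases "s \<in> par_along L P r")
      case True then show ?thesis using f[OF True] R(2)[of r] by auto
    next
      case False
      obtain x0 where "x0 \<in> P" using ne by blast
      then have "x0 \<in> par_along L P r" using r subspace_0[OF L] by (auto simp: par_along_def intro!: bexI[of _ x0])
      then have "C \<ge> 0" using f[of x0] by linarith
      then show ?thesis using False by (simp add: indicator_def)
    qed
  qed measurable
  have i1: "integrable lborel (\<lambda>s. ?i s * (norm s)\<^sup>2)"
  proof (rule bd[of _ "(R + r)\<^sup>2"])
    fix s assume "s \<in> par_along L P r"
    then have "norm s \<le> R + r" using R(2)[of r] by auto
    then show "\<bar>(norm s)\<^sup>2\<bar> \<le> (R + r)\<^sup>2" by (simp add: power_mono)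
  qed measurable
  have i2: "integrable lborel (\<lambda>s. ?i s * (norm (near L P s))\<^sup>2)"
    by (rule bd[of _ "R\<^sup>2"]) (use R(3) in \<open>auto simp: par_along_iff intro: power_mono\<close>)
  have i3: "integrable lborel (\<lambda>s. ?i s * (norm (proj L (near L P s)))\<^sup>2)"
  proof (rule bd[of _ "R\<^sup>2"])
    fix s assume "s \<in> par_along L P r"
    then have "norm (proj L (near L P s)) \<le> R" using R(3)[of s] norm_proj_le[OF L, of "near L P s"] by (auto simp: par_along_iff)
    then show "\<bar>(norm (proj L (near L P s)))\<^sup>2\<bar> \<le> R\<^sup>2" by (simp add: power_mono)
  qed measurable
  have i4: "integrable lborel (\<lambda>s. ?i s * ((norm s)\<^sup>2 - (norm (near L P s))\<^sup>2))"
    using Bochner_Integration.integrable_diff[OF i1 i2] by (simp add: right_diff_distrib)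
  have "?i s * (norm s)\<^sup>2 = ?i s * (norm (near L P s))\<^sup>2 + ?i s * ((norm s)\<^sup>2 - (norm (near L P s))\<^sup>2)" for s
    by (simp add: algebra_simps)
  then have "(\<integral>s. ?i s * (norm s)\<^sup>2 \<partial>lborel) = (\<integral>s. ?i s * (norm (near L P s))\<^sup>2 \<partial>lborel)
      + (\<integral>s. ?i s * ((norm s)\<^sup>2 - (norm (near L P s))\<^sup>2) \<partial>lborel)"
    using i2 i4 by simp
  then show ?th1 using integral_coef[OF L, of "\<lambda>x. (norm x)\<^sup>2" B r] B r by (simp add: rel)
  have pe: "(norm (proj L s))\<^sup>2 = (norm (proj L (near L P s)))\<^sup>2 + ((norm s)\<^sup>2 - (norm (near L P s))\<^sup>2)" for s
  proof -
    have "s - proj L s = near L P s - proj L (near L P s)"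
      using proj_id[OF L near_diff, of s] by (simp add: proj_diff algebra_simps)
    then show ?thesis using proj_pythagoras[OF L, of s] proj_pythagoras[OF L, of "near L P s"] by simp
  qed
  have "?i s * (norm (proj L s))\<^sup>2 = ?i s * (norm (proj L (near L P s)))\<^sup>2 + ?i s * ((norm s)\<^sup>2 - (norm (near L P s))\<^sup>2)" for s
    unfolding pe[of s] by (simp add: algebra_simps)
  then have "(\<integral>s. ?i s * (norm (proj L s))\<^sup>2 \<partial>lborel) = (\<integral>s. ?i s * (norm (proj L (near L P s)))\<^sup>2 \<partial>lborel)
      + (\<integral>s. ?i s * ((norm s)\<^sup>2 - (norm (near L P s))\<^sup>2) \<partial>lborel)"
    using i3 i4 by simp
  moreover have "(\<integral>s. ?i s * (norm (proj L (near L P s)))\<^sup>2 \<partial>lborel) = (\<Sum>j\<le>DIM('a). coef (\<lambda>x. (norm (proj L x))\<^sup>2) L j * r ^ j)"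
  proof (rule integral_coef[OF L _ _ _ r])
    fix x assume "x \<in> P"
    have "(norm (proj L x))\<^sup>2 \<le> (norm x)\<^sup>2" using norm_proj_le[OF L] by (rule power_mono) simp
    also have "\<dots> \<le> B" using \<open>x \<in> P\<close> by (rule B)
    finally show "(norm (proj L x))\<^sup>2 \<le> B" .
  qed auto
  ultimately show ?th2 by (simp add: rel)
qed

lemma stretch_squash_UNIV: "stretch (squash UNIV T) = 1"
proof -
  have "squash UNIV T = (\<lambda>w. w)" by (auto simp: squash_def)
  then show ?thesis using stretch_orthogonal[OF orthogonal_transformation_id] by simp
qed

end

context polyhedral_haar
begin

text \<open>Termwise application of \<open>cell_average\<close>; the uniform bound on the weights
  gives integrability over \<open>L\<close>.\<close>

lemma coef_average:
  assumes phi[measurable]: "\<phi> \<in> borel_measurable borel" and B: "\<And>x. x \<in> P \<Longrightarrow> \<phi> x \<le> B"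
  shows "integrable \<nu> (\<lambda>L. coef \<phi> L j)"
    and "(\<integral>L. coef \<phi> L j \<partial>\<nu>) = enn2real (fold_factor \<nu> j) * coef \<phi> UNIV j"
proof -
  obtain R where R: "P \<subseteq> cball 0 R" by (rule bounded_below)
  define C where "C = ennreal B * emeasure lborel (cball (0::'a) (R + 1))"
  have C: "C < top" unfolding C_def using emeasure_lborel_cball_finite[of "0::'a" "R + 1"] by (simp add: ennreal_mult_less_top)
  have tm[measurable]: "(\<lambda>L. weight \<phi> L A) \<in> borel_measurable \<nu>" for A
    unfolding weight_def cell_integral_def by measurable
  have tb: "weight \<phi> L A \<le> C" if "L \<in> space \<nu>" "A \<in> Pow J" for L A
    unfolding C_def using that by (intro weight_bound[OF _ phi B R]) (auto simp: grass_def)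
  have int: "integrable \<nu> (\<lambda>L. enn2real (weight \<phi> L A))" if "A \<in> Pow J" for A
  proof (rule integrable_const_bound[of _ "enn2real C"])
    show "AE L in \<nu>. norm (enn2real (weight \<phi> L A)) \<le> enn2real C"
      using tb[OF _ that] C by (intro AE_I2) (auto intro: enn2real_mono)
  qed measurable
  show "integrable \<nu> (\<lambda>L. coef \<phi> L j)" unfolding coef_def using int by auto
  have "(\<integral>L. coef \<phi> L j \<partial>\<nu>) = (\<Sum>A | A \<in> Pow J \<and> dim (S A) = j. \<integral>L. enn2real (weight \<phi> L A) \<partial>\<nu>)"
    unfolding coef_def using int by (intro Bochner_Integration.integral_sum) auto
  also have "\<dots> = (\<Sum>A | A \<in> Pow J \<and> dim (S A) = j. enn2real (fold_factor \<nu> j) * enn2real (weight \<phi> UNIV A))"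
  proof (rule sum.cong[OF refl])
    fix A assume A: "A \<in> {A. A \<in> Pow J \<and> dim (S A) = j}"
    have "(\<integral>L. enn2real (weight \<phi> L A) \<partial>\<nu>) = enn2real (\<integral>\<^sup>+L. ennreal (enn2real (weight \<phi> L A)) \<partial>\<nu>)"
      by (intro integral_eq_nn_integral) auto
    also have "(\<integral>\<^sup>+L. ennreal (enn2real (weight \<phi> L A)) \<partial>\<nu>) = (\<integral>\<^sup>+L. weight \<phi> L A \<partial>\<nu>)"
    proof (rule nn_integral_cong)
      fix L assume "L \<in> space \<nu>"
      then have "weight \<phi> L A < top" using tb[of L A] A C by (auto intro: le_less_trans)
      then show "ennreal (enn2real (weight \<phi> L A)) = weight \<phi> L A" by (simp add: less_top)
    qed
    also have "\<dots> = fold_factor \<nu> j * weight \<phi> UNIV A"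
      using cell_average[of "\<lambda>x. ennreal (\<phi> x)" A] A by (simp add: weight_def stretch_squash_UNIV)
    \<comment> \<open>\<open>enn2real\<close> is multiplicative also at infinity, so the identity
      passes to reals whatever the value of \<open>fold_factor\<close>.\<close>
    finally show "(\<integral>L. enn2real (weight \<phi> L A) \<partial>\<nu>) = enn2real (fold_factor \<nu> j) * enn2real (weight \<phi> UNIV A)"
      by (simp add: enn2real_mult)
  qed
  finally show "(\<integral>L. coef \<phi> L j \<partial>\<nu>) = enn2real (fold_factor \<nu> j) * coef \<phi> UNIV j"
    by (simp add: coef_def sum_distrib_left)
qed

lemma average_moment:
  assumes r: "r > 0"
  shows "(\<integral>L. (\<integral>s. indicator (par_along L P r) s * (norm s)\<^sup>2 \<partial>lborel) \<partial>\<nu>)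
    = (\<Sum>j\<le>DIM('a). enn2real (fold_factor \<nu> j) * coef (\<lambda>x. (norm x)\<^sup>2) UNIV j * r ^ j)
      + (\<Sum>j\<le>DIM('a). (2 * real (k + 1) / real (j + 2) - 1) * (enn2real (fold_factor \<nu> j) * coef (\<lambda>_. 1) UNIV j) * r ^ (j + 2))"
proof -
  obtain B where B: "\<And>x. x \<in> P \<Longrightarrow> (norm x)\<^sup>2 \<le> B" by (rule sq_bound) blast
  have i1: "integrable \<nu> (\<lambda>L. coef (\<lambda>x. (norm x)\<^sup>2) L j)" for j by (rule coef_average(1)[OF _ B]) auto
  have i2: "integrable \<nu> (\<lambda>L. coef (\<lambda>_. 1) L j)" for j by (rule coef_average(1)[of _ 1]) auto
  have "(\<integral>L. (\<integral>s. indicator (par_along L P r) s * (norm s)\<^sup>2 \<partial>lborel) \<partial>\<nu>)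
    = (\<integral>L. (\<Sum>j\<le>DIM('a). coef (\<lambda>x. (norm x)\<^sup>2) L j * r ^ j)
      + (\<Sum>j\<le>DIM('a). (2 * real (k + 1) / real (j + 2) - 1) * coef (\<lambda>_. 1) L j * r ^ (j + 2)) \<partial>\<nu>)"
  proof (rule Bochner_Integration.integral_cong[OF refl])
    fix L assume "L \<in> space \<nu>"
    then have L: "subspace L" "dim L = k" by (auto simp: grass_def)
    show "(\<integral>s. indicator (par_along L P r) s * (norm s)\<^sup>2 \<partial>lborel) = (\<Sum>j\<le>DIM('a). coef (\<lambda>x. (norm x)\<^sup>2) L j * r ^ j)
      + (\<Sum>j\<le>DIM('a). (2 * real (k + 1) / real (j + 2) - 1) * coef (\<lambda>_. 1) L j * r ^ (j + 2))"
      using moment_coef(1)[OF L(1) r] L(2) by simp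
  qed
  also have "\<dots> = (\<Sum>j\<le>DIM('a). (\<integral>L. coef (\<lambda>x. (norm x)\<^sup>2) L j \<partial>\<nu>) * r ^ j)
      + (\<Sum>j\<le>DIM('a). (2 * real (k + 1) / real (j + 2) - 1) * (\<integral>L. coef (\<lambda>_. 1) L j \<partial>\<nu>) * r ^ (j + 2))"
    using i1 i2 by (simp add: Bochner_Integration.integral_sum)
  also have "\<dots> = (\<Sum>j\<le>DIM('a). enn2real (fold_factor \<nu> j) * coef (\<lambda>x. (norm x)\<^sup>2) UNIV j * r ^ j)
      + (\<Sum>j\<le>DIM('a). (2 * real (k + 1) / real (j + 2) - 1) * (enn2real (fold_factor \<nu> j) * coef (\<lambda>_. 1) UNIV j) * r ^ (j + 2))"
    by (simp add: coef_average(2)[OF _ B] coef_average(2)[of _ 1])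
  finally show ?thesis .
qed

end

section \<open>Approximation by polytopes\<close>

text \<open>Lagrange interpolation at the nodes \<open>1\<close> to \<open>m + 1\<close>. What
  matters is that \<open>\<Lambda>\<close> is independent of the polynomial, so that coefficients
  inherit convergence and integrals from values; positive nodes fit formulas known only for
  \<open>r > 0\<close>.\<close>

lemma lagrange_coefficients:
  "\<exists>\<Lambda>::nat \<Rightarrow> nat \<Rightarrow> real. \<forall>c. \<forall>j\<le>m. c j = (\<Sum>i\<le>m. \<Lambda> j i * (\<Sum>l\<le>m. c l * real (Suc i) ^ l))"
proof -
  \<comment> \<open>Lagrange basis polynomial for the node \<open>i + 1\<close>; differences of
    nodes equal differences of indices.\<close>
  define b where "b i = (\<Prod>t\<in>{..m} - {i}. smult (1 / (real i - real t)) [:- real (Suc t), 1:])" for i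
  have pb: "poly (b i) (real (Suc i')) = (if i = i' then 1 else 0)" if "i \<le> m" "i' \<le> m" for i i'
  proof (cases "i = i'")
    case True
    have "poly (b i) (real (Suc i')) = (\<Prod>t\<in>{..m} - {i}. 1)"
      unfolding b_def poly_prod
    proof (intro prod.cong refl)
      fix t assume "t \<in> {..m} - {i}"
      then have "real i - real t \<noteq> 0" by simp
      moreover have "poly [:- real (Suc t), 1:] (real (Suc i')) = real i - real t" using True by simp
      ultimately show "poly (smult (1 / (real i - real t)) [:- real (Suc t), 1:]) (real (Suc i')) = 1"
        by (simp only: poly_smult) simp
    qed
    then show ?thesis using True by simp
  next
    case False
    have "poly (b i) (real (Suc i')) = 0" unfolding b_def poly_prod
    proof (intro prod_zero bexI[of _ i'])
      have "poly [:- real (Suc i'), 1:] (real (Suc i')) = 0" by simp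
      then show "poly (smult (1 / (real i - real i')) [:- real (Suc i'), 1:]) (real (Suc i')) = 0"
        by (simp only: poly_smult mult_zero_right)
    qed (use that False in auto)
    then show ?thesis using False by simp
  qed
  have db: "degree (b i) \<le> m" if "i \<le> m" for i
  proof -
    have "degree (b i) \<le> (\<Sum>t\<in>{..m} - {i}. degree (smult (1 / (real i - real t)) [:- real (Suc t), 1:]))"
      unfolding b_def by (rule order_trans[OF degree_prod_sum_le]) (simp_all only: comp_def finite_Diff finite_atMost order_refl)
    also have "\<dots> \<le> (\<Sum>t\<in>{..m} - {i}. 1)" by (intro sum_mono) (auto intro: order_trans[OF degree_smult_le])
    also have "\<dots> = m" using that by simp
    finally show ?thesis .
  qed
  show ?thesis
  proof (intro exI[of _ "\<lambda>j i. coeff (b i) j"] allI impI)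
    fix c :: "nat \<Rightarrow> real" and j assume j: "j \<le> m"
    define q where "q = (\<Sum>l\<le>m. monom (c l) l)"
    have pq: "poly q x = (\<Sum>l\<le>m. c l * x ^ l)" for x by (simp add: q_def poly_sum poly_monom)
    have "q = (\<Sum>i\<le>m. smult (poly q (real (Suc i))) (b i))"
    proof (rule poly_eqI_degree)
      let ?A = "(\<lambda>i. real (Suc i)) ` {..m}"
      have cA: "card ?A = Suc m" by (subst card_image) (auto simp: inj_on_def)
      show "poly q x = poly (\<Sum>i\<le>m. smult (poly q (real (Suc i))) (b i)) x" if "x \<in> ?A" for x
      proof -
        obtain i' where i': "i' \<le> m" "x = real (Suc i')" using \<open>x \<in> ?A\<close> by blast
        have "poly (\<Sum>i\<le>m. smult (poly q (real (Suc i))) (b i)) x = (\<Sum>i\<le>m. if i = i' then poly q x else 0)"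
          unfolding poly_sum by (intro sum.cong) (use pb i' in auto)
        then show ?thesis using i' by simp
      qed
      have "degree q \<le> m" unfolding q_def by (intro degree_sum_le) (auto intro: order_trans[OF degree_monom_le])
      then show "degree q < card ?A" by (simp only: cA less_Suc_eq_le)
      have "degree (\<Sum>i\<le>m. smult (poly q (real (Suc i))) (b i)) \<le> m"
        by (intro degree_sum_le) (use db in \<open>auto intro: order_trans[OF degree_smult_le]\<close>)
      then show "degree (\<Sum>i\<le>m. smult (poly q (real (Suc i))) (b i)) < card ?A" by (simp only: cA less_Suc_eq_le)
    qed
    then have "coeff q j = (\<Sum>i\<le>m. poly q (real (Suc i)) * coeff (b i) j)"
      by (subst (asm) poly_eq_iff) (simp add: coeff_sum)
    moreover have "coeff q j = c j" using j by (simp add: q_def coeff_sum)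
    ultimately show "c j = (\<Sum>i\<le>m. coeff (b i) j * (\<Sum>l\<le>m. c l * real (Suc i) ^ l))"
      by (simp add: pq mult.commute)
  qed
qed

text \<open>Values at finitely many radii determine the coefficients linearly, so pointwise
  convergence with bounded degree forces convergence of the coefficients and makes the limit a
  polynomial.\<close>

lemma poly_limit:
  fixes g :: "real \<Rightarrow> real" and G :: "nat \<Rightarrow> real \<Rightarrow> real"
  assumes G: "\<And>n r. 0 < r \<Longrightarrow> G n r = (\<Sum>j\<le>m. c n j * r ^ j)" and lim: "\<And>r. 0 < r \<Longrightarrow> (\<lambda>n. G n r) \<longlonglongrightarrow> g r"
  obtains c' where "\<And>r. 0 < r \<Longrightarrow> g r = (\<Sum>j\<le>m. c' j * r ^ j)" "\<And>j. j \<le> m \<Longrightarrow> (\<lambda>n. c n j) \<longlonglongrightarrow> c' j"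
proof -
  obtain \<Lambda> :: "nat \<Rightarrow> nat \<Rightarrow> real" where \<Lambda>: "\<And>c j. j \<le> m \<Longrightarrow> c j = (\<Sum>i\<le>m. \<Lambda> j i * (\<Sum>l\<le>m. c l * real (Suc i) ^ l))"
    using lagrange_coefficients[of m] by blast
  define c' where "c' j = (\<Sum>i\<le>m. \<Lambda> j i * g (real (Suc i)))" for j
  have conv: "(\<lambda>n. c n j) \<longlonglongrightarrow> c' j" if "j \<le> m" for j
  proof -
    have "c n j = (\<Sum>i\<le>m. \<Lambda> j i * G n (real (Suc i)))" for n
      using \<Lambda>[OF that, of "c n"] by (simp add: G del: of_nat_Suc)
    moreover have "(\<lambda>n. \<Sum>i\<le>m. \<Lambda> j i * G n (real (Suc i))) \<longlonglongrightarrow> c' j"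
      unfolding c'_def by (intro tendsto_sum tendsto_mult tendsto_const lim) simp
    ultimately show ?thesis by simp
  qed
  show thesis
  proof (rule that)
    fix r :: real assume r: "0 < r"
    have "(\<lambda>n. \<Sum>j\<le>m. c n j * r ^ j) \<longlonglongrightarrow> (\<Sum>j\<le>m. c' j * r ^ j)"
      by (intro tendsto_sum tendsto_mult tendsto_const conv) simp
    then show "g r = (\<Sum>j\<le>m. c' j * r ^ j)"
      using lim[OF r] G[OF r] LIMSEQ_unique by auto
  qed (rule conv)
qed

text \<open>The approximation is from outside: then the parallel sets decrease to that of \<open>K\<close>
  and dominated convergence applies without any statement about boundaries.\<close>

lemma outer_polyhedral:
  fixes K :: "'a::euclidean_space set"
  assumes K: "compact K" "convex K" "K \<noteq> {}" and \<delta>: "\<delta> > 0"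
  obtains J P where "polyhedral J P" "K \<subseteq> P" "\<And>x. x \<in> P \<Longrightarrow> \<exists>y\<in>K. norm (x - y) < \<delta>"
proof -
  obtain R where R: "R > 0" "\<And>x. x \<in> K \<Longrightarrow> norm x \<le> R" using compact_imp_bounded[OF K(1)] bounded_pos by blast
  \<comment> \<open>The constraints of a box around \<open>K\<close>, which keep the polytope
    bounded.\<close>
  define J0 :: "('a \<times> real) set" where "J0 = (\<lambda>i. (i, R)) ` Basis \<union> (\<lambda>i. (- i, R)) ` Basis"
  \<comment> \<open>The points of the box to be cut off. They form a compact set, so finitely many
    of the half-spaces separating them from \<open>K\<close> suffice.\<close>
  define X where "X = {x. \<forall>h\<in>J0. fst h \<bullet> x \<le> snd h} - (\<Union>y\<in>K. ball y \<delta>)"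
  have box: "{x. \<forall>h\<in>J0. fst h \<bullet> x \<le> snd h} = cbox (- (R *\<^sub>R One)) (R *\<^sub>R One)"
  proof (rule set_eqI)
    fix x :: 'a
    have "(\<forall>h\<in>J0. fst h \<bullet> x \<le> snd h) \<longleftrightarrow> (\<forall>i\<in>Basis. i \<bullet> x \<le> R \<and> - (i \<bullet> x) \<le> R)"
      unfolding J0_def ball_Un by auto
    also have "\<dots> \<longleftrightarrow> (\<forall>i\<in>Basis. - R \<le> x \<bullet> i \<and> x \<bullet> i \<le> R)"
      by (intro ball_cong refl) (auto simp: inner_commute)
    finally have "(\<forall>h\<in>J0. fst h \<bullet> x \<le> snd h) \<longleftrightarrow> (\<forall>i\<in>Basis. - R \<le> x \<bullet> i \<and> x \<bullet> i \<le> R)" .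
    then show "x \<in> {x. \<forall>h\<in>J0. fst h \<bullet> x \<le> snd h} \<longleftrightarrow> x \<in> cbox (- (R *\<^sub>R One)) (R *\<^sub>R One)"
      by (simp add: mem_box)
  qed
  have X: "compact X" unfolding X_def box by (intro compact_diff compact_cbox open_UN) auto
  have "\<forall>z\<in>X. \<exists>h. snd h < fst h \<bullet> z \<and> (\<forall>x\<in>K. fst h \<bullet> x \<le> snd h)"
  proof
    fix z assume "z \<in> X"
    then have "z \<notin> K" using \<delta> by (auto simp: X_def)
    then obtain a b where "a \<bullet> z < b" "\<forall>x\<in>K. b < a \<bullet> x"
      using separating_hyperplane_closed_point[OF K(2) compact_imp_closed[OF K(1)]] by metis
    then show "\<exists>h. snd h < fst h \<bullet> z \<and> (\<forall>x\<in>K. fst h \<bullet> x \<le> snd h)"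
      by (intro exI[of _ "(- a, - b)"]) auto
  qed
  then obtain H where H: "\<And>z. z \<in> X \<Longrightarrow> snd (H z) < fst (H z) \<bullet> z" "\<And>z x. z \<in> X \<Longrightarrow> x \<in> K \<Longrightarrow> fst (H z) \<bullet> x \<le> snd (H z)"
    by metis
  have cover: "X \<subseteq> (\<Union>z\<in>X. {x. fst (H z) \<bullet> x > snd (H z)})" using H(1) by blast
  obtain F where F: "F \<subseteq> X" "finite F" "X \<subseteq> (\<Union>z\<in>F. {x. fst (H z) \<bullet> x > snd (H z)})"
    by (rule compactE_image[OF X open_halfspace_gt cover])
  define J where "J = J0 \<union> H ` F"
  define P where "P = {x. \<forall>h\<in>J. fst h \<bullet> x \<le> snd h}"
  have PJ0: "P \<subseteq> {x. \<forall>h\<in>J0. fst h \<bullet> x \<le> snd h}" by (auto simp: P_def J_def)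
  have KP: "K \<subseteq> P"
  proof
    fix x assume x: "x \<in> K"
    have "\<bar>i \<bullet> x\<bar> \<le> R" if "i \<in> Basis" for i :: 'a
      using Basis_le_norm[OF that, of x] R(2)[OF x] by (simp add: inner_commute)
    then have "\<forall>h\<in>J0. fst h \<bullet> x \<le> snd h" by (auto simp: J0_def abs_le_iff)
    then show "x \<in> P" using H(2) x F(1) by (auto simp: P_def J_def)
  qed
  show thesis
  proof (rule that)
    show "polyhedral J P"
    proof
      show "finite J" using F(2) by (simp add: J_def J0_def)
      show "bounded P" using PJ0 unfolding box by (rule bounded_subset[OF bounded_cbox])
      show "P = {x. \<forall>h\<in>J. fst h \<bullet> x \<le> snd h}" by (rule P_def)
      show "P \<noteq> {}" using KP K(3) by blast
    qed
    fix x assume x: "x \<in> P"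
    have "x \<notin> X" using F(3) x by (auto simp: P_def J_def not_le[symmetric])
    then have "x \<in> (\<Union>y\<in>K. ball y \<delta>)" using x PJ0 by (auto simp: X_def)
    then show "\<exists>y\<in>K. norm (x - y) < \<delta>" by (auto simp: dist_norm norm_minus_commute)
  qed (rule KP)
qed

lemma polyhedral_sequence:
  fixes K :: "'a::euclidean_space set"
  assumes K: "compact K" "convex K" "K \<noteq> {}"
  obtains J P where "\<And>n::nat. polyhedral (J n) (P n)" "\<And>n. K \<subseteq> P n"
    "\<And>n x. x \<in> P n \<Longrightarrow> \<exists>y\<in>K. norm (x - y) \<le> inverse (real (Suc n))"
proof -
  have "\<forall>n::nat. \<exists>JP. polyhedral (fst JP) (snd JP) \<and> K \<subseteq> snd JP \<and> (\<forall>x\<in>snd JP. \<exists>y\<in>K. norm (x - y) \<le> inverse (real (Suc n)))"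
  proof
    fix n
    have "inverse (real (Suc n)) > 0" by simp
    then obtain J P where "polyhedral J P" "K \<subseteq> P" "\<And>x. x \<in> P \<Longrightarrow> \<exists>y\<in>K. norm (x - y) < inverse (real (Suc n))"
      using outer_polyhedral[OF K] by metis
    moreover from this(3) have "\<forall>x\<in>P. \<exists>y\<in>K. norm (x - y) \<le> inverse (real (Suc n))" by (meson less_imp_le)
    ultimately show "\<exists>JP. polyhedral (fst JP) (snd JP) \<and> K \<subseteq> snd JP \<and> (\<forall>x\<in>snd JP. \<exists>y\<in>K. norm (x - y) \<le> inverse (real (Suc n)))"
      by (intro exI[of _ "(J, P)"]) simp
  qed
  then obtain JP where "\<And>n. polyhedral (fst (JP n)) (snd (JP n)) \<and> K \<subseteq> snd (JP n) \<and> (\<forall>x\<in>snd (JP n). \<exists>y\<in>K. norm (x - y) \<le> inverse (real (Suc n)))"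
    by metis
  then show thesis by (intro that[of "\<lambda>n. fst (JP n)" "\<lambda>n. snd (JP n)"]) auto
qed

section \<open>Convergence of integrals under outer approximation\<close>

definition locally_bounded :: "('a::euclidean_space \<Rightarrow> real) \<Rightarrow> bool" where
  "locally_bounded \<psi> \<longleftrightarrow> \<psi> \<in> borel_measurable borel \<and> (\<forall>R. \<exists>C. \<forall>s. norm s \<le> R \<longrightarrow> \<bar>\<psi> s\<bar> \<le> C)"

lemma locally_bounded_continuous:
  assumes "continuous_on UNIV \<psi>" shows "locally_bounded \<psi>"
  unfolding locally_bounded_def
proof (intro conjI allI)
  show "\<psi> \<in> borel_measurable borel" using assms by (rule borel_measurable_continuous_onI)
  fix R
  have "compact (\<psi> ` cball 0 R)" using assms by (intro compact_continuous_image) (auto intro: continuous_on_subset)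
  then obtain C where "\<And>y. y \<in> \<psi> ` cball 0 R \<Longrightarrow> \<bar>y\<bar> \<le> C"
    using compact_imp_bounded bounded_pos by (metis real_norm_def)
  then show "\<exists>C. \<forall>s. norm s \<le> R \<longrightarrow> \<bar>\<psi> s\<bar> \<le> C" by (auto intro!: exI[of _ C])
qed

text \<open>The indicators converge at every point: points of \<open>X\<close> lie in all
  \<open>Y n\<close>, and a point off the closed set \<open>X\<close> has positive distance from it
  and so is eventually outside \<open>Y n\<close>.\<close>

lemma integral_shrinking_sets:
  fixes X :: "'a::euclidean_space set"
  assumes X: "compact X" and psi: "locally_bounded \<psi>"
    and Xn: "\<And>n. compact (Y n)" "\<And>n. X \<subseteq> Y n" "\<And>n s. s \<in> Y n \<Longrightarrow> \<exists>y\<in>X. norm (s - y) \<le> inverse (real (Suc n))"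
  shows "(\<lambda>n. \<integral>s. indicator (Y n) s * \<psi> s \<partial>lborel) \<longlonglongrightarrow> (\<integral>s. indicator X s * \<psi> s \<partial>lborel)"
proof -
  obtain R where R: "R > 0" "\<And>x. x \<in> X \<Longrightarrow> norm x \<le> R" using compact_imp_bounded[OF X] bounded_pos by blast
  obtain C where C: "\<And>s. norm s \<le> R + 1 \<Longrightarrow> \<bar>\<psi> s\<bar> \<le> C" using psi by (auto simp: locally_bounded_def)
  have [measurable]: "\<psi> \<in> borel_measurable borel" using psi by (simp add: locally_bounded_def)
  have [measurable]: "X \<in> sets borel" "Y n \<in> sets borel" for n using X Xn(1) by (auto intro: borel_compact)
  have nY: "norm s \<le> R + 1" if s: "s \<in> Y n" for s n
  proof -
    obtain y where y: "y \<in> X" "norm (s - y) \<le> inverse (real (Suc n))" using Xn(3)[OF s] by blast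
    have "inverse (real (Suc n)) \<le> 1" by (simp add: inverse_le_1_iff)
    then show ?thesis using y R(2)[OF y(1)] norm_triangle_sub[of s y] by linarith
  qed
  show ?thesis
  proof (rule integral_dominated_convergence[where w = "\<lambda>s. C * indicator (cball 0 (R + 1)) s"])
    show "integrable lborel (\<lambda>s::'a. C * indicator (cball 0 (R + 1)) s :: real)"
      using emeasure_lborel_cball_finite[of "0::'a" "R + 1"] by (intro integrable_mult_right integrable_real_indicator) auto
    have "C \<ge> 0" using C[of 0] R(1) by simp
    then show "AE s in lborel. norm (indicator (Y n) s * \<psi> s) \<le> C * indicator (cball 0 (R + 1)) s" for n
      using C nY[of _ n] by (intro AE_I2) (auto simp: indicator_def)
    show "AE s in lborel. (\<lambda>n. indicator (Y n) s * \<psi> s) \<longlonglongrightarrow> indicator X s * \<psi> s"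
    proof (rule AE_I2)
      fix s
      show "(\<lambda>n. indicator (Y n) s * \<psi> s) \<longlonglongrightarrow> indicator X s * \<psi> s"
      proof (cases "s \<in> X")
        case True
        then have "s \<in> Y n" for n using Xn(2) by blast
        then show ?thesis using True by simp
      next
        case False
        have "open (- X)" using compact_imp_closed[OF X] by auto
        then obtain e where e: "e > 0" "ball s e \<subseteq> - X" using False openE by blast
        have "eventually (\<lambda>n. inverse (real (Suc n)) < e) sequentially"
          using LIMSEQ_inverse_real_of_nat e(1) by (rule order_tendstoD(2))
        then have "eventually (\<lambda>n. 0 = indicator (Y n) s * \<psi> s) sequentially"
        proof eventually_elim
          case (elim n)
          have "s \<notin> Y n"
          proof
            assume "s \<in> Y n"
            then obtain y where y: "y \<in> X" "norm (s - y) \<le> inverse (real (Suc n))" using Xn(3) by blast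
            then have "y \<in> ball s e" using elim by (simp add: dist_norm)
            then show False using e(2) y(1) by blast
          qed
          then show ?case by simp
        qed
        then have "(\<lambda>n. indicator (Y n) s * \<psi> s) \<longlonglongrightarrow> 0" by (rule Lim_transform_eventually[OF tendsto_const])
        then show ?thesis using False by simp
      qed
    qed
  qed measurable
qed

lemma integral_par_approx:
  fixes K L :: "'a::euclidean_space set"
  assumes K: "compact K" and L: "subspace L" and psi: "locally_bounded \<psi>"
    and P: "\<And>n. compact (P n)" "\<And>n. K \<subseteq> P n" "\<And>n x. x \<in> P n \<Longrightarrow> \<exists>y\<in>K. norm (x - y) \<le> inverse (real (Suc n))"
  shows "(\<lambda>n. \<integral>s. indicator (par_along L (P n) r) s * \<psi> s \<partial>lborel) \<longlonglongrightarrow> (\<integral>s. indicator (par_along L K r) s * \<psi> s \<partial>lborel)"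
proof (rule integral_shrinking_sets[OF compact_par_along[OF K L] psi compact_par_along[OF P(1) L]])
  show "par_along L K r \<subseteq> par_along L (P n) r" for n using P(2)[of n] by (auto simp: par_along_def)
  fix n s assume "s \<in> par_along L (P n) r"
  then obtain x where x: "x \<in> P n" "s - x \<in> L" "norm (s - x) \<le> r" by (auto simp: par_along_def)
  obtain y where y: "y \<in> K" "norm (x - y) \<le> inverse (real (Suc n))" using P(3)[OF x(1)] by blast
  have "s - (x - y) \<in> par_along L K r" using x y by (auto simp: par_along_def intro!: bexI[of _ y])
  then show "\<exists>y\<in>par_along L K r. norm (s - y) \<le> inverse (real (Suc n))"
    using y(2) by (intro bexI[of _ "s - (x - y)"]) auto
qed

text \<open>Gives continuity at radius \<open>0\<close>, where the scaling argument on cells does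
  not reach; \<open>poly_extend_0\<close> uses it to include \<open>r = 0\<close> in the polynomial
  formulas.\<close>

lemma integral_par_at_0:
  fixes K L :: "'a::euclidean_space set"
  assumes K: "compact K" and L: "subspace L" and psi: "locally_bounded \<psi>"
  shows "(\<lambda>n. \<integral>s. indicator (par_along L K (inverse (real (Suc n)))) s * \<psi> s \<partial>lborel) \<longlonglongrightarrow> (\<integral>s. indicator (par_along L K 0) s * \<psi> s \<partial>lborel)"
proof (rule integral_shrinking_sets[OF compact_par_along[OF K L] psi compact_par_along[OF K L]])
  show "par_along L K 0 \<subseteq> par_along L K (inverse (real (Suc n)))" for n by (force simp: par_along_def)
  fix n s assume "s \<in> par_along L K (inverse (real (Suc n)))"
  then obtain x where x: "x \<in> K" "norm (s - x) \<le> inverse (real (Suc n))" by (auto simp: par_along_def)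
  have "x \<in> par_along L K 0" using x(1) subspace_0[OF L] by (auto simp: par_along_def intro!: bexI[of _ x])
  then show "\<exists>y\<in>par_along L K 0. norm (s - y) \<le> inverse (real (Suc n))" using x(2) by blast
qed

lemma poly_extend_0:
  fixes f :: "real \<Rightarrow> real"
  assumes f: "\<And>r. 0 < r \<Longrightarrow> f r = (\<Sum>j\<le>m. c j * r ^ j)" and lim: "(\<lambda>n. f (inverse (real (Suc n)))) \<longlonglongrightarrow> f 0" and r: "0 \<le> r"
  shows "f r = (\<Sum>j\<le>m. c j * r ^ j)"
proof (cases "r = 0")
  case True
  have "(\<lambda>n. \<Sum>j\<le>m. c j * inverse (real (Suc n)) ^ j) \<longlonglongrightarrow> (\<Sum>j\<le>m. c j * 0 ^ j)"
    by (intro tendsto_intros LIMSEQ_inverse_real_of_nat)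
  then have "(\<lambda>n. f (inverse (real (Suc n)))) \<longlonglongrightarrow> (\<Sum>j\<le>m. c j * 0 ^ j)" by (simp add: f del: of_nat_Suc)
  then show ?thesis using lim True LIMSEQ_unique by blast
qed (use f r in simp)

text \<open>Collects a sum shifted by two degrees; the guard \<open>2 \<le> j\<close> protects
  \<open>j - 2\<close> from truncated subtraction.\<close>

lemma sum_shift2:
  fixes r :: real
  shows "(\<Sum>j\<le>n. a j * r ^ j) + (\<Sum>j\<le>n. b j * r ^ (j + 2)) = (\<Sum>j\<le>n + 2. ((if j \<le> n then a j else 0) + (if 2 \<le> j then b (j - 2) else 0)) * r ^ j)"
proof -
  have "(\<Sum>j\<le>n + 2. (if j \<le> n then a j else 0) * r ^ j) = (\<Sum>j\<le>n. a j * r ^ j)"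
    by (intro sum.mono_neutral_cong_right) auto
  moreover have "(\<Sum>j\<le>n + 2. (if 2 \<le> j then b (j - 2) else 0) * r ^ j) = (\<Sum>j\<le>n. b j * r ^ (j + 2))"
  proof -
    have "(\<Sum>j\<le>n + 2. (if 2 \<le> j then b (j - 2) else 0) * r ^ j) = (\<Sum>j\<in>(\<lambda>j. j + 2) ` {..n}. (if 2 \<le> j then b (j - 2) else 0) * r ^ j)"
    proof (intro sum.mono_neutral_right ballI)
      fix j assume "j \<in> {..n + 2} - (\<lambda>j. j + 2) ` {..n}"
      moreover have "j \<in> (\<lambda>j. j + 2) ` {..n}" if "2 \<le> j" "j \<le> n + 2"
        using that by (intro image_eqI[of _ _ "j - 2"]) auto
      ultimately have "\<not> 2 \<le> j" by blast
      then show "(if 2 \<le> j then b (j - 2) else 0) * r ^ j = 0" by simp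
    qed auto
    also have "\<dots> = (\<Sum>j\<le>n. b j * r ^ (j + 2))" by (subst sum.reindex) (auto simp: inj_on_def)
    finally show ?thesis .
  qed
  ultimately show ?thesis by (simp add: distrib_right sum.distrib)
qed

lemma locally_bounded_moments: "locally_bounded (\<lambda>s. (norm s)\<^sup>2)" "locally_bounded (\<lambda>s. (norm (proj L s))\<^sup>2)" "locally_bounded (\<lambda>s. 1)"
  by (rule locally_bounded_continuous, intro continuous_intros)+

lemma measure_par_eq: "compact K \<Longrightarrow> subspace L \<Longrightarrow> (\<integral>s. indicator (par_along L K r) s * 1 \<partial>lborel) = measure lborel (par_along L K r)"
  using borel_par_along[of K L r] by simp

text \<open>The degree is bounded through \<open>dim L\<close> instead of \<open>DIM('a)\<close>
  because coefficients of polytopes vanish beyond \<open>dim L\<close>; coefficientwise limits keep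
  this bound.\<close>

lemma par_polynomials:
  fixes K L :: "'a::euclidean_space set"
  assumes K: "compact K" "convex K" "K \<noteq> {}" and L: "subspace L"
  obtains c w where
    "\<And>r. 0 \<le> r \<Longrightarrow> (\<integral>s. indicator (par_along L K r) s * (norm (proj L s))\<^sup>2 \<partial>lborel) = (\<Sum>j\<le>dim L + 2. c j * r ^ j)"
    "\<And>r. 0 \<le> r \<Longrightarrow> measure lborel (par_along L K r) = (\<Sum>j\<le>dim L. w j * r ^ j)"
proof -
  obtain J P where JP: "\<And>n::nat. polyhedral (J n) (P n)" "\<And>n. K \<subseteq> P n"
    "\<And>n x. x \<in> P n \<Longrightarrow> \<exists>y\<in>K. norm (x - y) \<le> inverse (real (Suc n))"
    using polyhedral_sequence[OF K] by blast
  have cP: "compact (P n)" for n using polyhedral.compact_P[OF JP(1)] .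
  let ?cq = "\<lambda>n. polyhedral.coef (J n) (P n) (\<lambda>x. (norm (proj L x))\<^sup>2) L"
  let ?c1 = "\<lambda>n. polyhedral.coef (J n) (P n) (\<lambda>_. 1) L"
  have F: "(\<integral>s. indicator (par_along L (P n) r) s * (norm (proj L s))\<^sup>2 \<partial>lborel)
     = (\<Sum>j\<le>dim L + 2. ((if j \<le> dim L then ?cq n j else 0) + (if 2 \<le> j then (2 * real (dim L + 1) / real (j - 2 + 2) - 1) * ?c1 n (j - 2) else 0)) * r ^ j)"
    if r: "0 < r" for n r
  proof -
    have t: "(\<Sum>j\<le>DIM('a). (2 * real (dim L + 1) / real (j + 2) - 1) * ?c1 n j * r ^ (j + 2))
      = (\<Sum>j\<le>dim L. (2 * real (dim L + 1) / real (j + 2) - 1) * ?c1 n j * r ^ (j + 2))"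
      using polyhedral.coef_truncate[OF JP(1)[of n] L, of "\<lambda>_. 1" "\<lambda>j. (2 * real (dim L + 1) / real (j + 2) - 1) * r ^ (j + 2)"]
      by (simp add: mult_ac)
    show ?thesis
      unfolding polyhedral.moment_coef(2)[OF JP(1) L r] t polyhedral.coef_truncate[OF JP(1) L]
      by (rule sum_shift2)
  qed
  have G: "(\<integral>s. indicator (par_along L (P n) r) s * 1 \<partial>lborel) = (\<Sum>j\<le>dim L. ?c1 n j * r ^ j)" if r: "0 < r" for n r
    unfolding measure_par_eq[OF cP L] polyhedral.volume_coef[OF JP(1) L r] by (rule polyhedral.coef_truncate[OF JP(1) L])
  obtain c where c: "\<And>r. 0 < r \<Longrightarrow> (\<integral>s. indicator (par_along L K r) s * (norm (proj L s))\<^sup>2 \<partial>lborel) = (\<Sum>j\<le>dim L + 2. c j * r ^ j)"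
    by (rule poly_limit[OF F integral_par_approx[OF K(1) L locally_bounded_moments(2) cP JP(2,3)]]) blast+
  obtain w where w: "\<And>r. 0 < r \<Longrightarrow> (\<integral>s. indicator (par_along L K r) s * 1 \<partial>lborel) = (\<Sum>j\<le>dim L. w j * r ^ j)"
    by (rule poly_limit[OF G integral_par_approx[OF K(1) L locally_bounded_moments(3) cP JP(2,3)]]) blast+
  show thesis
  proof (rule that)
    fix r :: real assume r: "0 \<le> r"
    show "(\<integral>s. indicator (par_along L K r) s * (norm (proj L s))\<^sup>2 \<partial>lborel) = (\<Sum>j\<le>dim L + 2. c j * r ^ j)"
      by (rule poly_extend_0[OF c integral_par_at_0[OF K(1) L locally_bounded_moments(2)] r])
    have "(\<integral>s. indicator (par_along L K r) s * 1 \<partial>lborel) = (\<Sum>j\<le>dim L. w j * r ^ j)"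
      by (rule poly_extend_0[OF w integral_par_at_0[OF K(1) L locally_bounded_moments(3)] r])
    then show "measure lborel (par_along L K r) = (\<Sum>j\<le>dim L. w j * r ^ j)" unfolding measure_par_eq[OF K(1) L] .
  qed
qed

section \<open>Averages over the Grassmannian for general convex bodies\<close>

context haar
begin

lemma measurable_par_integral:
  fixes K :: "'a set"
  assumes K: "compact K" and [measurable]: "\<psi> \<in> borel_measurable borel"
  shows "(\<lambda>L. \<integral>s. indicator (par_along L K r) s * \<psi> s \<partial>lborel :: real) \<in> borel_measurable \<nu>"
proof -
  define X where "X = {w \<in> space (grass_space k \<Otimes>\<^sub>M borel). snd w \<in> par_along (fst w) K r}"
  have [measurable]: "X \<in> sets (grass_space k \<Otimes>\<^sub>M borel)" unfolding X_def by (rule sets_par_along_pair[OF K])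
  have "(\<lambda>(L, s). indicator X (L, s) * \<psi> s) \<in> borel_measurable (\<nu> \<Otimes>\<^sub>M lborel)" by measurable
  then have "(\<lambda>L. \<integral>s. indicator X (L, s) * \<psi> s \<partial>lborel) \<in> borel_measurable \<nu>"
    by (rule lborel.borel_measurable_lebesgue_integral)
  then show ?thesis
    by (rule measurable_cong[THEN iffD1, rotated])
      (auto simp: X_def space_pair_measure indicator_def intro!: Bochner_Integration.integral_cong)
qed

lemma par_integral_bound:
  fixes Y :: "'a set"
  assumes Y: "Y \<subseteq> cball 0 R" "Y \<in> sets borel"
  shows "\<bar>\<integral>s. indicator Y s * (norm s)\<^sup>2 \<partial>lborel\<bar> \<le> (\<integral>s. R\<^sup>2 * indicator (cball (0::'a) R) s \<partial>lborel)"
proof -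
  note [measurable] = Y(2)
  have b: "\<bar>indicator Y s * (norm s)\<^sup>2\<bar> \<le> R\<^sup>2 * indicator (cball 0 R) s" for s
    using Y(1) by (auto simp: indicator_def intro: power_mono)
  have "integrable lborel (\<lambda>s. indicator Y s * (norm s)\<^sup>2)"
    by (rule integrable_cball_bound[OF _ b]) measurable
  moreover have "integrable lborel (\<lambda>s::'a. R\<^sup>2 * indicator (cball 0 R) s :: real)"
    using emeasure_lborel_cball_finite[of "0::'a" R] by (intro integrable_mult_right integrable_real_indicator) auto
  ultimately have "(\<integral>s. \<bar>indicator Y s * (norm s)\<^sup>2\<bar> \<partial>lborel) \<le> (\<integral>s. R\<^sup>2 * indicator (cball (0::'a) R) s \<partial>lborel)"
    by (intro integral_mono b) auto
  then have "norm (\<integral>s. indicator Y s * (norm s)\<^sup>2 \<partial>lborel) \<le> (\<integral>s. R\<^sup>2 * indicator (cball (0::'a) R) s \<partial>lborel)"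
    using integral_norm_bound[of lborel "\<lambda>s. indicator Y s * (norm s)\<^sup>2"] by simp
  then show ?thesis by simp
qed

lemma average_par_limit:
  fixes K :: "'a set" and P :: "nat \<Rightarrow> 'a set"
  assumes K: "compact K" and P: "\<And>n. compact (P n)" and R: "\<And>n L. subspace L \<Longrightarrow> par_along L (P n) (\<rho> n) \<subseteq> cball 0 R"
    and lim: "\<And>L. subspace L \<Longrightarrow> (\<lambda>n. \<integral>s. indicator (par_along L (P n) (\<rho> n)) s * (norm s)\<^sup>2 \<partial>lborel) \<longlonglongrightarrow> (\<integral>s. indicator (par_along L K r) s * (norm s)\<^sup>2 \<partial>lborel)"
  shows "(\<lambda>n. \<integral>L. (\<integral>s. indicator (par_along L (P n) (\<rho> n)) s * (norm s)\<^sup>2 \<partial>lborel) \<partial>\<nu>)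
    \<longlonglongrightarrow> (\<integral>L. (\<integral>s. indicator (par_along L K r) s * (norm s)\<^sup>2 \<partial>lborel) \<partial>\<nu>)"
proof (rule integral_dominated_convergence[where w = "\<lambda>_. \<integral>s. R\<^sup>2 * indicator (cball (0::'a) R) s \<partial>lborel"])
  show "AE L in \<nu>. (\<lambda>n. \<integral>s. indicator (par_along L (P n) (\<rho> n)) s * (norm s)\<^sup>2 \<partial>lborel) \<longlonglongrightarrow> (\<integral>s. indicator (par_along L K r) s * (norm s)\<^sup>2 \<partial>lborel)"
    by (intro AE_I2 lim) (simp add: grass_def)
  show "AE L in \<nu>. norm (\<integral>s. indicator (par_along L (P n) (\<rho> n)) s * (norm s)\<^sup>2 \<partial>lborel) \<le> (\<integral>s. R\<^sup>2 * indicator (cball (0::'a) R) s \<partial>lborel)" for n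
  proof (rule AE_I2)
    fix L assume "L \<in> space \<nu>"
    then have L: "subspace L" by (simp add: grass_def)
    show "norm (\<integral>s. indicator (par_along L (P n) (\<rho> n)) s * (norm s)\<^sup>2 \<partial>lborel) \<le> (\<integral>s. R\<^sup>2 * indicator (cball (0::'a) R) s \<partial>lborel)"
      using par_integral_bound[OF R[OF L] borel_par_along[OF P L]] by simp
  qed
qed (auto intro!: measurable_par_integral K P)

text \<open>Real form of \<open>fold_factor\<close>, continued by \<open>0\<close> beyond
  \<open>DIM('a)\<close>, where no face has such a codimension.\<close>

definition ratio :: "nat \<Rightarrow> real" where
  "ratio j = (if j \<le> DIM('a) then enn2real (fold_factor \<nu> j) else 0)"

text \<open>Degree \<open>j\<close> of the averaged moment contains \<open>ratio j\<close> times the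
  face sum for the squared norm of the nearest point, plus the shifted volume term for dimension
  \<open>k\<close>, scaled by \<open>ratio (j - 2)\<close>. Eliminating the face sum through the
  coefficient of the full parallel body subtracts the shifted term for dimension
  \<open>DIM('a)\<close>, scaled by \<open>ratio j\<close>.\<close>

definition correction :: "nat \<Rightarrow> real" where
  "correction j = (2 * real (k + 1) / real j - 1) * ratio (j - 2) - ratio j * (2 * real (DIM('a) + 1) / real j - 1)"

lemma ratio_eq_0: "k < j \<Longrightarrow> ratio j = 0"
  by (simp add: ratio_def fold_factor_eq_0)

lemma correction_eq_0: "k + 2 < j \<Longrightarrow> correction j = 0"
  by (simp add: correction_def ratio_eq_0)

text \<open>For each approximating polytope the relation is linear in the coefficients, with factors
  independent of the polytope; convergence of the coefficients carries it over to
  \<open>K\<close>.\<close>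

theorem average_coefficients:
  fixes K :: "'a set"
  assumes K: "compact K" "convex K" "K \<noteq> {}"
  obtains v w i where
    "\<And>r. 0 \<le> r \<Longrightarrow> (\<integral>s. indicator (par_along UNIV K r) s * (norm s)\<^sup>2 \<partial>lborel) = (\<Sum>j\<le>DIM('a) + 2. v j * r ^ j)"
    "\<And>r. 0 \<le> r \<Longrightarrow> measure lborel (par_along UNIV K r) = (\<Sum>j\<le>DIM('a). w j * r ^ j)"
    "\<And>r. 0 \<le> r \<Longrightarrow> (\<integral>L. (\<integral>s. indicator (par_along L K r) s * (norm s)\<^sup>2 \<partial>lborel) \<partial>\<nu>) = (\<Sum>j\<le>DIM('a) + 2. i j * r ^ j)"
    "\<And>j. j \<le> DIM('a) + 2 \<Longrightarrow> i j = ratio j * v j + (if 2 \<le> j then correction j * w (j - 2) else 0)"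
proof -
  obtain J P where JP: "\<And>n::nat. polyhedral (J n) (P n)" "\<And>n. K \<subseteq> P n"
    "\<And>n x. x \<in> P n \<Longrightarrow> \<exists>y\<in>K. norm (x - y) \<le> inverse (real (Suc n))"
    using polyhedral_sequence[OF K] by blast
  have cP: "compact (P n)" for n using polyhedral.compact_P[OF JP(1)] .
  have ph: "polyhedral_haar (J n) (P n) \<nu> k" for n by (intro polyhedral_haar.intro JP(1) haar_axioms)
  obtain R where R: "R > 0" "\<And>x. x \<in> K \<Longrightarrow> norm x \<le> R" using compact_imp_bounded[OF K(1)] bounded_pos by blast
  have RP: "norm x \<le> R + 1" if x: "x \<in> P n" for x n
  proof -
    obtain y where y: "y \<in> K" "norm (x - y) \<le> inverse (real (Suc n))" using JP(3)[OF x] by blast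
    have "inverse (real (Suc n)) \<le> 1" by (simp add: inverse_le_1_iff)
    then show ?thesis using y R(2)[OF y(1)] norm_triangle_sub[of x y] by linarith
  qed
  have Rpar: "par_along L Q r \<subseteq> cball 0 (R + 1 + r)" if Q: "\<And>x. x \<in> Q \<Longrightarrow> norm x \<le> R + 1" for L Q r
  proof
    fix s assume "s \<in> par_along L Q r"
    then obtain x where x: "x \<in> Q" "norm (s - x) \<le> r" by (auto simp: par_along_def)
    then show "s \<in> cball 0 (R + 1 + r)" using Q[OF x(1)] norm_triangle_sub[of s x] by simp
  qed
  let ?a = "\<lambda>n. polyhedral.coef (J n) (P n) (\<lambda>x. (norm x)\<^sup>2) UNIV"
  let ?b = "\<lambda>n. polyhedral.coef (J n) (P n) (\<lambda>_. 1) UNIV"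
  let ?f = "\<lambda>j. enn2real (fold_factor \<nu> j)"
  let ?v = "\<lambda>n j. (if j \<le> DIM('a) then ?a n j else 0) + (if 2 \<le> j then (2 * real (DIM('a) + 1) / real (j - 2 + 2) - 1) * ?b n (j - 2) else 0)"
  let ?i = "\<lambda>n j. (if j \<le> DIM('a) then ?f j * ?a n j else 0) + (if 2 \<le> j then (2 * real (k + 1) / real (j - 2 + 2) - 1) * (?f (j - 2) * ?b n (j - 2)) else 0)"
  have V: "(\<integral>s. indicator (par_along UNIV (P n) r) s * (norm s)\<^sup>2 \<partial>lborel) = (\<Sum>j\<le>DIM('a) + 2. ?v n j * r ^ j)" if r: "0 < r" for n r
    unfolding polyhedral.moment_coef(1)[OF JP(1) subspace_UNIV r] dim_UNIV by (rule sum_shift2)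
  have I: "(\<integral>L. (\<integral>s. indicator (par_along L (P n) r) s * (norm s)\<^sup>2 \<partial>lborel) \<partial>\<nu>) = (\<Sum>j\<le>DIM('a) + 2. ?i n j * r ^ j)" if r: "0 < r" for n r
    unfolding polyhedral_haar.average_moment[OF ph r] by (rule sum_shift2)
  have W: "(\<integral>s. indicator (par_along UNIV (P n) r) s * 1 \<partial>lborel) = (\<Sum>j\<le>DIM('a). ?b n j * r ^ j)" if r: "0 < r" for n r
    unfolding measure_par_eq[OF cP subspace_UNIV] by (rule polyhedral.volume_coef[OF JP(1) subspace_UNIV r])
  have Vl: "(\<lambda>n. \<integral>s. indicator (par_along L (P n) r) s * (norm s)\<^sup>2 \<partial>lborel) \<longlonglongrightarrow> (\<integral>s. indicator (par_along L K r) s * (norm s)\<^sup>2 \<partial>lborel)"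
    if "subspace L" for L r
    by (rule integral_par_approx[OF K(1) that locally_bounded_moments(1) cP JP(2,3)])
  have Il: "(\<lambda>n. \<integral>L. (\<integral>s. indicator (par_along L (P n) r) s * (norm s)\<^sup>2 \<partial>lborel) \<partial>\<nu>)
    \<longlonglongrightarrow> (\<integral>L. (\<integral>s. indicator (par_along L K r) s * (norm s)\<^sup>2 \<partial>lborel) \<partial>\<nu>)" for r
    by (rule average_par_limit[OF K(1) cP Rpar Vl]) (use RP in auto)
  have Wl: "(\<lambda>n. \<integral>s. indicator (par_along UNIV (P n) r) s * 1 \<partial>lborel) \<longlonglongrightarrow> (\<integral>s. indicator (par_along UNIV K r) s * (1::real) \<partial>lborel)" for r
    by (rule integral_par_approx[OF K(1) subspace_UNIV locally_bounded_moments(3) cP JP(2,3)])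
  obtain v where v: "\<And>r. 0 < r \<Longrightarrow> (\<integral>s. indicator (par_along UNIV K r) s * (norm s)\<^sup>2 \<partial>lborel) = (\<Sum>j\<le>DIM('a) + 2. v j * r ^ j)"
    "\<And>j. j \<le> DIM('a) + 2 \<Longrightarrow> (\<lambda>n. ?v n j) \<longlonglongrightarrow> v j"
    using poly_limit[OF V Vl[OF subspace_UNIV]] by blast
  obtain w where w: "\<And>r. 0 < r \<Longrightarrow> (\<integral>s. indicator (par_along UNIV K r) s * 1 \<partial>lborel) = (\<Sum>j\<le>DIM('a). w j * r ^ j)"
    "\<And>j. j \<le> DIM('a) \<Longrightarrow> (\<lambda>n. ?b n j) \<longlonglongrightarrow> w j"
    using poly_limit[OF W Wl] by blast
  obtain i where i: "\<And>r. 0 < r \<Longrightarrow> (\<integral>L. (\<integral>s. indicator (par_along L K r) s * (norm s)\<^sup>2 \<partial>lborel) \<partial>\<nu>) = (\<Sum>j\<le>DIM('a) + 2. i j * r ^ j)"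
    "\<And>j. j \<le> DIM('a) + 2 \<Longrightarrow> (\<lambda>n. ?i n j) \<longlonglongrightarrow> i j"
    using poly_limit[OF I Il] by blast
  have I0: "(\<lambda>n. \<integral>L. (\<integral>s. indicator (par_along L K (inverse (real (Suc n)))) s * (norm s)\<^sup>2 \<partial>lborel) \<partial>\<nu>)
    \<longlonglongrightarrow> (\<integral>L. (\<integral>s. indicator (par_along L K 0) s * (norm s)\<^sup>2 \<partial>lborel) \<partial>\<nu>)"
  \<comment> \<open>Here the body is fixed and the radii tend to \<open>0\<close>, all bounded by
    \<open>1\<close>.\<close>
  proof (rule average_par_limit[OF K(1) K(1), where R = "R + 1 + 1"])
    show "par_along L K (inverse (real (Suc n))) \<subseteq> cball 0 (R + 1 + 1)" for n L
    proof -
      have "inverse (real (Suc n)) \<le> 1" by (simp add: inverse_le_1_iff)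
      then have "par_along L K (inverse (real (Suc n))) \<subseteq> par_along L K 1" by (force simp: par_along_def)
      also have "\<dots> \<subseteq> cball 0 (R + 1 + 1)" by (rule Rpar) (use R(2) in force)
      finally show ?thesis .
    qed
  qed (rule integral_par_at_0[OF K(1) _ locally_bounded_moments(1)])
  show thesis
  proof (rule that)
    fix r :: real assume r: "0 \<le> r"
    show "(\<integral>s. indicator (par_along UNIV K r) s * (norm s)\<^sup>2 \<partial>lborel) = (\<Sum>j\<le>DIM('a) + 2. v j * r ^ j)"
      by (rule poly_extend_0[OF v(1) integral_par_at_0[OF K(1) subspace_UNIV locally_bounded_moments(1)] r])
    have "(\<integral>s. indicator (par_along UNIV K r) s * 1 \<partial>lborel) = (\<Sum>j\<le>DIM('a). w j * r ^ j)"
      by (rule poly_extend_0[OF w(1) integral_par_at_0[OF K(1) subspace_UNIV locally_bounded_moments(3)] r])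
    then show "measure lborel (par_along UNIV K r) = (\<Sum>j\<le>DIM('a). w j * r ^ j)" unfolding measure_par_eq[OF K(1) subspace_UNIV] .
    show "(\<integral>L. (\<integral>s. indicator (par_along L K r) s * (norm s)\<^sup>2 \<partial>lborel) \<partial>\<nu>) = (\<Sum>j\<le>DIM('a) + 2. i j * r ^ j)"
      by (rule poly_extend_0[OF i(1) I0 r])
  next
    fix j assume j: "j \<le> DIM('a) + 2"
    have rel: "?i n j = ratio j * ?v n j + (if 2 \<le> j then correction j * ?b n (j - 2) else 0)" for n
    proof (cases "2 \<le> j")
      case True
      then have "j - 2 + 2 = j" "j - 2 \<le> DIM('a)" using j by auto
      then show ?thesis using True by (simp add: ratio_def correction_def algebra_simps)
    qed (simp add: ratio_def)
    have "(\<lambda>n. ?i n j) \<longlonglongrightarrow> ratio j * v j + (if 2 \<le> j then correction j * w (j - 2) else 0)"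
    proof (cases "2 \<le> j")
      case True
      have "(\<lambda>n. ratio j * ?v n j + correction j * ?b n (j - 2)) \<longlonglongrightarrow> ratio j * v j + correction j * w (j - 2)"
        by (intro tendsto_add tendsto_mult tendsto_const v(2) w(2)) (use j in auto)
      then show ?thesis unfolding rel using True by (simp only: if_True)
    next
      case False
      have "(\<lambda>n. ratio j * ?v n j + 0) \<longlonglongrightarrow> ratio j * v j + 0"
        by (intro tendsto_add tendsto_mult tendsto_const v(2) j)
      then show ?thesis unfolding rel using False by (simp only: if_False)
    qed
    then show "i j = ratio j * v j + (if 2 \<le> j then correction j * w (j - 2) else 0)"
      using i(2)[OF j] LIMSEQ_unique by blast
  qed
qed

end

section \<open>Integrals over the fibres\<close>

lemma convex_par_along: "convex K \<Longrightarrow> subspace L \<Longrightarrow> convex (par_along L K \<epsilon>)"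
  unfolding par_along_image
  using subspace_imp_convex[of L]
  by (intro convex_linear_image convex_Times convex_Int convex_cball) (auto intro!: linearI simp: algebra_simps)

text \<open>The unit ball contains a coordinate cube. Positivity is what allows division by this
  mass in the fibre argument.\<close>

lemma lebesgue_subspace_cball_pos:
  assumes S: "subspace S" shows "emeasure (lebesgue_subspace S) (cball 0 1) \<noteq> 0"
proof -
  let ?n = "dim S"
  \<comment> \<open>Half the side of the cube: the squared norm of its points is at most
    \<open>?n\<close> times the square of \<open>a\<close>, which is below \<open>1\<close>.\<close>
  define a where "a = inverse (real (Suc ?n))"
  have a: "0 < a" by (simp add: a_def)
  have "emeasure (coord_space ?n) (Pi\<^sub>E {..<?n} (\<lambda>_. {-a..a})) \<le> emeasure (coord_space ?n) (emb S -` cball 0 1 \<inter> space (coord_space ?n))"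
  proof (rule emeasure_mono)
    show "Pi\<^sub>E {..<?n} (\<lambda>_. {-a..a}) \<subseteq> emb S -` cball 0 1 \<inter> space (coord_space ?n)"
    proof
      fix t assume t: "t \<in> Pi\<^sub>E {..<?n} (\<lambda>_. {-a..a})"
      have "(norm (emb S t))\<^sup>2 = (\<Sum>i<?n. (t i)\<^sup>2)" by (rule norm_emb[OF S])
      also have "\<dots> \<le> (\<Sum>i<?n. a\<^sup>2)"
      proof (rule sum_mono)
        fix i assume "i \<in> {..<?n}"
        then have "- a \<le> t i" "t i \<le> a" using t by (auto simp: PiE_iff)
        then have "\<bar>t i\<bar> \<le> \<bar>a\<bar>" using a by linarith
        then show "(t i)\<^sup>2 \<le> a\<^sup>2" by (simp add: abs_le_square_iff)
      qed
      also have "\<dots> = (real ?n * a) * a" by (simp add: power2_eq_square)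
      also have "\<dots> \<le> 1 * 1" using a by (intro mult_mono) (auto simp: a_def field_simps)
      finally have "(norm (emb S t))\<^sup>2 \<le> 1\<^sup>2" by simp
      then have "norm (emb S t) \<le> 1" by (rule power2_le_imp_le) simp
      then show "t \<in> emb S -` cball 0 1 \<inter> space (coord_space ?n)" using t by (auto simp: space_PiM PiE_iff)
    qed
    have "emb S -` cball 0 1 \<inter> space (coord_space ?n) \<in> sets (coord_space ?n)" by (rule measurable_sets[OF measurable_emb]) simp
    then show "emb S -` cball 0 1 \<inter> space (coord_space ?n) \<in> sets (coord_space ?n)" .
  qed
  moreover have "emeasure (coord_space ?n) (Pi\<^sub>E {..<?n} (\<lambda>_. {-a..a})) = (\<Prod>i<?n. emeasure lborel {-a..a})"
    by (rule lborel_prod.emeasure_PiM) auto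
  moreover have "(\<Prod>i<?n. emeasure lborel {-a..a}) \<noteq> 0" using a by simp
  moreover have "emeasure (lebesgue_subspace S) (cball 0 1) = emeasure (coord_space ?n) (emb S -` cball 0 1 \<inter> space (coord_space ?n))"
    unfolding lebesgue_subspace_emb by (subst emeasure_distr) auto
  ultimately show ?thesis by (metis le_zero_eq)
qed

text \<open>The fibre integral is compared with the full-dimensional body \<open>M + (L\<^sup>\<bottom> \<inter> cball 0 1)\<close>,
  where \<open>M\<close> is the fibre moved into \<open>L\<close>.\<close>

lemma fibre_polynomial_perp:
  fixes K L :: "'a::euclidean_space set"
  assumes K: "compact K" "convex K" and L: "subspace L" and y: "y \<in> L\<^sup>\<bottom>"
  obtains c where "\<And>r. 0 \<le> r \<Longrightarrow> (\<integral>x. indicator (par_along L K r) (x + y) * (norm (x + y))\<^sup>2 \<partial>lebesgue_subspace L) = (\<Sum>j\<le>dim L + 2. c j * r ^ j)"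
proof -
  have L': "subspace (L\<^sup>\<bottom>)" by (rule subspace_orthogonal_comp)
  have Lperp: "u = 0" if "u \<in> L" "u \<in> L\<^sup>\<bottom>" for u using that proj_id[OF L that(1)] by (simp add: orth_comp_mem[OF L])
  define M where "M = L \<inter> (\<lambda>z. z + y) -` K"
  have Meq: "M = L \<inter> (\<lambda>z. - y + z) ` K"
  proof -
    have "(\<lambda>z. z + y) -` K = (\<lambda>z. - y + z) ` K" by (force simp: image_iff)
    then show ?thesis by (simp add: M_def)
  qed
  have M: "compact M" "convex M"
    unfolding Meq
    by (rule closed_Int_compact[OF closed_subspace[OF L] compact_translation[OF K(1)]],
        rule convex_Int[OF subspace_imp_convex[OF L] convex_translation[OF K(2)]])
  have parM: "x + y \<in> par_along L K r \<longleftrightarrow> x \<in> par_along L M r" if x: "x \<in> L" for x r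
  proof
    assume "x + y \<in> par_along L K r"
    then obtain z where z: "z \<in> K" "x + y - z \<in> L" "norm (x + y - z) \<le> r" by (auto simp: par_along_def)
    have "z - y \<in> L" using subspace_diff[OF L x z(2)] by simp
    then have "z - y \<in> M" using z(1) by (simp add: M_def)
    then show "x \<in> par_along L M r" using z by (auto simp: par_along_def algebra_simps intro!: bexI[of _ "z - y"])
  next
    assume "x \<in> par_along L M r"
    then obtain z where z: "z \<in> M" "x - z \<in> L" "norm (x - z) \<le> r" by (auto simp: par_along_def)
    then show "x + y \<in> par_along L K r" by (auto simp: par_along_def M_def intro!: bexI[of _ "z + y"])
  qed
  have nrm: "(norm (x + y'))\<^sup>2 = (norm x)\<^sup>2 + (norm y')\<^sup>2" if "x \<in> L" "y' \<in> L\<^sup>\<bottom>" for x y'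
    using that by (intro norm_add_Pythagorean) (auto simp: orthogonal_comp_def)
  note AEL = AE_lebesgue_subspace[OF L] and AEL' = AE_lebesgue_subspace[OF L']
  let ?f = "\<lambda>r. \<integral>x. indicator (par_along L K r) (x + y) * (norm (x + y))\<^sup>2 \<partial>lebesgue_subspace L"
  have [measurable]: "par_along L K r \<in> sets borel" for r using K(1) L by (rule borel_par_along)
  show thesis
  proof (cases "M = {}")
    case True
    have "?f r = 0" for r
    proof -
      have emp: "par_along L M r = {}" using True by (simp add: par_along_def)
      have "?f r = (\<integral>x. 0 \<partial>lebesgue_subspace L)"
      proof (rule integral_cong_AE)
        show "AE x in lebesgue_subspace L. indicator (par_along L K r) (x + y) * (norm (x + y))\<^sup>2 = (0::real)"
          using AEL by eventually_elim (simp add: parM emp)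
      qed measurable
      then show ?thesis by simp
    qed
    then show thesis by (intro that[of "\<lambda>_. 0"]) simp
  next
    case False
    define K' where "K' = par_along (L\<^sup>\<bottom>) M 1"
    have K': "compact K'" "convex K'" using M L' by (auto simp: K'_def compact_par_along convex_par_along)
    have MK': "M \<subseteq> K'" using subspace_0[OF L'] by (force simp: K'_def par_along_def)
    have K'ne: "K' \<noteq> {}" using MK' False by blast
    have [measurable]: "par_along L K' r \<in> sets borel" for r using K'(1) L by (rule borel_par_along)
    \<comment> \<open>\<open>K'\<close> is the product of \<open>M\<close> with the unit ball of the
      complement, and taking parallel sets along \<open>L\<close> acts only on the first
      factor.\<close>
    have parK': "x + y' \<in> par_along L K' r \<longleftrightarrow> x \<in> par_along L M r \<and> norm y' \<le> 1" if x: "x \<in> L" and y': "y' \<in> L\<^sup>\<bottom>" for x y' r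
    proof
      assume "x + y' \<in> par_along L K' r"
      then obtain q z where z: "z \<in> M" "q - z \<in> L\<^sup>\<bottom>" "norm (q - z) \<le> 1" "x + y' - q \<in> L" "norm (x + y' - q) \<le> r"
        by (auto simp: par_along_def K'_def)
      have zL: "z \<in> L" using z(1) by (simp add: M_def)
      have e: "y' - (q - z) = (x + y' - q) - (x - z)" by simp
      have "y' - (q - z) \<in> L" unfolding e by (intro subspace_diff L z x zL)
      moreover have "y' - (q - z) \<in> L\<^sup>\<bottom>" by (intro subspace_diff L' y' z)
      ultimately have "y' - (q - z) = 0" by (rule Lperp)
      then have yq: "y' = q - z" by simp
      have "norm (x - z) \<le> r" using z(5) unfolding yq by simp
      then show "x \<in> par_along L M r \<and> norm y' \<le> 1"
        using z yq subspace_diff[OF L x zL] by (auto simp: par_along_def)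
    next
      assume "x \<in> par_along L M r \<and> norm y' \<le> 1"
      then obtain z where z: "z \<in> M" "x - z \<in> L" "norm (x - z) \<le> r" "norm y' \<le> 1" by (auto simp: par_along_def)
      have "z + y' \<in> K'" using z y' by (auto simp: K'_def par_along_def intro!: bexI[of _ z])
      then show "x + y' \<in> par_along L K' r" using z by (auto simp: par_along_def intro!: bexI[of _ "z + y'"])
    qed
    obtain c w where cw: "\<And>r. 0 \<le> r \<Longrightarrow> (\<integral>s. indicator (par_along L K' r) s * (norm (proj L s))\<^sup>2 \<partial>lborel) = (\<Sum>j\<le>dim L + 2. c j * r ^ j)"
      "\<And>r. 0 \<le> r \<Longrightarrow> measure lborel (par_along L K' r) = (\<Sum>j\<le>dim L. w j * r ^ j)"
      by (rule par_polynomials[OF K' K'ne L]) blast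
    obtain R where R: "\<And>r. par_along L K' r \<subseteq> cball 0 (R + r)"
    proof -
      interpret convex_along L K' by unfold_locales (auto simp: K' L)
      show thesis using radius that by metis
    qed
    let ?m' = "emeasure (lebesgue_subspace (L\<^sup>\<bottom>)) (cball 0 1)"
    let ?c0 = "split_const TYPE('a) (dim L)"
    \<comment> \<open>At offset \<open>y\<close> the squared norm is that of the component in
      \<open>L\<close> plus that of \<open>y\<close>. Expressed through \<open>proj L\<close>, it
      becomes a function on the full-dimensional body.\<close>
    let ?u = "\<lambda>r s. indicator (par_along L K' r) s * ((norm (proj L s))\<^sup>2 + (norm y)\<^sup>2) :: real"
    let ?h = "\<lambda>r x. indicator (par_along L K r) (x + y) * (norm (x + y))\<^sup>2 :: real"
    have [measurable]: "proj L \<in> borel_measurable borel" by (intro borel_measurable_linear linear_proj)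
    \<comment> \<open>Every offset in the unit ball of the complement sees the same fibre integral,
      so splitting the full integral along \<open>L\<close> produces it times the mass of that
      ball.\<close>
    have key: "?m' * (\<integral>\<^sup>+x. ennreal (?h r x) \<partial>lebesgue_subspace L) = ?c0 * (\<integral>\<^sup>+s. ennreal (?u r s) \<partial>lborel)" for r
    proof -
      have "?c0 * (\<integral>\<^sup>+s. ennreal (?u r s) \<partial>lborel) = (\<integral>\<^sup>+y'. (\<integral>\<^sup>+x. ennreal (?u r (x + y')) \<partial>lebesgue_subspace L) \<partial>lebesgue_subspace (L\<^sup>\<bottom>))"
        by (rule nn_integral_split(1)[OF L, symmetric]) measurable
      also have "\<dots> = (\<integral>\<^sup>+y'. indicator (cball 0 1) y' * (\<integral>\<^sup>+x. ennreal (?h r x) \<partial>lebesgue_subspace L) \<partial>lebesgue_subspace (L\<^sup>\<bottom>))"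
      proof (rule nn_integral_cong_AE)
        show "AE y' in lebesgue_subspace (L\<^sup>\<bottom>). (\<integral>\<^sup>+x. ennreal (?u r (x + y')) \<partial>lebesgue_subspace L)
          = indicator (cball 0 1) y' * (\<integral>\<^sup>+x. ennreal (?h r x) \<partial>lebesgue_subspace L)"
          using AEL'
        proof eventually_elim
          case (elim y')
          have "(\<integral>\<^sup>+x. ennreal (?u r (x + y')) \<partial>lebesgue_subspace L) = (\<integral>\<^sup>+x. indicator (cball 0 1) y' * ennreal (?h r x) \<partial>lebesgue_subspace L)"
          proof (rule nn_integral_cong_AE)
            show "AE x in lebesgue_subspace L. ennreal (?u r (x + y')) = indicator (cball 0 1) y' * ennreal (?h r x)"
              using AEL
            proof eventually_elim
              case (elim x)
              have "proj L (x + y') = x" using elim \<open>y' \<in> L\<^sup>\<bottom>\<close> by (simp add: proj_add proj_id[OF L] orth_comp_mem[OF L])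
              then show ?case using parK'[OF elim \<open>y' \<in> L\<^sup>\<bottom>\<close>, of r] parM[OF elim, of r] nrm[OF elim y]
                by (auto simp: indicator_def)
            qed
          qed
          also have "\<dots> = indicator (cball 0 1) y' * (\<integral>\<^sup>+x. ennreal (?h r x) \<partial>lebesgue_subspace L)"
            by (rule nn_integral_cmult) measurable
          finally show ?case .
        qed
      qed
      also have "\<dots> = ?m' * (\<integral>\<^sup>+x. ennreal (?h r x) \<partial>lebesgue_subspace L)"
        by (subst nn_integral_multc) (auto intro!: borel_measurable_indicator)
      finally show ?thesis by simp
    qed
    define C where "C = enn2real ?c0 / enn2real ?m'"
    \<comment> \<open>The mass is positive and finite, so it can be divided out.\<close>
    have m': "enn2real ?m' \<noteq> 0"
      using lebesgue_subspace_cball_pos[OF L'] lebesgue_subspace_cball_finite[OF L', of 1]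
      by (auto simp: enn2real_eq_0_iff)
    have f: "?f r = C * (\<Sum>j\<le>dim L + 2. (c j + (if j \<le> dim L then (norm y)\<^sup>2 * w j else 0)) * r ^ j)" if r: "0 \<le> r" for r
    proof -
      have "enn2real ?m' * ?f r = enn2real (?m' * (\<integral>\<^sup>+x. ennreal (?h r x) \<partial>lebesgue_subspace L))"
        by (subst integral_eq_nn_integral) (auto simp: enn2real_mult)
      also have "\<dots> = enn2real ?c0 * (\<integral>s. ?u r s \<partial>lborel)"
        unfolding key by (subst integral_eq_nn_integral) (auto simp: enn2real_mult)
      also have "(\<integral>s. ?u r s \<partial>lborel) = (\<integral>s. indicator (par_along L K' r) s * (norm (proj L s))\<^sup>2 + (norm y)\<^sup>2 * indicator (par_along L K' r) s \<partial>lborel)"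
        by (intro Bochner_Integration.integral_cong) (auto simp: algebra_simps)
      also have "\<dots> = (\<integral>s. indicator (par_along L K' r) s * (norm (proj L s))\<^sup>2 \<partial>lborel) + (norm y)\<^sup>2 * measure lborel (par_along L K' r)"
      proof -
        have i2: "integrable lborel (indicator (par_along L K' r) :: 'a \<Rightarrow> real)"
          using emeasure_compact_finite[OF compact_par_along[OF K'(1) L, of r]] by (intro integrable_real_indicator) auto
        have i1: "integrable lborel (\<lambda>s. indicator (par_along L K' r) s * (norm (proj L s))\<^sup>2 :: real)"
        proof (rule integrable_cball_bound[of _ "(R + r)\<^sup>2" "R + r"])
          fix s
          show "\<bar>indicator (par_along L K' r) s * (norm (proj L s))\<^sup>2\<bar> \<le> (R + r)\<^sup>2 * indicator (cball 0 (R + r)) s"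
          proof (cases "s \<in> par_along L K' r")
            case True
            then have s: "norm s \<le> R + r" using R[of r] by auto
            then have "norm (proj L s) \<le> R + r" using norm_proj_le[OF L, of s] by linarith
            then show ?thesis using True s by (simp add: power_mono)
          qed simp
        qed measurable
        show ?thesis using i1 i2 by simp
      qed
      also have "\<dots> = (\<Sum>j\<le>dim L + 2. (c j + (if j \<le> dim L then (norm y)\<^sup>2 * w j else 0)) * r ^ j)"
      proof -
        have "(\<Sum>j\<le>dim L + 2. (if j \<le> dim L then (norm y)\<^sup>2 * w j else 0) * r ^ j) = (\<Sum>j\<le>dim L. (norm y)\<^sup>2 * w j * r ^ j)"
          by (intro sum.mono_neutral_cong_right) auto
        then show ?thesis using cw[OF r] by (simp add: distrib_right sum.distrib sum_distrib_left mult.assoc)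
      qed
      finally show ?thesis using m' by (simp add: C_def field_simps)
    qed
    show thesis
      by (rule that[of "\<lambda>j. C * (c j + (if j \<le> dim L then (norm y)\<^sup>2 * w j else 0))"])
        (simp only: f sum_distrib_left mult.assoc)
  qed
qed

text \<open>Replacing the offset by its component orthogonal to \<open>L\<close> leaves the affine
  subspace unchanged.\<close>

lemma affine_fibre_polynomial:
  fixes K L :: "'a::euclidean_space set" and y :: 'a
  assumes K: "compact K" "convex K" and L: "subspace L"
  defines "E \<equiv> (\<lambda>x. x + y) ` L"
  obtains c where "\<And>r. 0 \<le> r \<Longrightarrow> (\<integral>s. indicator (par_in E (K \<inter> E) r) s * (norm s)\<^sup>2 \<partial>lebesgue_affine E) = (\<Sum>j\<le>dim L + 2. c j * r ^ j)"
proof -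
  define y' where "y' = y - proj L y"
  have y': "y' \<in> L\<^sup>\<bottom>" using L by (simp add: y'_def orth_comp_mem proj_perp)
  have E: "E = (\<lambda>x. x + y') ` L"
  proof -
    have "x + y \<in> (\<lambda>x. x + y') ` L" if "x \<in> L" for x
      by (rule image_eqI[of _ _ "x + proj L y"]) (simp_all add: y'_def subspace_add[OF L that proj_in[OF L]])
    moreover have "x + y' \<in> (\<lambda>x. x + y) ` L" if "x \<in> L" for x
      by (rule image_eqI[of _ _ "x - proj L y"]) (simp_all add: y'_def subspace_diff[OF L that proj_in[OF L]])
    ultimately show ?thesis unfolding E_def by blast
  qed
  obtain c where c: "\<And>r. 0 \<le> r \<Longrightarrow> (\<integral>x. indicator (par_along L K r) (x + y') * (norm (x + y'))\<^sup>2 \<partial>lebesgue_subspace L) = (\<Sum>j\<le>dim L + 2. c j * r ^ j)"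
    by (rule fibre_polynomial_perp[OF K L y']) blast
  show thesis
  proof (rule that)
    fix r :: real assume r: "0 \<le> r"
    show "(\<integral>s. indicator (par_in E (K \<inter> E) r) s * (norm s)\<^sup>2 \<partial>lebesgue_affine E) = (\<Sum>j\<le>dim L + 2. c j * r ^ j)"
      unfolding E fibre_integral[OF L K(1) r] by (rule c[OF r])
  qed
qed

section \<open>Derivatives and quermassintegrals read off from coefficients\<close>

lemma higher_deriv_poly_0:
  fixes p :: "real poly"
  shows "(deriv ^^ j) (poly p) 0 = fact j * coeff p j"
proof -
  have 1: "(deriv ^^ j) (poly p) = poly ((pderiv ^^ j) p)"
  proof (induction j)
    case (Suc j)
    have "deriv (poly q) = poly (pderiv q)" for q :: "real poly"
      by (rule ext) (rule DERIV_imp_deriv, rule poly_DERIV)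
    then show ?case using Suc by simp
  qed simp
  have 2: "coeff ((pderiv ^^ j) p) i * fact i = fact (i + j) * coeff p (i + j)" for i
  proof (induction j arbitrary: i)
    case (Suc j)
    have "coeff ((pderiv ^^ Suc j) p) i * fact i = coeff ((pderiv ^^ j) p) (Suc i) * fact (Suc i)"
      by (simp add: coeff_pderiv mult_ac)
    then show ?case using Suc[of "Suc i"] by simp
  qed simp
  show ?thesis using 2[of 0] by (simp add: 1 poly_0_coeff_0)
qed

text \<open>Two polynomials that agree on the half-line have infinitely many common values and
  coincide, so the description has exactly one solution.\<close>

lemma deriv0_polynomial:
  assumes f: "\<And>r. 0 \<le> r \<Longrightarrow> f r = (\<Sum>j\<le>m. c j * r ^ j)"
  shows "deriv0 j f = (if j \<le> m then fact j * c j else 0)"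
proof -
  define q where "q = (\<Sum>l\<le>m. monom (c l) l)"
  have pq: "poly q x = (\<Sum>l\<le>m. c l * x ^ l)" for x by (simp add: q_def poly_sum poly_monom)
  have "coeff q j = (if j \<le> m then c j else 0)" by (simp add: q_def coeff_sum)
  then have d: "(deriv ^^ j) (poly q) 0 = (if j \<le> m then fact j * c j else 0)" by (simp add: higher_deriv_poly_0)
  show ?thesis unfolding deriv0_def
  proof (rule the_equality)
    show "\<exists>p. (\<forall>\<epsilon>\<ge>0. f \<epsilon> = poly p \<epsilon>) \<and> (if j \<le> m then fact j * c j else 0) = (deriv ^^ j) (poly p) 0"
      using f d by (intro exI[of _ q]) (simp add: pq)
    fix x assume "\<exists>p. (\<forall>\<epsilon>\<ge>0. f \<epsilon> = poly p \<epsilon>) \<and> x = (deriv ^^ j) (poly p) 0"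
    then obtain p where p: "\<And>r. 0 \<le> r \<Longrightarrow> f r = poly p r" "x = (deriv ^^ j) (poly p) 0" by blast
    have "p - q = 0"
    proof (rule ccontr)
      assume "p - q \<noteq> 0"
      then have "finite {x. poly (p - q) x = 0}" by (rule poly_roots_finite)
      moreover have "{0..} \<subseteq> {x. poly (p - q) x = 0}" using p(1) f pq by auto
      ultimately have "finite {0::real..}" by (rule finite_subset[rotated])
      then show False by (simp add: infinite_Ici)
    qed
    then show "x = (if j \<le> m then fact j * c j else 0)" using p(2) d by simp
  qed
qed

text \<open>The volume expansion determines \<open>W i\<close> exactly for
  \<open>i \<le> DIM('a)\<close>; in this range the binomial factor is nonzero and uniqueness of
  coefficients resolves the description.\<close>

lemma quermass_polynomial:
  fixes K :: "'a::euclidean_space set"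
  assumes f: "\<And>r. 0 \<le> r \<Longrightarrow> measure lborel (par_along UNIV K r) = (\<Sum>j\<le>DIM('a). w j * r ^ j)" and i: "i \<le> DIM('a)"
  shows "w i = real (DIM('a) choose i) * quermass i K"
proof -
  have "quermass i K = w i / real (DIM('a) choose i)" unfolding quermass_def
  proof (rule the_equality)
    show "\<exists>W. (\<forall>\<epsilon>\<ge>0. measure lborel (par_body K \<epsilon>) = (\<Sum>l\<le>DIM('a). real (DIM('a) choose l) * W l * \<epsilon> ^ l)) \<and> w i / real (DIM('a) choose i) = W i"
      by (intro exI[of _ "\<lambda>l. w l / real (DIM('a) choose l)"]) (auto simp: par_body_eq f intro!: sum.cong)
    fix x assume "\<exists>W. (\<forall>\<epsilon>\<ge>0. measure lborel (par_body K \<epsilon>) = (\<Sum>l\<le>DIM('a). real (DIM('a) choose l) * W l * \<epsilon> ^ l)) \<and> x = W i"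
    then obtain W where W: "\<And>r. 0 \<le> r \<Longrightarrow> measure lborel (par_along UNIV K r) = (\<Sum>l\<le>DIM('a). (real (DIM('a) choose l) * W l) * r ^ l)" "x = W i"
      by (auto simp: par_body_eq)
    have "fact i * w i = fact i * (real (DIM('a) choose i) * W i)"
      using deriv0_polynomial[OF f, of i] deriv0_polynomial[OF W(1), of i] i by simp
    then show "x = w i / real (DIM('a) choose i)" using W(2) i by (simp add: field_simps)
  qed
  then show ?thesis using i by simp
qed

text \<open>Passage to real integrals: the iterated nonnegative integral is finite, so the inner one
  is finite almost everywhere and \<open>enn2real\<close> loses nothing.\<close>

lemma integral_split:
  fixes L :: "'a::euclidean_space set" and u :: "'a \<Rightarrow> real"
  assumes L: "subspace L" and u[measurable]: "u \<in> borel_measurable borel" and pos: "\<And>s. 0 \<le> u s"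
    and int: "integrable lborel u"
  shows "integrable (lebesgue_subspace (L\<^sup>\<bottom>)) (\<lambda>y. \<integral>x. u (x + y) \<partial>lebesgue_subspace L)"
    and "(\<integral>y. (\<integral>x. u (x + y) \<partial>lebesgue_subspace L) \<partial>lebesgue_subspace (L\<^sup>\<bottom>))
      = enn2real (split_const TYPE('a) (dim L)) * (\<integral>s. u s \<partial>lborel)"
proof -
  let ?m = "lebesgue_subspace L" and ?m' = "lebesgue_subspace (L\<^sup>\<bottom>)"
  interpret m: sigma_finite_measure ?m using L by (rule sigma_finite_lebesgue_subspace)
  define X where "X y = (\<integral>\<^sup>+x. ennreal (u (x + y)) \<partial>?m)" for y
  have X[measurable]: "X \<in> borel_measurable ?m'" unfolding X_def by measurable
  have f: "(\<integral>x. u (x + y) \<partial>?m) = enn2real (X y)" for y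
    unfolding X_def by (intro integral_eq_nn_integral) (auto simp: pos)
  have nX: "(\<integral>\<^sup>+y. X y \<partial>?m') = split_const TYPE('a) (dim L) * (\<integral>\<^sup>+s. ennreal (u s) \<partial>lborel)"
    unfolding X_def by (rule nn_integral_split(1)[OF L, of "\<lambda>s. ennreal (u s)"]) measurable
  have fin: "(\<integral>\<^sup>+s. ennreal (u s) \<partial>lborel) < top"
    using int pos by (simp add: integrable_iff_bounded)
  have nfin: "(\<integral>\<^sup>+y. X y \<partial>?m') < top"
    unfolding nX using fin nn_integral_split(2)[OF L u[THEN measurable_compose[OF _ measurable_ennreal]]]
    by (simp add: ennreal_mult_less_top)
  have AEX: "AE y in ?m'. ennreal (enn2real (X y)) = X y"
  proof -
    have "AE y in ?m'. X y \<noteq> \<infinity>" using nfin by (intro nn_integral_PInf_AE) auto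
    then show ?thesis by eventually_elim (simp add: less_top)
  qed
  have e: "(\<integral>\<^sup>+y. ennreal (enn2real (X y)) \<partial>?m') = (\<integral>\<^sup>+y. X y \<partial>?m')" by (rule nn_integral_cong_AE[OF AEX])
  show "integrable ?m' (\<lambda>y. \<integral>x. u (x + y) \<partial>?m)" unfolding f
    using nfin e by (intro integrableI_nonneg) auto
  have "(\<integral>y. enn2real (X y) \<partial>?m') = enn2real (\<integral>\<^sup>+y. ennreal (enn2real (X y)) \<partial>?m')"
    by (intro integral_eq_nn_integral) auto
  also have "\<dots> = enn2real (split_const TYPE('a) (dim L)) * enn2real (\<integral>\<^sup>+s. ennreal (u s) \<partial>lborel)"
    unfolding e nX by (simp add: enn2real_mult)
  also have "enn2real (\<integral>\<^sup>+s. ennreal (u s) \<partial>lborel) = (\<integral>s. u s \<partial>lborel)"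
    by (intro integral_eq_nn_integral[symmetric]) (auto simp: pos)
  finally show "(\<integral>y. (\<integral>x. u (x + y) \<partial>?m) \<partial>?m') = enn2real (split_const TYPE('a) (dim L)) * (\<integral>s. u s \<partial>lborel)"
    unfolding f .
qed

section \<open>The integral over affine subspaces\<close>

lemma integrable_par_sq:
  fixes K L :: "'a::euclidean_space set"
  assumes K: "compact K" and L: "subspace L"
  shows "integrable lborel (\<lambda>s. indicator (par_along L K r) s * (norm s)\<^sup>2 :: real)"
proof -
  have c: "compact (par_along L K r)" by (rule compact_par_along[OF K L])
  then have [measurable]: "par_along L K r \<in> sets borel" by (rule borel_compact)
  obtain R where R: "\<And>x. x \<in> par_along L K r \<Longrightarrow> norm x \<le> R" using compact_imp_bounded[OF c] bounded_pos by blast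
  show ?thesis
  proof (rule integrable_cball_bound[of _ "R\<^sup>2" R])
    show "\<bar>indicator (par_along L K r) s * (norm s)\<^sup>2\<bar> \<le> R\<^sup>2 * indicator (cball 0 R) s" for s
      using R[of s] by (auto simp: indicator_def intro: power_mono)
  qed measurable
qed

lemma (in haar) integrable_average:
  fixes K :: "'a set"
  assumes K: "compact K"
  shows "integrable \<nu> (\<lambda>L. \<integral>s. indicator (par_along L K r) s * (norm s)\<^sup>2 \<partial>lborel)"
proof -
  obtain R where R: "\<And>x. x \<in> K \<Longrightarrow> norm x \<le> R" using compact_imp_bounded[OF K] bounded_pos by blast
  have sub: "par_along L K r \<subseteq> cball 0 (R + r)" for L
  proof
    fix s assume "s \<in> par_along L K r"
    then obtain x where x: "x \<in> K" "norm (s - x) \<le> r" by (auto simp: par_along_def)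
    then show "s \<in> cball 0 (R + r)" using R[OF x(1)] norm_triangle_sub[of s x] by simp
  qed
  show ?thesis
  proof (rule integrable_const_bound[of _ "\<integral>s. (R + r)\<^sup>2 * indicator (cball (0::'a) (R + r)) s \<partial>lborel"])
    show "AE L in \<nu>. norm (\<integral>s. indicator (par_along L K r) s * (norm s)\<^sup>2 \<partial>lborel) \<le> (\<integral>s. (R + r)\<^sup>2 * indicator (cball (0::'a) (R + r)) s \<partial>lborel)"
      using par_integral_bound[OF sub borel_par_along[OF K]] by (intro AE_I2) (simp add: grass_def)
  qed (intro measurable_par_integral K, measurable)
qed

text \<open>On each fibre the derivative is a fixed linear combination of the fibre integrals at the
  radii \<open>1\<close> to \<open>k + 3\<close>. These are integrable, so both outer integrations
  act on values; interpolating the averaged values with the same \<open>\<Lambda>\<close> returns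
  the coefficient \<open>i j\<close>.\<close>

lemma crofton_value:
  fixes K :: "'a::euclidean_space set"
  assumes K: "compact K" "convex K" and k: "k \<le> DIM('a)"
    and i: "\<And>r. 0 \<le> r \<Longrightarrow> (\<integral>L. (\<integral>s. indicator (par_along L K r) s * (norm s)\<^sup>2 \<partial>lborel) \<partial>haar_grass k) = (\<Sum>j\<le>k + 2. i j * r ^ j)"
  shows "I_j k j K = (if j \<le> k + 2 then enn2real (split_const TYPE('a) k) * fact j * i j else 0)"
proof -
  interpret haar "haar_grass k :: 'a set measure" k
    by unfold_locales (rule haar_like_haar_grass[OF k])
  let ?\<nu> = "haar_grass k :: 'a set measure" and ?c = "enn2real (split_const TYPE('a) k)"
  let ?E = "\<lambda>L y. (\<lambda>x. x + y) ` L"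
  let ?F = "\<lambda>L y r. \<integral>s. indicator (par_in (?E L y) (K \<inter> ?E L y) r) s * (norm s)\<^sup>2 \<partial>lebesgue_affine (?E L y)"
  let ?f = "\<lambda>L y r. \<integral>x. indicator (par_along L K r) (x + y) * (norm (x + y))\<^sup>2 \<partial>lebesgue_subspace L"
  let ?g = "\<lambda>r L. \<integral>s. indicator (par_along L K r) s * (norm s)\<^sup>2 \<partial>lborel"
  obtain \<Lambda> :: "nat \<Rightarrow> nat \<Rightarrow> real" where \<Lambda>: "\<And>c j. j \<le> k + 2 \<Longrightarrow> c j = (\<Sum>l\<le>k + 2. \<Lambda> j l * (\<Sum>t\<le>k + 2. c t * real (Suc l) ^ t))"
    using lagrange_coefficients[of "k + 2"] by blast
  \<comment> \<open>Replaces the description \<open>deriv0\<close> by finitely many values with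
    weights independent of \<open>L\<close> and \<open>y\<close>, which also settles integrability
    in both variables.\<close>
  have d: "deriv0 j (?F L y) = (if j \<le> k + 2 then fact j * (\<Sum>l\<le>k + 2. \<Lambda> j l * ?f L y (real (Suc l))) else 0)"
    if L: "L \<in> grass k" for L y
  proof -
    have L': "subspace L" "dim L = k" using L by (auto simp: grass_def)
    obtain c where "\<And>r. 0 \<le> r \<Longrightarrow> ?F L y r = (\<Sum>j\<le>dim L + 2. c j * r ^ j)"
      by (rule affine_fibre_polynomial[OF K L'(1), of y]) blast
    note c = this[unfolded L'(2)]
    have "?f L y (real (Suc l)) = (\<Sum>t\<le>k + 2. c t * real (Suc l) ^ t)" for l
      using c[of "real (Suc l)"] fibre_integral[OF L'(1) K(1), of "real (Suc l)" y] by simp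
    then show ?thesis using deriv0_polynomial[OF c, of j] \<Lambda>[of j c] by simp
  qed
  have I: "I_j k j K = (\<integral>L. (\<integral>y. deriv0 j (?F L y) \<partial>lebesgue_subspace (L\<^sup>\<bottom>)) \<partial>?\<nu>)"
    by (simp add: I_j_def int_affgrass_def)
  show ?thesis
  proof (cases "j \<le> k + 2")
    case False
    \<comment> \<open>The fibre polynomials have degree at most \<open>k + 2\<close>, so the
      integrand itself is \<open>0\<close>.\<close>
    have z: "deriv0 j (?F L y) = 0" if "L \<in> grass k" for L y using d[OF that, of y] False by (simp only: if_False)
    have "I_j k j K = (\<integral>L. 0 \<partial>?\<nu>)" unfolding I
      by (intro Bochner_Integration.integral_cong refl) (simp add: z)
    then show ?thesis using False by simp
  next
    case True
    have "(\<integral>y. deriv0 j (?F L y) \<partial>lebesgue_subspace (L\<^sup>\<bottom>)) = fact j * (\<Sum>l\<le>k + 2. \<Lambda> j l * (?c * ?g (real (Suc l)) L))"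
      if L: "L \<in> grass k" for L
    proof -
      have L': "subspace L" "dim L = k" using L by (auto simp: grass_def)
      have [measurable]: "par_along L K r \<in> sets borel" for r using K(1) L'(1) by (rule borel_par_along)
      have sp: "integrable (lebesgue_subspace (L\<^sup>\<bottom>)) (\<lambda>y. ?f L y r)"
        "(\<integral>y. ?f L y r \<partial>lebesgue_subspace (L\<^sup>\<bottom>)) = ?c * ?g r L" for r
        using integral_split[OF L'(1) _ _ integrable_par_sq[OF K(1) L'(1)], of r] L'(2) by auto
      have "(\<integral>y. deriv0 j (?F L y) \<partial>lebesgue_subspace (L\<^sup>\<bottom>))
        = (\<integral>y. fact j * (\<Sum>l\<le>k + 2. \<Lambda> j l * ?f L y (real (Suc l))) \<partial>lebesgue_subspace (L\<^sup>\<bottom>))"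
        using True by (simp only: d[OF L] if_True)
      also have "\<dots> = fact j * (\<Sum>l\<le>k + 2. \<Lambda> j l * (\<integral>y. ?f L y (real (Suc l)) \<partial>lebesgue_subspace (L\<^sup>\<bottom>)))"
        using sp(1) by (simp add: Bochner_Integration.integral_sum del: of_nat_Suc)
      finally show ?thesis by (simp only: sp(2))
    qed
    then have "I_j k j K = (\<integral>L. fact j * (\<Sum>l\<le>k + 2. \<Lambda> j l * (?c * ?g (real (Suc l)) L)) \<partial>?\<nu>)"
      unfolding I by (intro Bochner_Integration.integral_cong refl) simp
    also have "\<dots> = fact j * (\<Sum>l\<le>k + 2. \<Lambda> j l * (?c * (\<integral>L. ?g (real (Suc l)) L \<partial>?\<nu>)))"
      using integrable_average[OF K(1)] by (simp add: Bochner_Integration.integral_sum del: of_nat_Suc)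
    also have "\<dots> = fact j * (\<Sum>l\<le>k + 2. ?c * (\<Lambda> j l * (\<Sum>t\<le>k + 2. i t * real (Suc l) ^ t)))"
    proof -
      have "(\<integral>L. ?g (real (Suc l)) L \<partial>?\<nu>) = (\<Sum>t\<le>k + 2. i t * real (Suc l) ^ t)" for l by (rule i) simp
      then show ?thesis by (simp only: mult.left_commute)
    qed
    also have "\<dots> = fact j * (?c * i j)" unfolding sum_distrib_left[symmetric] using \<Lambda>[OF True, of i] by simp
    finally show ?thesis using True by simp
  qed
qed

theorem theorem5p1:
  fixes k j :: nat
  assumes "DIM('a::euclidean_space) \<ge> 2" and "1 \<le> k" and "k \<le> DIM('a) - 1"
  shows "\<exists>\<alpha>1 \<alpha>2 \<beta>2 \<beta>3 :: real. \<forall>K :: 'a set. compact K \<and> convex K \<and> K \<noteq> {} \<longrightarrow>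
           (j \<le> 1 \<longrightarrow> I_j k j K = \<alpha>1 * V_j j K) \<and>
           (2 \<le> j \<and> j \<le> k \<longrightarrow> I_j k j K = \<alpha>2 * V_j j K + \<beta>2 * quermass (j - 2) K) \<and>
           ((j = k + 1 \<or> j = k + 2) \<longrightarrow> I_j k j K = \<beta>3 * quermass (j - 2) K) \<and>
           (j > k + 2 \<longrightarrow> I_j k j K = 0)"
proof -
  have k: "k \<le> DIM('a)" "k + 2 \<le> DIM('a) + 2" using assms by auto
  interpret haar "haar_grass k :: 'a set measure" k
    by unfold_locales (rule haar_like_haar_grass[OF k(1)])
  let ?c = "enn2real (split_const TYPE('a) k)"
  \<comment> \<open>One pair of constants serves all cases; \<open>a0\<close> and \<open>b0\<close>
    show which of the two vanishes for the given \<open>j\<close>.\<close>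
  define \<alpha> where "\<alpha> = ?c * ratio j"
  define \<beta> where "\<beta> = (if 2 \<le> j then ?c * fact j * correction j * real (DIM('a) choose (j - 2)) else 0)"
  have main: "I_j k j K = (if j \<le> k + 2 then \<alpha> * V_j j K + \<beta> * quermass (j - 2) K else 0)"
    if K: "compact K" "convex K" "K \<noteq> {}" for K :: "'a set"
  proof -
    obtain v w i where V: "\<And>r. 0 \<le> r \<Longrightarrow> (\<integral>s. indicator (par_along UNIV K r) s * (norm s)\<^sup>2 \<partial>lborel) = (\<Sum>j\<le>DIM('a) + 2. v j * r ^ j)"
      and W: "\<And>r. 0 \<le> r \<Longrightarrow> measure lborel (par_along UNIV K r) = (\<Sum>j\<le>DIM('a). w j * r ^ j)"
      and I: "\<And>r. 0 \<le> r \<Longrightarrow> (\<integral>L. (\<integral>s. indicator (par_along L K r) s * (norm s)\<^sup>2 \<partial>lborel) \<partial>haar_grass k) = (\<Sum>j\<le>DIM('a) + 2. i j * r ^ j)"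
      and rel: "\<And>j. j \<le> DIM('a) + 2 \<Longrightarrow> i j = ratio j * v j + (if 2 \<le> j then correction j * w (j - 2) else 0)"
      by (rule average_coefficients[OF K]) blast
    \<comment> \<open>\<open>ratio\<close> vanishes beyond \<open>k\<close> and
      \<open>correction\<close> beyond \<open>k + 2\<close>, which lowers the degree of the averaged
      polynomial to the one \<open>crofton_value\<close> expects.\<close>
    have i0: "i j = 0" if "j \<in> {..DIM('a) + 2} - {..k + 2}" for j
      using that rel[of j] by (simp add: ratio_eq_0 correction_eq_0)
    have I': "(\<integral>L. (\<integral>s. indicator (par_along L K r) s * (norm s)\<^sup>2 \<partial>lborel) \<partial>haar_grass k) = (\<Sum>j\<le>k + 2. i j * r ^ j)" if "0 \<le> r" for r
      unfolding I[OF that] using k(2) i0 by (intro sum.mono_neutral_right) auto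
    note val = crofton_value[OF K(1,2) k(1) I', of j]
    show ?thesis
    proof (cases "j \<le> k + 2")
      case True
      then have jd: "j \<le> DIM('a) + 2" using k(2) by linarith
      have "(\<integral>s. indicator (par_body K r) s * (norm s)\<^sup>2 \<partial>lborel) = (\<Sum>j\<le>DIM('a) + 2. v j * r ^ j)" if "0 \<le> r" for r
        using V[OF that] by (simp add: par_body_eq[OF that])
      from deriv0_polynomial[OF this, of j] have Vj: "V_j j K = fact j * v j" using jd by (simp add: V_j_def)
      have Wj: "w (j - 2) = real (DIM('a) choose (j - 2)) * quermass (j - 2) K"
        by (rule quermass_polynomial[OF W]) (use jd in auto)
      have "I_j k j K = ?c * fact j * (ratio j * v j + (if 2 \<le> j then correction j * w (j - 2) else 0))"
        using val True by (simp add: rel[OF jd])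
      also have "\<dots> = \<alpha> * V_j j K + \<beta> * quermass (j - 2) K"
        by (simp add: Vj Wj \<alpha>_def \<beta>_def algebra_simps)
      finally show ?thesis using True by simp
    qed (use val in simp)
  qed
  have a0: "\<alpha> = 0" if "j = k + 1 \<or> j = k + 2" using that by (auto simp: \<alpha>_def ratio_eq_0)
  have b0: "\<beta> = 0" if "j \<le> 1" using that by (simp add: \<beta>_def)
  show ?thesis
    by (intro exI[of _ \<alpha>] exI[of _ \<alpha>] exI[of _ \<beta>] exI[of _ \<beta>]) (use main a0 b0 assms in auto)
qed

end
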